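(* Let $F=\{\sigma_1,\dots,\sigma_n\}\subset\partial\mathbb{D}$ consist of pairwise distinct points, let $\tau\in\overline{\mathbb{D}}\setminus F$, and let $\Lambda=(\lambda_1,\dots,\lambda_n)\in(-\infty,0)^n$. (A) A function $G:\mathbb{D}\to\mathbb{C}$ belongs to $\mathsf{Gen}_\tau(F,\Lambda)\setminus\{G\equiv0\}$ if and only if there exists a Herglotz function $p$ such that $$G(z)=\frac{(\tau-z)(1-\overline\tau z)}{p(z)+p_0(z;F,\Lambda)}\quad\text{for all } z\in\mathbb{D}.$$ (B) A function $G:\mathbb{D}\to\mathbb{C}$ belongs to $\mathsf{Gen}'_\tau(F,\Lambda)$ if and only if the same formula holds with some Herglotz function $p$ satisfying $p^{\star}(\sigma_k)=0$ for all $k=1,\dots,n$.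
   Context: $\mathbb{D}$ is the open unit disk. A Herglotz function is a holomorphic $p:\mathbb{D}\to\mathbb{C}$ with $\mathrm{Re}\, p\ge0$. For a Herglotz function $p$ and $\sigma\in\partial\mathbb{D}$, set $p^{\star}(\sigma):=\angle\lim_{z\to\sigma}(1-\overline\sigma z)p(z)$; this angular limit always exists in $[0,\infty)$. A one-parameter semigroup is a family $(\phi_t)_{t\ge0}$ of holomorphic self-maps of $\mathbb{D}$ with $\phi_0=\mathrm{id}$, $\phi_s\circ\phi_t=\phi_{s+t}$, and $\phi_t(z)\to z$ as $t\to0^+$. Its infinitesimal generator is the holomorphic $G$ with $\frac{d}{dt}\phi_t(z)=G(\phi_t(z))$. For a non-trivial semigroup, all $\phi_t\neq\mathrm{id}$ share a Denjoy–Wolff point $\tau\in\overline{\mathbb{D}}$. We write $G\in\mathsf{Gen}_\tau$ if $\tau$ is the Denjoy–Wolff point of the semigroup generated by $G$; by convention $G\equiv0$ belongs to $\mathsf{Gen}_\tau$ for every $\tau$. A point $\sigma\in\partial\mathbb{D}$ is a boundary regular fixed point (BRFP) of the semigroup if, for every $t$, $\phi_t$ has angular limit $\sigma$ at $\sigma$ and a finite angular derivative $\phi_t'(\sigma)$. In that case $\phi_t'(\sigma)=e^{-\lambda t}$ for a real number $\lambda$, called the spectral value at $\sigma$; equivalently $\lambda=\angle\lim_{z\to\sigma}G(z)/(\sigma-z)$. $\mathsf{Gen}_\tau(F,\Lambda)$ is the class of all $G\in\mathsf{Gen}_\tau$ whose semigroup has BRFPs at $\sigma_1,\dots,\sigma_n$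 with spectral values $\lambda_k'$ satisfying $\lambda_k\le\lambda_k'\le0$, $k=1,\dots,n$; it contains $G\equiv0$. $\mathsf{Gen}'_\tau(F,\Lambda)$ is the subclass where $\lambda'_k=\lambda_k$ for all $k$. Finally, $$p_0(z;F,\Lambda):=\sum_{k=1}^n\alpha_k\frac{\sigma_k+z}{\sigma_k-z},\qquad \alpha_k:=\frac{|\tau-\sigma_k|^2}{2|\lambda_k|}.$$ *)

theory Defs
  imports "HOL-Analysis.Analysis"
begin

abbreviation unit_disk :: "complex set" where
  "unit_disk \<equiv> ball 0 1"

definition stolz_angle :: "complex \<Rightarrow> real \<Rightarrow> complex set" where
  "stolz_angle \<sigma> M = {z. cmod z < 1 \<and> cmod (\<sigma> - z) < M * (1 - cmod z)}"

definition has_angular_limit :: "(complex \<Rightarrow> complex) \<Rightarrow> complex \<Rightarrow> complex \<Rightarrow> bool" where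
  "has_angular_limit f \<sigma> L \<longleftrightarrow> (\<forall>M>1. (f \<longlongrightarrow> L) (at \<sigma> within stolz_angle \<sigma> M))"

definition herglotz :: "(complex \<Rightarrow> complex) \<Rightarrow> bool" where
  "herglotz p \<longleftrightarrow> p holomorphic_on unit_disk \<and> (\<forall>z\<in>unit_disk. Re (p z) \<ge> 0)"

definition pstar_eq :: "(complex \<Rightarrow> complex) \<Rightarrow> complex \<Rightarrow> complex \<Rightarrow> bool" where
  "pstar_eq p \<sigma> c \<longleftrightarrow> has_angular_limit (\<lambda>z. (1 - cnj \<sigma> * z) * p z) \<sigma> c"

definition semigroup_disk :: "(real \<Rightarrow> complex \<Rightarrow> complex) \<Rightarrow> bool" where
  "semigroup_disk \<phi> \<longleftrightarrow>
     (\<forall>t\<ge>0. \<phi> t holomorphic_on unit_disk \<and> \<phi> t ` unit_disk \<subseteq> unit_disk) \<and>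
     (\<forall>z\<in>unit_disk. \<phi> 0 z = z) \<and>
     (\<forall>s\<ge>0. \<forall>t\<ge>0. \<forall>z\<in>unit_disk. \<phi> s (\<phi> t z) = \<phi> (s + t) z) \<and>
     (\<forall>z\<in>unit_disk. ((\<lambda>t. \<phi> t z) \<longlongrightarrow> z) (at_right 0))"

definition generator_of :: "(real \<Rightarrow> complex \<Rightarrow> complex) \<Rightarrow> (complex \<Rightarrow> complex) \<Rightarrow> bool" where
  "generator_of \<phi> G \<longleftrightarrow> G holomorphic_on unit_disk \<and>
     (\<forall>z\<in>unit_disk. \<forall>t\<ge>0.
        ((\<lambda>s. \<phi> s z) has_vector_derivative G (\<phi> t z)) (at t within {0..}))"

definition DW_point :: "(complex \<Rightarrow> complex) \<Rightarrow> complex \<Rightarrow> bool" where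
  "DW_point f \<tau> \<longleftrightarrow>
     (\<tau> \<in> unit_disk \<and> f \<tau> = \<tau>) \<or>
     (cmod \<tau> = 1 \<and> (\<forall>z\<in>unit_disk. (\<lambda>n. (f ^^ n) z) \<longlonglongrightarrow> \<tau>))"

definition BRFP_spectral :: "(real \<Rightarrow> complex \<Rightarrow> complex) \<Rightarrow> complex \<Rightarrow> real \<Rightarrow> bool" where
  "BRFP_spectral \<phi> \<sigma> lam \<longleftrightarrow> cmod \<sigma> = 1 \<and>
     (\<forall>t\<ge>0. has_angular_limit (\<phi> t) \<sigma> \<sigma> \<and>
        has_angular_limit (\<lambda>z. (\<phi> t z - \<sigma>) / (z - \<sigma>)) \<sigma> (complex_of_real (exp (- lam * t))))"

definition semigroup_DW :: "(real \<Rightarrow> complex \<Rightarrow> complex) \<Rightarrow> complex \<Rightarrow> bool" where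
  "semigroup_DW \<phi> \<tau> \<longleftrightarrow> (\<forall>t\<ge>0. \<not> (\<forall>z\<in>unit_disk. \<phi> t z = z) \<longrightarrow> DW_point (\<phi> t) \<tau>)"

text \<open>Gen_tau: generators whose semigroup has DW point tau (contains G = 0 automatically).\<close>
definition Gen :: "complex \<Rightarrow> (complex \<Rightarrow> complex) \<Rightarrow> bool" where
  "Gen \<tau> G \<longleftrightarrow> (\<exists>\<phi>. semigroup_disk \<phi> \<and> generator_of \<phi> G \<and> semigroup_DW \<phi> \<tau>)"

text \<open>Gen_tau(F, Lambda), with F = {sigma 0, ..., sigma (n-1)} and Lambda = (lam 0, ..., lam (n-1)).\<close>
definition Gen_FL :: "complex \<Rightarrow> (nat \<Rightarrow> complex) \<Rightarrow> (nat \<Rightarrow> real) \<Rightarrow> nat \<Rightarrow> (complex \<Rightarrow> complex) \<Rightarrow> bool" where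
  "Gen_FL \<tau> \<sigma> lam n G \<longleftrightarrow>
     (\<exists>\<phi>. semigroup_disk \<phi> \<and> generator_of \<phi> G \<and> semigroup_DW \<phi> \<tau> \<and>
        (\<forall>k<n. \<exists>lam'. lam k \<le> lam' \<and> lam' \<le> 0 \<and> BRFP_spectral \<phi> (\<sigma> k) lam'))"

definition Gen'_FL :: "complex \<Rightarrow> (nat \<Rightarrow> complex) \<Rightarrow> (nat \<Rightarrow> real) \<Rightarrow> nat \<Rightarrow> (complex \<Rightarrow> complex) \<Rightarrow> bool" where
  "Gen'_FL \<tau> \<sigma> lam n G \<longleftrightarrow>
     (\<exists>\<phi>. semigroup_disk \<phi> \<and> generator_of \<phi> G \<and> semigroup_DW \<phi> \<tau> \<and>
        (\<forall>k<n. BRFP_spectral \<phi> (\<sigma> k) (lam k)))"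

definition p0 :: "complex \<Rightarrow> (nat \<Rightarrow> complex) \<Rightarrow> (nat \<Rightarrow> real) \<Rightarrow> nat \<Rightarrow> complex \<Rightarrow> complex" where
  "p0 \<tau> \<sigma> lam n z =
     (\<Sum>k<n. complex_of_real ((cmod (\<tau> - \<sigma> k))\<^sup>2 / (2 * \<bar>lam k\<bar>)) * ((\<sigma> k + z) / (\<sigma> k - z)))"

end

theory Submission
  imports Defs "HOL-Complex_Analysis.Complex_Analysis"
begin

text \<open>
  By Berkson and Porta, a non-zero generator with Denjoy-Wolff point \<open>\<tau>\<close> is
  \<open>(\<tau> - z) (1 - cnj \<tau> z) / Q(z)\<close> with a Herglotz function \<open>Q\<close>. Everything about a
  BRFP \<open>\<sigma> \<noteq> \<tau>\<close> is encoded in the mass \<open>c\<close> of \<open>Q\<close> at \<open>\<sigma>\<close>, that is, the angular limit of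
  \<open>(1 - cnj \<sigma> z) Q(z)\<close>: the point \<open>\<sigma>\<close> is a BRFP iff \<open>c > 0\<close>, and then the spectral value is
  \<open>- |\<tau> - \<sigma>|^2 / c\<close>. The bounds on the spectral values thus say that the masses of \<open>Q\<close> dominate
  those of \<open>p0\<close>, so that \<open>Q - p0\<close> is again a Herglotz function.

  All the boundary estimates come from the Schwarz-Pick inequality, in the form it takes for
  functions with non-negative real part. The semigroup of a given \<open>Q\<close> is obtained on the right
  half-plane: the equation \<open>v' = g(v)\<close> with \<open>Re g > 0\<close> is linearized by a primitive \<open>h\<close> of \<open>1 / g\<close>,
  which is injective as \<open>Re h' > 0\<close>, so its flow is \<open>h^-1 (h + t)\<close>.
\<close>

section \<open>The Schwarz-Pick inequality\<close>

text \<open>The kernel \<open>cayley \<sigma>\<close> has mass 2 at \<sigma>, so \<open>p0\<close>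
  has mass \<open>|\<tau> - \<sigma> k|^2 / |lam k|\<close> at \<open>\<sigma> k\<close>; this fixes
  the coefficients of \<open>p0\<close>. Masses are handled without representing measures: the mass
  is twice the largest \<open>k\<close> for which \<open>k * Re (cayley \<sigma> z)\<close> stays
  below the real part.

  The two passages between masses and boundary fixed points differ in strength. From a fixed point,
  Julia's inequality differentiated at time 0 yields only a lower bound for the mass. Conversely,
  the mass determines the angular derivative of every \<open>\<phi> t\<close>, with an exact
  spectral value. Equality of spectral values in the second equivalence therefore rests on the exact
  direction and on the uniqueness of spectral values.

  For the flow, the obstacle is that the image of \<open>h\<close> must be invariant under
  translation to the right, that is, no orbit may blow up in finite time. Monotonicity of the real
  part alone does not give this; the Schwarz-Pick bound \<open>|g'(w)| Re w \<le> Re (g w)\<close>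
  does.\<close>

lemma pseudo_hyperbolic_identity:
  "(cmod (1 - cnj w * z))\<^sup>2 - (cmod (z - w))\<^sup>2 = (1 - (cmod z)\<^sup>2) * (1 - (cmod w)\<^sup>2)"
  unfolding cmod_power2 by (simp add: power2_eq_square algebra_simps)

lemma one_minus_cnj_mult_nonzero:
  assumes "cmod w \<le> 1" "cmod z < 1"
  shows "1 - cnj w * z \<noteq> 0"
proof
  assume "1 - cnj w * z = 0"
  hence "cmod (cnj w * z) = 1" by (metis norm_one right_minus_eq)
  moreover have "cmod w * cmod z \<le> 1 * cmod z" using assms by (intro mult_right_mono) auto
  ultimately show False using assms by (simp add: norm_mult)
qed

lemma one_minus_norm_square_pos: "cmod z < 1 \<Longrightarrow> 0 < 1 - (cmod z)\<^sup>2"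
  by (simp add: abs_square_less_1)

text \<open>The Schwarz lemma for \<open>F\<close>, which is \<open>f\<close> conjugated by disk
  automorphisms so that \<open>w\<close> and \<open>f w\<close> both become 0. Written without
  quotients, the inequality passes directly to limits at the circle.\<close>

lemma Schwarz_Pick:
  assumes holf: "f holomorphic_on ball 0 1" and im: "\<And>z. cmod z < 1 \<Longrightarrow> cmod (f z) < 1"
    and z: "cmod z < 1" and w: "cmod w < 1"
  shows "(1 - (cmod z)\<^sup>2) * (1 - (cmod w)\<^sup>2) * (cmod (1 - cnj (f w) * f z))\<^sup>2
       \<le> (1 - (cmod (f z))\<^sup>2) * (1 - (cmod (f w))\<^sup>2) * (cmod (1 - cnj w * z))\<^sup>2"
proof -
  define F where "F = (\<lambda>u. Moebius_function 0 (f w) (f (Moebius_function 0 (-w) u)))"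
  define u where "u = Moebius_function 0 w z"
  have holF: "F holomorphic_on ball 0 1"
  proof -
    have a: "Moebius_function 0 (-w) holomorphic_on ball 0 1"
      using Moebius_function_holomorphic w by auto
    have b: "Moebius_function 0 (-w) ` ball 0 1 \<subseteq> ball 0 1"
      using Moebius_function_norm_lt_1 w by auto
    have c: "(f \<circ> Moebius_function 0 (-w)) holomorphic_on ball 0 1"
      using holomorphic_on_compose_gen[OF a holf b] .
    have d: "(f \<circ> Moebius_function 0 (-w)) ` ball 0 1 \<subseteq> ball 0 1"
      using b im by fastforce
    have "(Moebius_function 0 (f w) \<circ> (f \<circ> Moebius_function 0 (-w))) holomorphic_on ball 0 1"
      by (rule holomorphic_on_compose_gen[OF c _ d]) (simp add: Moebius_function_holomorphic im w)
    thus ?thesis by (simp add: F_def o_def)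
  qed
  have F0: "F 0 = 0" by (simp add: F_def Moebius_function_simple)
  have Fim: "cmod (F v) < 1" if "cmod v < 1" for v
    unfolding F_def by (intro Moebius_function_norm_lt_1 im) (use w that in auto)
  have u: "cmod u < 1" unfolding u_def by (intro Moebius_function_norm_lt_1 z w)
  have le: "cmod (F u) \<le> cmod u" by (rule Schwarz_Lemma(1)[OF holF F0 Fim u])
  have "Moebius_function 0 (-w) u = z"
    unfolding u_def using Moebius_function_compose[of "-w" w z] w z by simp
  hence Fu: "F u = (f z - f w) / (1 - cnj (f w) * f z)" by (simp add: F_def Moebius_function_simple)
  define A where "A = cmod (1 - cnj (f w) * f z)"
  define B where "B = cmod (1 - cnj w * z)"
  have A: "A > 0" and B: "B > 0"
    using one_minus_cnj_mult_nonzero w z im[OF w] im[OF z] by (auto simp: A_def B_def)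
  have "cmod (f z - f w) / A \<le> cmod (z - w) / B"
    using le unfolding Fu by (simp add: u_def Moebius_function_simple norm_divide A_def B_def)
  hence "cmod (f z - f w) * B \<le> cmod (z - w) * A"
    using A B by (simp add: field_simps)
  hence "(cmod (f z - f w) * B)\<^sup>2 \<le> (cmod (z - w) * A)\<^sup>2"
    using B by (intro power_mono) auto
  moreover have "(cmod (f z - f w))\<^sup>2 = A\<^sup>2 - (1 - (cmod (f z))\<^sup>2) * (1 - (cmod (f w))\<^sup>2)"
    using pseudo_hyperbolic_identity[of "f w" "f z"] by (simp add: A_def)
  moreover have "(cmod (z - w))\<^sup>2 = B\<^sup>2 - (1 - (cmod z)\<^sup>2) * (1 - (cmod w)\<^sup>2)"
    using pseudo_hyperbolic_identity[of w z] by (simp add: B_def)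
  ultimately have "(A\<^sup>2 - (1 - (cmod (f z))\<^sup>2) * (1 - (cmod (f w))\<^sup>2)) * B\<^sup>2
      \<le> (B\<^sup>2 - (1 - (cmod z)\<^sup>2) * (1 - (cmod w)\<^sup>2)) * A\<^sup>2"
    by (simp add: power_mult_distrib)
  thus ?thesis unfolding A_def[symmetric] B_def[symmetric] by (simp add: algebra_simps)
qed

text \<open>\<open>f\<close> is the Cayley transform of \<open>p\<close> into the disk. Both
  \<open>1 - |f|^2\<close> and \<open>1 - cnj (f w) * f z\<close> become explicit fractions in
  \<open>p\<close>, and their denominators cancel.\<close>

lemma Schwarz_Pick_Re_pos:
  assumes holp: "p holomorphic_on ball 0 1" and pos: "\<And>z. cmod z < 1 \<Longrightarrow> Re (p z) > 0"
    and z: "cmod z < 1" and w: "cmod w < 1"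
  shows "(cmod (p z + cnj (p w)))\<^sup>2 * (1 - (cmod z)\<^sup>2) * (1 - (cmod w)\<^sup>2)
       \<le> 4 * Re (p z) * Re (p w) * (cmod (1 - cnj w * z))\<^sup>2"
proof -
  define f where "f = (\<lambda>z. (p z - 1) / (p z + 1))"
  have nz: "p v + 1 \<noteq> 0" if "cmod v < 1" for v
  proof
    assume "p v + 1 = 0"
    hence "p v = -1" by (simp add: eq_neg_iff_add_eq_0)
    thus False using pos[OF that] by simp
  qed
  have hol: "f holomorphic_on ball 0 1"
    unfolding f_def by (intro holomorphic_intros holp) (use nz in auto)
  have id1: "1 - (cmod (f v))\<^sup>2 = 4 * Re (p v) / (cmod (p v + 1))\<^sup>2" if "cmod v < 1" for v
  proof -
    have "(cmod (p v + 1))\<^sup>2 - (cmod (p v - 1))\<^sup>2 = 4 * Re (p v)"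
      unfolding cmod_power2 by (simp add: power2_eq_square algebra_simps)
    moreover have "(cmod (f v))\<^sup>2 = (cmod (p v - 1))\<^sup>2 / (cmod (p v + 1))\<^sup>2"
      by (simp add: f_def norm_divide power_divide)
    moreover have "1 - (cmod (f v))\<^sup>2 = ((cmod (p v + 1))\<^sup>2 - (cmod (p v - 1))\<^sup>2) / (cmod (p v + 1))\<^sup>2"
      using nz[OF that] by (simp add: calculation(2) diff_divide_distrib)
    ultimately show ?thesis by simp
  qed
  have im: "cmod (f v) < 1" if "cmod v < 1" for v
  proof -
    have "1 - (cmod (f v))\<^sup>2 > 0"
      unfolding id1[OF that] using nz[OF that] pos[OF that] by (simp add: divide_pos_pos)
    thus ?thesis by (simp add: abs_square_less_1)
  qed
  define X where "X = (cmod (p z + 1))\<^sup>2"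
  define Y where "Y = (cmod (p w + 1))\<^sup>2"
  have X: "X > 0" and Y: "Y > 0" using nz z w by (auto simp: X_def Y_def)
  have nz': "cnj (p w) + 1 \<noteq> 0" using nz[OF w] by (metis complex_cnj_add complex_cnj_one complex_cnj_zero_iff)
  have "1 - cnj (f w) * f z = 2 * (p z + cnj (p w)) / ((p z + 1) * (cnj (p w) + 1))"
  proof -
    define x where "x = p z + 1"
    define y where "y = cnj (p w) + 1"
    have "x \<noteq> 0" "y \<noteq> 0" using nz[OF z] nz' by (auto simp: x_def y_def)
    have "cnj (f w) = (y - 2) / y" "f z = (x - 2) / x" by (simp_all add: f_def x_def y_def)
    hence "cnj (f w) * f z = (y - 2) * (x - 2) / (x * y)" by (simp add: mult.commute)
    hence "1 - cnj (f w) * f z = (x * y - (y - 2) * (x - 2)) / (x * y)"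
      using \<open>x \<noteq> 0\<close> \<open>y \<noteq> 0\<close> by (simp only: diff_divide_distrib) simp
    also have "x * y - (y - 2) * (x - 2) = 2 * (p z + cnj (p w))"
      by (simp add: x_def y_def algebra_simps)
    finally show ?thesis by (simp add: x_def y_def)
  qed
  hence "cmod (1 - cnj (f w) * f z) = 2 * cmod (p z + cnj (p w)) / (cmod (p z + 1) * cmod (cnj (p w) + 1))"
    by (simp only: norm_mult norm_divide norm_numeral)
  moreover have "cmod (cnj (p w) + 1) = cmod (p w + 1)"
    by (metis complex_cnj_add complex_cnj_one complex_mod_cnj)
  ultimately have id2: "(cmod (1 - cnj (f w) * f z))\<^sup>2 = 4 * (cmod (p z + cnj (p w)))\<^sup>2 / (X * Y)"
    by (simp add: X_def Y_def power_mult_distrib power_divide)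
  have "(1 - (cmod z)\<^sup>2) * (1 - (cmod w)\<^sup>2) * (4 * (cmod (p z + cnj (p w)))\<^sup>2 / (X * Y))
      \<le> 4 * Re (p z) / X * (4 * Re (p w) / Y) * (cmod (1 - cnj w * z))\<^sup>2"
    using Schwarz_Pick[OF hol im z w] id2 id1[OF z] id1[OF w] by (simp add: X_def Y_def)
  hence "4 * ((cmod (p z + cnj (p w)))\<^sup>2 * (1 - (cmod z)\<^sup>2) * (1 - (cmod w)\<^sup>2)) / (X * Y)
      \<le> 4 * (4 * Re (p z) * Re (p w) * (cmod (1 - cnj w * z))\<^sup>2) / (X * Y)"
    by (simp add: mult_ac)
  thus ?thesis using mult_pos_pos[OF X Y] by (simp only: divide_le_cancel) (simp add: mult_ac)
qed

text \<open>Adding \<open>e > 0\<close> to \<open>p\<close> makes the real part strictly positive;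
  letting \<open>e\<close> tend to 0 then covers imaginary constants as well.\<close>

lemma Schwarz_Pick_herglotz:
  assumes p: "herglotz p" and z: "cmod z < 1" and w: "cmod w < 1"
  shows "(cmod (p z + cnj (p w)))\<^sup>2 * (1 - (cmod z)\<^sup>2) * (1 - (cmod w)\<^sup>2)
       \<le> 4 * Re (p z) * Re (p w) * (cmod (1 - cnj w * z))\<^sup>2"
proof -
  define L where "L = (\<lambda>e::real. (cmod (p z + of_real e + cnj (p w + of_real e)))\<^sup>2 * (1 - (cmod z)\<^sup>2) * (1 - (cmod w)\<^sup>2))"
  define R where "R = (\<lambda>e::real. 4 * Re (p z + of_real e) * Re (p w + of_real e) * (cmod (1 - cnj w * z))\<^sup>2)"
  have le: "L e \<le> R e" if "e > 0" for e
    unfolding L_def R_def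
  proof (rule Schwarz_Pick_Re_pos[OF _ _ z w, of "\<lambda>z. p z + of_real e"])
    show "(\<lambda>z. p z + of_real e) holomorphic_on ball 0 1"
      using p by (auto simp: herglotz_def intro!: holomorphic_intros)
    show "0 < Re (p v + of_real e)" if "cmod v < 1" for v
      using p that \<open>e > 0\<close> by (auto simp: herglotz_def intro: add_nonneg_pos)
  qed
  have "(L \<longlongrightarrow> L 0) (at_right 0)" unfolding L_def by (intro tendsto_intros)
  moreover have "(R \<longlongrightarrow> R 0) (at_right 0)" unfolding R_def by (intro tendsto_intros)
  moreover have "eventually (\<lambda>e. L e \<le> R e) (at_right (0::real))"
    by (rule eventually_at_rightI[of 0 1]) (use le in auto)
  ultimately have "L 0 \<le> R 0" by (intro tendsto_le[of "at_right 0"]) auto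
  thus ?thesis by (simp add: L_def R_def)
qed

text \<open>As \<open>Re (p z) \<le> a\<close> for \<open>a = |p z + cnj (p w)|\<close>, one factor
  \<open>a\<close> cancels from Schwarz-Pick. The result is linear in \<open>Re (p w)\<close>, so a
  single point with small real part controls the growth of the whole function.\<close>

lemma herglotz_growth:
  assumes p: "herglotz p" and z: "cmod z < 1" and w: "cmod w < 1"
  shows "cmod (p z + cnj (p w)) * ((1 - (cmod z)\<^sup>2) * (1 - (cmod w)\<^sup>2)) \<le> 4 * Re (p w) * (cmod (1 - cnj w * z))\<^sup>2"
proof -
  define a where "a = cmod (p z + cnj (p w))"
  define D where "D = (1 - (cmod z)\<^sup>2) * (1 - (cmod w)\<^sup>2)"
  define E where "E = 4 * Re (p w) * (cmod (1 - cnj w * z))\<^sup>2"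
  have E: "E \<ge> 0" using p w by (auto simp: E_def herglotz_def)
  have pw: "Re (p w) \<ge> 0" using p w by (auto simp: herglotz_def)
  have "Re (p z) \<le> a" using complex_Re_le_cmod[of "p z + cnj (p w)"] pw by (simp add: a_def)
  hence "Re (p z) * E \<le> a * E" using E by (rule mult_right_mono)
  moreover have "a\<^sup>2 * D \<le> Re (p z) * E"
    using Schwarz_Pick_herglotz[OF assms] by (simp add: a_def D_def E_def algebra_simps)
  ultimately have *: "a * (a * D) \<le> a * E" by (simp add: power2_eq_square algebra_simps)
  have "a * D \<le> E"
  proof (cases "a = 0")
    case False
    hence "a > 0" by (simp add: a_def)
    thus ?thesis using * by simp
  qed (use E in simp)
  thus ?thesis by (simp add: a_def D_def E_def)
qed

section \<open>Angular limits and masses of Herglotz functions\<close>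

text \<open>For \<sigma> on the circle, the conformal map of the disk onto the right half-plane that
  sends \<sigma> to infinity. Its real part is the Poisson kernel at \<sigma>, so it is the Herglotz
  function of a point mass there.\<close>

definition cayley :: "complex \<Rightarrow> complex \<Rightarrow> complex" where
  "cayley \<sigma> z = (\<sigma> + z) / (\<sigma> - z)"

lemma unit_circle_neq: "cmod \<sigma> = 1 \<Longrightarrow> cmod z < 1 \<Longrightarrow> \<sigma> \<noteq> z"
  by auto

lemma unit_mult_cnj: "cmod \<sigma> = 1 \<Longrightarrow> \<sigma> * cnj \<sigma> = 1"
  by (simp flip: complex_norm_square)

lemma unit_cnj_mult: "cmod \<sigma> = 1 \<Longrightarrow> cnj \<sigma> * \<sigma> = 1"
  by (simp add: unit_mult_cnj mult.commute)

lemma one_minus_cnj_unit_mult: "cmod \<sigma> = 1 \<Longrightarrow> 1 - cnj \<sigma> * z = cnj \<sigma> * (\<sigma> - z)"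
  by (simp add: right_diff_distrib unit_cnj_mult)

lemma norm_one_minus_cnj_unit_mult: "cmod \<sigma> = 1 \<Longrightarrow> cmod (1 - cnj \<sigma> * z) = cmod (\<sigma> - z)"
  by (simp add: one_minus_cnj_unit_mult norm_mult)

lemma one_minus_cnj_mult_unit: "cmod \<sigma> = 1 \<Longrightarrow> 1 - cnj \<tau> * \<sigma> = \<sigma> * cnj (\<sigma> - \<tau>)"
  using unit_mult_cnj[of \<sigma>] by (simp add: algebra_simps)

lemma Re_cayley:
  assumes "cmod \<sigma> = 1"
  shows "Re (cayley \<sigma> z) = (1 - (cmod z)\<^sup>2) / (cmod (\<sigma> - z))\<^sup>2"
proof -
  have "Re ((\<sigma> + z) * cnj (\<sigma> - z)) = (cmod \<sigma>)\<^sup>2 - (cmod z)\<^sup>2"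
    unfolding cmod_power2 by (simp add: power2_eq_square algebra_simps)
  thus ?thesis using assms
    unfolding cayley_def complex_div_cnj[of "\<sigma> + z"] by (simp add: Re_divide_of_real)
qed

lemma Re_cayley_pos:
  assumes "cmod \<sigma> = 1" "cmod z < 1"
  shows "Re (cayley \<sigma> z) > 0"
  using assms unit_circle_neq[OF assms] one_minus_norm_square_pos[OF assms(2)]
  by (simp add: Re_cayley)

lemma cayley_holomorphic:
  assumes "cmod \<sigma> = 1"
  shows "cayley \<sigma> holomorphic_on ball 0 1"
  unfolding cayley_def[abs_def] using assms by (intro holomorphic_intros) auto

lemma herglotz_Re_nonneg: "herglotz p \<Longrightarrow> cmod z < 1 \<Longrightarrow> Re (p z) \<ge> 0"
  by (auto simp: herglotz_def)

lemma eventually_in_stolz: "eventually (\<lambda>z. z \<in> stolz_angle \<sigma> M) (at \<sigma> within stolz_angle \<sigma> M)"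
  by (simp add: eventually_at_filter)

lemma stolz_angle_norm: "z \<in> stolz_angle \<sigma> M \<Longrightarrow> cmod z < 1"
  by (simp add: stolz_angle_def)

lemma angular_limitD:
  "has_angular_limit f \<sigma> L \<Longrightarrow> M > 1 \<Longrightarrow> (f \<longlongrightarrow> L) (at \<sigma> within stolz_angle \<sigma> M)"
  by (simp add: has_angular_limit_def)

lemma angular_limit_cong:
  assumes "\<And>z. cmod z < 1 \<Longrightarrow> f z = g z" "has_angular_limit f \<sigma> L"
  shows "has_angular_limit g \<sigma> L"
  unfolding has_angular_limit_def
proof (intro allI impI)
  fix M :: real assume "M > 1"
  have "eventually (\<lambda>z. f z = g z) (at \<sigma> within stolz_angle \<sigma> M)"
    by (rule eventually_mono[OF eventually_in_stolz]) (auto intro: assms stolz_angle_norm)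
  thus "(g \<longlongrightarrow> L) (at \<sigma> within stolz_angle \<sigma> M)"
    using angular_limitD[OF assms(2) \<open>M > 1\<close>] tendsto_cong by blast
qed

lemma angular_limit_isCont: "isCont f \<sigma> \<Longrightarrow> has_angular_limit f \<sigma> (f \<sigma>)"
  unfolding has_angular_limit_def isCont_def by (auto intro: tendsto_within_subset)

lemma angular_limit_add:
  "has_angular_limit f \<sigma> a \<Longrightarrow> has_angular_limit g \<sigma> b \<Longrightarrow> has_angular_limit (\<lambda>z. f z + g z) \<sigma> (a + b)"
  unfolding has_angular_limit_def by (auto intro: tendsto_add)

lemma angular_limit_mult:
  "has_angular_limit f \<sigma> a \<Longrightarrow> has_angular_limit g \<sigma> b \<Longrightarrow> has_angular_limit (\<lambda>z. f z * g z) \<sigma> (a * b)"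
  unfolding has_angular_limit_def by (auto intro: tendsto_mult)

lemma angular_limit_divide:
  "has_angular_limit f \<sigma> a \<Longrightarrow> has_angular_limit g \<sigma> b \<Longrightarrow> b \<noteq> 0 \<Longrightarrow>
     has_angular_limit (\<lambda>z. f z / g z) \<sigma> (a / b)"
  unfolding has_angular_limit_def by (auto intro: tendsto_divide)

text \<open>On the radius \<open>|\<sigma> - z| = 1 - |z|\<close>, so it runs inside the Stolz angle
  with \<open>M = 2\<close>. This reduces uniqueness of angular limits to a limit in one real
  variable.\<close>

lemma angular_limit_radial:
  assumes \<sigma>: "cmod \<sigma> = 1" and lim: "has_angular_limit f \<sigma> L"
  shows "((\<lambda>r. f (of_real r * \<sigma>)) \<longlongrightarrow> L) (at_left 1)"
proof -
  have "filterlim (\<lambda>r. of_real r * \<sigma>) (at \<sigma> within stolz_angle \<sigma> 2) (at_left (1::real))"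
    unfolding filterlim_at
  proof
    have "((\<lambda>r. of_real r * \<sigma>) \<longlongrightarrow> of_real 1 * \<sigma>) (at_left (1::real))"
      by (intro tendsto_intros)
    thus "((\<lambda>r. of_real r * \<sigma>) \<longlongrightarrow> \<sigma>) (at_left (1::real))" by simp
    show "eventually (\<lambda>r. of_real r * \<sigma> \<in> stolz_angle \<sigma> 2 \<and> of_real r * \<sigma> \<noteq> \<sigma>) (at_left (1::real))"
    proof (rule eventually_at_leftI[of 0 1])
      fix r :: real assume r: "r \<in> {0<..<1}"
      have "\<sigma> - of_real r * \<sigma> = of_real (1 - r) * \<sigma>" by (simp add: algebra_simps)
      hence n: "cmod (\<sigma> - of_real r * \<sigma>) = 1 - r" using r \<sigma> by (simp only: norm_mult norm_of_real) simp
      hence "of_real r * \<sigma> \<noteq> \<sigma>" using r by auto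
      thus "of_real r * \<sigma> \<in> stolz_angle \<sigma> 2 \<and> of_real r * \<sigma> \<noteq> \<sigma>"
        using r \<sigma> n by (simp add: stolz_angle_def norm_mult)
    qed simp
  qed
  thus ?thesis using angular_limitD[OF lim, of 2] by (auto intro: filterlim_compose)
qed

lemma angular_limit_unique:
  assumes "cmod \<sigma> = 1" "has_angular_limit f \<sigma> a" "has_angular_limit f \<sigma> b"
  shows "a = b"
  using angular_limit_radial[OF assms(1,2)] angular_limit_radial[OF assms(1,3)]
  by (intro tendsto_unique[of "at_left (1::real)"]) auto

lemma pstar_radial:
  assumes \<sigma>: "cmod \<sigma> = 1" and p: "pstar_eq p \<sigma> c"
  shows "((\<lambda>r. of_real (1 - r) * p (of_real r * \<sigma>)) \<longlongrightarrow> c) (at_left 1)"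
proof -
  have "1 - cnj \<sigma> * (of_real r * \<sigma>) = of_real (1 - r)" for r
    using unit_cnj_mult[OF \<sigma>] by (metis mult.left_commute mult.right_neutral of_real_1 of_real_diff)
  thus ?thesis using angular_limit_radial[OF \<sigma> p[unfolded pstar_eq_def]] by (simp only:)
qed

text \<open>Julia's lemma in half-plane form: at \<open>w = r \<sigma>\<close> the value
  \<open>p w\<close> grows like \<open>c / (1 - r)\<close>, and Schwarz-Pick with this
  \<open>w\<close> retains just the contribution of the mass as \<open>r\<close> tends to 1.\<close>

lemma herglotz_radial_mass:
  assumes p: "herglotz p" and \<sigma>: "cmod \<sigma> = 1" and c: "c > 0"
    and lim: "((\<lambda>r. of_real (1 - r) * p (of_real r * \<sigma>)) \<longlongrightarrow> of_real c) (at_left 1)"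
    and z: "cmod z < 1"
  shows "c / 2 * Re (cayley \<sigma> z) \<le> Re (p z)"
proof -
  \<comment> \<open>The two sides of Schwarz-Pick at \<open>w = r \<sigma>\<close>, multiplied by
    \<open>1 - r\<close>. On the left, \<open>1 - |w|^2\<close> contributes a second factor
    \<open>1 - r\<close>, and the square absorbs both; so both sides have finite limits.\<close>
  define L where "L = (\<lambda>r. (cmod (of_real (1 - r) * p z + cnj (of_real (1 - r) * p (of_real r * \<sigma>))))\<^sup>2 * ((1 - (cmod z)\<^sup>2) * (1 + r)))"
  define R where "R = (\<lambda>r. 4 * Re (p z) * Re (of_real (1 - r) * p (of_real r * \<sigma>)) * (cmod (1 - cnj (of_real r * \<sigma>) * z))\<^sup>2)"
  have le: "L r \<le> R r" if r: "r \<in> {0<..<1}" for r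
  proof -
    define w where "w = of_real r * \<sigma>"
    have w: "cmod w = r" using r \<sigma> by (simp add: w_def norm_mult)
    have "of_real (1 - r) * p z + cnj (of_real (1 - r) * p w) = of_real (1 - r) * (p z + cnj (p w))"
      by (simp add: algebra_simps)
    hence n: "cmod (of_real (1 - r) * p z + cnj (of_real (1 - r) * p w)) = (1 - r) * cmod (p z + cnj (p w))"
      using r by (simp only: norm_mult norm_of_real) simp
    have "L r = (1 - r) * ((cmod (p z + cnj (p w)))\<^sup>2 * (1 - (cmod z)\<^sup>2) * (1 - (cmod w)\<^sup>2))"
      unfolding L_def w_def[symmetric] n unfolding w by (simp add: power2_eq_square algebra_simps)
    also have "\<dots> \<le> (1 - r) * (4 * Re (p z) * Re (p w) * (cmod (1 - cnj w * z))\<^sup>2)"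
      using r w by (intro mult_left_mono Schwarz_Pick_herglotz[OF p z]) auto
    also have "\<dots> = R r"
      unfolding R_def w_def[symmetric] by (simp add: algebra_simps)
    finally show ?thesis .
  qed
  have "(L \<longlongrightarrow> (cmod (of_real (1 - 1) * p z + cnj (of_real c)))\<^sup>2 * ((1 - (cmod z)\<^sup>2) * (1 + 1))) (at_left 1)"
    unfolding L_def by (intro tendsto_intros lim)
  hence L: "(L \<longlongrightarrow> c\<^sup>2 * ((1 - (cmod z)\<^sup>2) * 2)) (at_left 1)" by simp
  have "(R \<longlongrightarrow> 4 * Re (p z) * Re (of_real c) * (cmod (1 - cnj (of_real 1 * \<sigma>) * z))\<^sup>2) (at_left 1)"
    unfolding R_def by (intro tendsto_intros lim)
  hence R: "(R \<longlongrightarrow> 4 * Re (p z) * c * (cmod (\<sigma> - z))\<^sup>2) (at_left 1)"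
    using norm_one_minus_cnj_unit_mult[OF \<sigma>] by simp
  have ev: "eventually (\<lambda>r. L r \<le> R r) (at_left 1)"
    by (rule eventually_at_leftI[of 0 1]) (use le in auto)
  have "c\<^sup>2 * ((1 - (cmod z)\<^sup>2) * 2) \<le> 4 * Re (p z) * c * (cmod (\<sigma> - z))\<^sup>2"
    by (rule tendsto_le[OF _ R L ev]) simp
  hence "c * (2 * (c * (1 - (cmod z)\<^sup>2))) \<le> c * (4 * (Re (p z) * (cmod (\<sigma> - z))\<^sup>2))"
    by (simp add: power2_eq_square algebra_simps)
  hence "c * (1 - (cmod z)\<^sup>2) \<le> 2 * (Re (p z) * (cmod (\<sigma> - z))\<^sup>2)"
    using c by simp
  moreover have "(cmod (\<sigma> - z))\<^sup>2 > 0" using unit_circle_neq[OF \<sigma> z] by simp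
  ultimately show ?thesis unfolding Re_cayley[OF \<sigma>] by (simp add: field_simps)
qed

text \<open>The value 2 is the source of the factor \<open>c / 2\<close> in the mass inequalities
  and of the 2 in the denominators of the coefficients of \<open>p0\<close>.\<close>

lemma pstar_cayley_self:
  assumes "cmod \<sigma> = 1"
  shows "pstar_eq (cayley \<sigma>) \<sigma> 2"
  unfolding pstar_eq_def
proof (rule angular_limit_cong)
  show "cnj \<sigma> * (\<sigma> + z) = (1 - cnj \<sigma> * z) * cayley \<sigma> z" if "cmod z < 1" for z
    using unit_circle_neq[OF assms that] by (simp add: one_minus_cnj_unit_mult[OF assms] cayley_def)
  have "has_angular_limit (\<lambda>z. cnj \<sigma> * (\<sigma> + z)) \<sigma> (cnj \<sigma> * (\<sigma> + \<sigma>))"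
    by (rule angular_limit_isCont) (intro continuous_intros)
  also have "cnj \<sigma> * (\<sigma> + \<sigma>) = 2" using unit_cnj_mult[OF assms] by (simp add: distrib_left)
  finally show "has_angular_limit (\<lambda>z. cnj \<sigma> * (\<sigma> + z)) \<sigma> 2" .
qed

lemma pstar_add: "pstar_eq p \<sigma> a \<Longrightarrow> pstar_eq q \<sigma> b \<Longrightarrow> pstar_eq (\<lambda>z. p z + q z) \<sigma> (a + b)"
  unfolding pstar_eq_def distrib_left by (rule angular_limit_add)

lemma pstar_cmult:
  assumes "pstar_eq p \<sigma> a" shows "pstar_eq (\<lambda>z. k * p z) \<sigma> (k * a)"
proof -
  have "has_angular_limit (\<lambda>z. k * ((1 - cnj \<sigma> * z) * p z)) \<sigma> (k * a)"
    using assms unfolding pstar_eq_def by (intro angular_limit_mult angular_limit_isCont) auto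
  thus ?thesis unfolding pstar_eq_def by (simp add: mult.left_commute)
qed

lemma pstar_isCont:
  assumes "isCont p \<sigma>" "cmod \<sigma> = 1" shows "pstar_eq p \<sigma> 0"
  using angular_limit_isCont[of \<sigma> "\<lambda>z. (1 - cnj \<sigma> * z) * p z"] assms
  by (simp add: pstar_eq_def unit_cnj_mult continuous_intros)

text \<open>The candidate for half the mass is the infimum \<open>k\<close> of \<open>Re p\<close>
  divided by the Poisson kernel. Subtracting \<open>k\<close> times the kernel leaves a Herglotz
  function \<open>q\<close> for which this infimum is 0; at a point \<open>z0\<close> nearly
  attaining it, \<open>herglotz_growth\<close> makes \<open>(1 - cnj \<sigma> * z) * q z\<close>
  small in Stolz angles.\<close>

lemma herglotz_has_pstar:
  assumes p: "herglotz p" and \<sigma>: "cmod \<sigma> = 1"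
  obtains c :: real where "c \<ge> 0" "pstar_eq p \<sigma> (of_real c)"
    "\<And>z. cmod z < 1 \<Longrightarrow> c / 2 * Re (cayley \<sigma> z) \<le> Re (p z)"
proof -
  define S where "S = (\<lambda>z. Re (p z) / Re (cayley \<sigma> z)) ` ball 0 1"
  define k where "k = Inf S"
  have bdd: "bdd_below S"
    unfolding S_def using herglotz_Re_nonneg[OF p] Re_cayley_pos[OF \<sigma>]
    by (intro bdd_belowI[of _ 0]) (auto intro!: divide_nonneg_pos)
  have S0: "S \<noteq> {}" by (auto simp: S_def)
  have k0: "k \<ge> 0" unfolding k_def
    using S0 herglotz_Re_nonneg[OF p] Re_cayley_pos[OF \<sigma>]
    by (intro cInf_greatest) (auto simp: S_def intro!: divide_nonneg_pos)
  have k: "k * Re (cayley \<sigma> z) \<le> Re (p z)" if "cmod z < 1" for z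
  proof -
    have "k \<le> Re (p z) / Re (cayley \<sigma> z)"
      unfolding k_def by (rule cInf_lower[OF _ bdd]) (use that in \<open>auto simp: S_def\<close>)
    thus ?thesis using Re_cayley_pos[OF \<sigma> that] by (simp add: field_simps)
  qed
  define q where "q = (\<lambda>z. p z - of_real k * cayley \<sigma> z)"
  have q: "herglotz q"
    using p k cayley_holomorphic[OF \<sigma>] unfolding herglotz_def q_def by (auto intro!: holomorphic_intros)
  have "pstar_eq q \<sigma> 0"
    unfolding pstar_eq_def has_angular_limit_def
  proof (intro allI impI)
    fix M :: real assume M: "M > 1"
    show "((\<lambda>z. (1 - cnj \<sigma> * z) * q z) \<longlongrightarrow> 0) (at \<sigma> within stolz_angle \<sigma> M)"
    proof (rule tendstoI)
      fix e :: real assume e: "e > 0"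
      \<comment> \<open>The margin \<open>e / (4 * M)\<close> absorbs the 4 of
        \<open>herglotz_growth\<close> and the Stolz constant \<open>M\<close>, so that the limit of
        \<open>B\<close> at \<sigma> lies below \<open>e\<close>.\<close>
      have "Inf S < k + e / (4 * M)" using e M by (simp add: k_def)
      then obtain z0 where z0: "cmod z0 < 1" and "Re (p z0) / Re (cayley \<sigma> z0) < k + e / (4 * M)"
        using cInf_lessD[OF S0] unfolding S_def by fastforce
      hence small: "Re (q z0) < e / (4 * M) * Re (cayley \<sigma> z0)"
        using Re_cayley_pos[OF \<sigma> z0] by (simp add: q_def field_simps)
      define D where "D = 1 - (cmod z0)\<^sup>2"
      have D: "D > 0" using one_minus_norm_square_pos[OF z0] by (simp add: D_def)
      have b: "Re (q z0) \<ge> 0" using herglotz_Re_nonneg[OF q z0] .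
      define B where "B = (\<lambda>z. cmod (\<sigma> - z) * cmod (q z0) + M * (4 * Re (q z0) * (cmod (1 - cnj z0 * z))\<^sup>2 / D))"
      have bound: "cmod ((1 - cnj \<sigma> * z) * q z) \<le> B z" if z: "z \<in> stolz_angle \<sigma> M" for z
      proof -
        have z1: "cmod z < 1" and st: "cmod (\<sigma> - z) \<le> M * (1 - cmod z)"
          using z by (auto simp: stolz_angle_def)
        define E where "E = 4 * Re (q z0) * (cmod (1 - cnj z0 * z))\<^sup>2 / D"
        define a where "a = cmod (q z + cnj (q z0))"
        have "a * (1 - (cmod z)\<^sup>2) \<le> E"
          using herglotz_growth[OF q z1 z0] D by (simp add: a_def E_def D_def field_simps)
        moreover have "a * (1 - cmod z) \<le> a * (1 - (cmod z)\<^sup>2)"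
          using z1 by (intro mult_left_mono) (auto simp: a_def power2_eq_square intro: mult_left_le)
        ultimately have "M * (a * (1 - cmod z)) \<le> M * E" using M by simp
        moreover have "cmod (\<sigma> - z) * a \<le> M * (1 - cmod z) * a"
          using st by (intro mult_right_mono) (auto simp: a_def)
        ultimately have 1: "cmod (\<sigma> - z) * a \<le> M * E" by (simp add: algebra_simps)
        have "cmod (q z) \<le> a + cmod (q z0)"
          using norm_triangle_ineq4[of "q z + cnj (q z0)" "cnj (q z0)"] by (simp add: a_def)
        hence "cmod (\<sigma> - z) * cmod (q z) \<le> cmod (\<sigma> - z) * (a + cmod (q z0))"
          by (intro mult_left_mono) auto
        thus ?thesis using 1
          by (simp add: norm_mult norm_one_minus_cnj_unit_mult[OF \<sigma>] B_def E_def distrib_left)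
      qed
      have "(B \<longlongrightarrow> cmod (\<sigma> - \<sigma>) * cmod (q z0) + M * (4 * Re (q z0) * (cmod (1 - cnj z0 * \<sigma>))\<^sup>2 / D)) (at \<sigma> within stolz_angle \<sigma> M)"
        unfolding B_def using D by (intro tendsto_intros) auto
      moreover have "cmod (\<sigma> - \<sigma>) * cmod (q z0) + M * (4 * Re (q z0) * (cmod (1 - cnj z0 * \<sigma>))\<^sup>2 / D) < e"
      proof -
        have "cmod (1 - cnj z0 * \<sigma>) = cmod (cnj (1 - cnj \<sigma> * z0))" by (simp add: mult.commute)
        hence n: "cmod (1 - cnj z0 * \<sigma>) = cmod (\<sigma> - z0)"
          using norm_one_minus_cnj_unit_mult[OF \<sigma>, of z0] by (simp only: complex_mod_cnj)
        have "(cmod (\<sigma> - z0))\<^sup>2 > 0" using unit_circle_neq[OF \<sigma> z0] by simp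
        hence "Re (q z0) * (cmod (\<sigma> - z0))\<^sup>2 < e / (4 * M) * D"
          using small unfolding Re_cayley[OF \<sigma>] D_def[symmetric] times_divide_eq_right
          by (simp only: pos_less_divide_eq)
        thus ?thesis unfolding n using D M by (simp add: field_simps)
      qed
      ultimately have "eventually (\<lambda>z. B z < e) (at \<sigma> within stolz_angle \<sigma> M)"
        by (rule order_tendstoD(2))
      thus "eventually (\<lambda>z. dist ((1 - cnj \<sigma> * z) * q z) 0 < e) (at \<sigma> within stolz_angle \<sigma> M)"
        using eventually_in_stolz by eventually_elim (use bound in force)
    qed
  qed
  hence "pstar_eq (\<lambda>z. q z + of_real k * cayley \<sigma> z) \<sigma> (0 + of_real k * 2)"
    by (intro pstar_add pstar_cmult pstar_cayley_self \<sigma>)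
  hence "pstar_eq p \<sigma> (of_real (2 * k))" by (simp add: q_def mult.commute)
  thus ?thesis using that[of "2 * k"] k0 k by simp
qed

section \<open>Generators of semigroups and their Herglotz functions\<close>

lemma has_real_derivative_norm_square:
  fixes u :: "real \<Rightarrow> complex"
  assumes "(u has_vector_derivative u') (at t within S)"
  shows "((\<lambda>s. (cmod (u s))\<^sup>2) has_real_derivative 2 * Re (cnj (u t) * u')) (at t within S)"
proof -
  have "((\<lambda>s. u s \<bullet> u s) has_vector_derivative (u t \<bullet> u' + u' \<bullet> u t)) (at t within S)"
    by (rule bounded_bilinear.has_vector_derivative[OF bounded_bilinear_inner assms assms])
  moreover have "u t \<bullet> u' + u' \<bullet> u t = 2 * Re (cnj (u t) * u')"
    by (simp add: inner_complex_def algebra_simps)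
  ultimately show ?thesis
    by (simp add: power2_norm_eq_inner has_real_derivative_iff_has_vector_derivative)
qed

lemma has_real_derivative_Re:
  "(u has_vector_derivative u') (at t within S) \<Longrightarrow>
    ((\<lambda>s. Re (u s)) has_real_derivative Re u') (at t within S)"
  by (simp add: has_real_derivative_iff_has_vector_derivative bounded_linear.has_vector_derivative[OF bounded_linear_Re])

text \<open>Serves to turn an inequality that holds along a semigroup, with equality at time 0, into
  an inequality for its generator.\<close>

lemma derivative_nonpos_at_initial_max:
  fixes f :: "real \<Rightarrow> real"
  assumes "(f has_real_derivative D) (at 0 within {0..})" "\<And>t. t \<ge> 0 \<Longrightarrow> f t \<le> f 0"
  shows "D \<le> 0"
proof (rule ccontr)
  assume "\<not> D \<le> 0"
  then obtain d where d: "d > 0" "\<And>h. 0 < h \<Longrightarrow> 0 + h \<in> {0..} \<Longrightarrow> h < d \<Longrightarrow> f 0 < f (0 + h)"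
    using has_real_derivative_pos_inc_right[OF assms(1)] by auto
  have "f 0 < f (d / 2)" using d(2)[of "d / 2"] d(1) by simp
  thus False using assms(2)[of "d / 2"] d(1) by simp
qed

lemma semigroup_disk_holomorphic:
  "semigroup_disk \<phi> \<Longrightarrow> t \<ge> 0 \<Longrightarrow> \<phi> t holomorphic_on ball 0 1"
  by (simp add: semigroup_disk_def)

lemma semigroup_disk_norm:
  "semigroup_disk \<phi> \<Longrightarrow> t \<ge> 0 \<Longrightarrow> cmod z < 1 \<Longrightarrow> cmod (\<phi> t z) < 1"
  by (auto simp: semigroup_disk_def image_subset_iff)

lemma semigroup_disk_0:
  "semigroup_disk \<phi> \<Longrightarrow> cmod z < 1 \<Longrightarrow> \<phi> 0 z = z"
  by (simp add: semigroup_disk_def)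

text \<open>For interior \<open>\<tau>\<close> this is Schwarz-Pick at the fixed point. For boundary \<open>\<tau>\<close> it is the limit of
  Schwarz-Pick along the orbit \<open>w n\<close> of \<open>0\<close>, using that \<open>1 - |w n|^2\<close> cannot increase eventually.\<close>

lemma DW_point_horocycle:
  assumes holf: "f holomorphic_on ball 0 1" and im: "\<And>z. cmod z < 1 \<Longrightarrow> cmod (f z) < 1"
    and DW: "DW_point f \<tau>" and z: "cmod z < 1"
  shows "(cmod (1 - cnj \<tau> * f z))\<^sup>2 * (1 - (cmod z)\<^sup>2) \<le> (cmod (1 - cnj \<tau> * z))\<^sup>2 * (1 - (cmod (f z))\<^sup>2)"
  using DW unfolding DW_point_def
proof (elim disjE conjE)
  assume \<tau>: "\<tau> \<in> ball 0 1" and fp: "f \<tau> = \<tau>"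
  hence \<tau>1: "cmod \<tau> < 1" by simp
  have "(1 - (cmod z)\<^sup>2) * (1 - (cmod \<tau>)\<^sup>2) * (cmod (1 - cnj \<tau> * f z))\<^sup>2
      \<le> (1 - (cmod (f z))\<^sup>2) * (1 - (cmod \<tau>)\<^sup>2) * (cmod (1 - cnj \<tau> * z))\<^sup>2"
    using Schwarz_Pick[OF holf im z \<tau>1] by (simp only: fp)
  hence "(1 - (cmod \<tau>)\<^sup>2) * ((1 - (cmod z)\<^sup>2) * (cmod (1 - cnj \<tau> * f z))\<^sup>2)
      \<le> (1 - (cmod \<tau>)\<^sup>2) * ((1 - (cmod (f z))\<^sup>2) * (cmod (1 - cnj \<tau> * z))\<^sup>2)"
    by (simp only: mult_ac)
  hence "(1 - (cmod z)\<^sup>2) * (cmod (1 - cnj \<tau> * f z))\<^sup>2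
      \<le> (1 - (cmod (f z))\<^sup>2) * (cmod (1 - cnj \<tau> * z))\<^sup>2"
    using one_minus_norm_square_pos[OF \<tau>1] by (simp only: mult_le_cancel_left_pos)
  thus ?thesis by (simp add: mult.commute)
next
  assume \<tau>: "cmod \<tau> = 1" and conv: "\<forall>z\<in>ball 0 1. (\<lambda>n. (f ^^ n) z) \<longlonglongrightarrow> \<tau>"
  define w where "w = (\<lambda>n. (f ^^ n) 0)"
  have w: "cmod (w n) < 1" for n
    by (induction n) (auto simp: w_def im)
  have w_Suc: "w (Suc n) = f (w n)" for n by (simp add: w_def)
  have lim: "w \<longlonglongrightarrow> \<tau>" using conv by (simp add: w_def)
  note lim' = LIMSEQ_Suc[OF lim]
  define a where "a = (\<lambda>n. 1 - (cmod (w n))\<^sup>2)"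
  have a_pos: "a n > 0" for n using one_minus_norm_square_pos[OF w] by (simp add: a_def)
  have "a \<longlonglongrightarrow> 1 - (cmod \<tau>)\<^sup>2" unfolding a_def by (intro tendsto_intros lim)
  hence a_lim: "a \<longlonglongrightarrow> 0" using \<tau> by simp
  define X where "X = (\<lambda>n. (cmod (1 - cnj (w (Suc n)) * f z))\<^sup>2 * (1 - (cmod z)\<^sup>2))"
  define Y where "Y = (\<lambda>n. (cmod (1 - cnj (w n) * z))\<^sup>2 * (1 - (cmod (f z))\<^sup>2))"
  have XY: "a n * X n \<le> a (Suc n) * Y n" for n
    using Schwarz_Pick[OF holf im z w[of n]] by (simp add: X_def Y_def a_def w_Suc mult_ac)
  have X: "X \<longlonglongrightarrow> (cmod (1 - cnj \<tau> * f z))\<^sup>2 * (1 - (cmod z)\<^sup>2)"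
    unfolding X_def by (intro tendsto_intros lim')
  have Y: "Y \<longlonglongrightarrow> (cmod (1 - cnj \<tau> * z))\<^sup>2 * (1 - (cmod (f z))\<^sup>2)"
    unfolding Y_def by (intro tendsto_intros lim)
  show ?thesis
  proof (rule ccontr)
    assume "\<not> ?thesis"
    hence "eventually (\<lambda>n. X n - Y n > 0) sequentially"
      by (intro order_tendstoD(1)[OF tendsto_diff[OF X Y]]) simp
    then obtain N where N: "\<And>n. n \<ge> N \<Longrightarrow> X n > Y n"
      by (auto simp: eventually_sequentially)
    have step: "a n \<le> a (Suc n)" if "n \<ge> N" for n
    proof (rule ccontr)
      assume "\<not> a n \<le> a (Suc n)"
      hence "a (Suc n) * Y n \<le> a n * Y n"
        using im[OF z] by (intro mult_right_mono) (auto simp: Y_def abs_square_le_1)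
      also have "\<dots> < a n * X n" using N[OF that] a_pos by simp
      finally show False using XY[of n] by simp
    qed
    have "a N \<le> a n" if "n \<ge> N" for n
      using that by (induction n rule: dec_induct) (use step in force)+
    hence "a N \<le> 0" by (intro LIMSEQ_le_const[OF a_lim]) auto
    thus False using a_pos[of N] by simp
  qed
qed

section \<open>The Berkson-Porta formula\<close>

lemma generator_derivative:
  assumes "semigroup_disk \<phi>" "generator_of \<phi> G" "cmod z < 1" "t \<ge> 0"
  shows "((\<lambda>s. \<phi> s z) has_vector_derivative G (\<phi> t z)) (at t within {0..})"
  using assms by (auto simp: generator_of_def)

text \<open>The horocycle inequality is an equality at time 0, and its derivative there is a
  negative multiple of the real part in question. At \<open>z = \<tau>\<close> the quotient is 0 by
  convention, so nothing is claimed there yet.\<close>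

lemma Berkson_Porta_Re_nonneg:
  assumes sg: "semigroup_disk \<phi>" and gen: "generator_of \<phi> G" and DW: "semigroup_DW \<phi> \<tau>"
    and z: "cmod z < 1"
  shows "0 \<le> Re (G z / ((\<tau> - z) * (1 - cnj \<tau> * z)))"
proof -
  define f where "f = (\<lambda>t. (cmod (1 - cnj \<tau> * \<phi> t z))\<^sup>2 * (1 - (cmod z)\<^sup>2) - (cmod (1 - cnj \<tau> * z))\<^sup>2 * (1 - (cmod (\<phi> t z))\<^sup>2))"
  have z0: "\<phi> 0 z = z" using semigroup_disk_0[OF sg z] .
  have d: "((\<lambda>s. \<phi> s z) has_vector_derivative G z) (at 0 within {0..})"
    using generator_derivative[OF sg gen z order.refl] z0 by simp
  have d1: "((\<lambda>s. 1 - cnj \<tau> * \<phi> s z) has_vector_derivative (- cnj \<tau> * G z)) (at 0 within {0..})"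
    using has_vector_derivative_diff[OF has_vector_derivative_const has_vector_derivative_mult_right[OF d, of "cnj \<tau>"], of 1]
    by simp
  have f0: "f 0 = 0" by (simp add: f_def z0)
  have le: "f t \<le> f 0" if "t \<ge> 0" for t
  proof (cases "\<forall>z\<in>ball 0 1. \<phi> t z = z")
    case True
    thus ?thesis using z f0 by (simp add: f_def)
  next
    case False
    hence "DW_point (\<phi> t) \<tau>" using DW that by (simp add: semigroup_DW_def)
    from DW_point_horocycle[OF semigroup_disk_holomorphic[OF sg that] semigroup_disk_norm[OF sg that] this z]
    show ?thesis unfolding f0 by (simp add: f_def)
  qed
  have "(f has_real_derivative (2 * Re (cnj (1 - cnj \<tau> * \<phi> 0 z) * (- cnj \<tau> * G z)) * (1 - (cmod z)\<^sup>2)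
      - (cmod (1 - cnj \<tau> * z))\<^sup>2 * (0 - 2 * Re (cnj (\<phi> 0 z) * G z)))) (at 0 within {0..})"
    unfolding f_def
    by (intro DERIV_diff DERIV_cmult DERIV_cmult_right DERIV_const has_real_derivative_norm_square d d1)
  hence "2 * Re (cnj (1 - cnj \<tau> * z) * (- cnj \<tau> * G z)) * (1 - (cmod z)\<^sup>2)
      - (cmod (1 - cnj \<tau> * z))\<^sup>2 * (0 - 2 * Re (cnj z * G z)) \<le> 0"
    using derivative_nonpos_at_initial_max[of f, OF _ le] unfolding z0 by blast
  also have "2 * Re (cnj (1 - cnj \<tau> * z) * (- cnj \<tau> * G z)) * (1 - (cmod z)\<^sup>2)
      - (cmod (1 - cnj \<tau> * z))\<^sup>2 * (0 - 2 * Re (cnj z * G z))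
    = - 2 * Re (G z * cnj ((\<tau> - z) * (1 - cnj \<tau> * z)))"
    unfolding cmod_power2 by (simp add: power2_eq_square algebra_simps)
  finally have "0 \<le> Re (G z * cnj ((\<tau> - z) * (1 - cnj \<tau> * z)))"
    by (simp only: mult_le_0_iff) simp
  thus ?thesis
    unfolding complex_div_cnj[of "G z"] by (simp add: Re_divide_of_real)
qed

text \<open>Schwarz-Pick at a zero \<open>w\<close> has right-hand side 0, which gives the minimum
  principle for Herglotz functions. It ensures that the quotient of a non-zero generator can be
  inverted throughout the disk.\<close>

lemma herglotz_zero:
  assumes q: "herglotz q" and w: "cmod w < 1" "q w = 0" and z: "cmod z < 1"
  shows "q z = 0"
proof -
  have "(cmod (q z))\<^sup>2 * ((1 - (cmod z)\<^sup>2) * (1 - (cmod w)\<^sup>2)) \<le> 0"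
    using Schwarz_Pick_herglotz[OF q z w(1)] w(2) by (simp add: mult.assoc)
  moreover have "(1 - (cmod z)\<^sup>2) * (1 - (cmod w)\<^sup>2) > 0"
    using one_minus_norm_square_pos z w by simp
  ultimately have "(cmod (q z))\<^sup>2 \<le> 0" by (meson mult_pos_pos not_le)
  thus ?thesis by simp
qed

text \<open>\<open>Q\<close> is the reciprocal of the usual Berkson-Porta function \<open>q\<close>,
  because the masses of \<open>Q\<close>, not those of \<open>q\<close>, encode the boundary fixed
  points other than \<tau>. For \<tau> on the circle the division is harmless; for interior \<tau> a
  zero of \<open>G\<close> has to be divided out.\<close>

lemma Berkson_Porta_representation:
  assumes sg: "semigroup_disk \<phi>" and gen: "generator_of \<phi> G" and DW: "semigroup_DW \<phi> \<tau>"
    and \<tau>: "cmod \<tau> \<le> 1" and nz: "\<exists>z\<in>ball 0 1. G z \<noteq> 0"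
  obtains Q where "herglotz Q" "\<And>z. cmod z < 1 \<Longrightarrow> Q z \<noteq> 0"
    "\<And>z. cmod z < 1 \<Longrightarrow> G z = (\<tau> - z) * (1 - cnj \<tau> * z) / Q z"
proof -
  have holG: "G holomorphic_on ball 0 1" using gen by (simp add: generator_of_def)
  obtain q where holq: "q holomorphic_on ball 0 1"
    and Gq: "\<And>z. cmod z < 1 \<Longrightarrow> G z = (\<tau> - z) * (1 - cnj \<tau> * z) * q z"
  proof (cases "cmod \<tau> < 1")
    case True
    have fixed: "\<phi> t \<tau> = \<tau>" if "t \<ge> 0" for t
    proof (cases "\<forall>z\<in>ball 0 1. \<phi> t z = z")
      case False
      hence "DW_point (\<phi> t) \<tau>" using DW that by (simp add: semigroup_DW_def)
      thus ?thesis using True by (simp add: DW_point_def)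
    qed (use True in simp)
    \<comment> \<open>The orbit of \<tau> is constant, so its derivative \<open>G \<tau>\<close>
      vanishes; this is the zero that cancels the factor \<open>\<tau> - z\<close>.\<close>
    have "((\<lambda>s. \<phi> s \<tau>) has_vector_derivative G \<tau>) (at 0 within {0..})"
      using generator_derivative[OF sg gen True order.refl] fixed[OF order.refl] by simp
    moreover have "((\<lambda>s. \<phi> s \<tau>) has_vector_derivative 0) (at 0 within {0..})"
      by (rule has_vector_derivative_transform[OF _ _ has_vector_derivative_const[of \<tau>]]) (auto simp: fixed)
    ultimately have G\<tau>: "G \<tau> = 0"
      by (rule vector_derivative_unique_within[rotated]) (simp add: at_within_Ici_at_right)
    define f where "f = (\<lambda>z. if z = \<tau> then deriv G \<tau> else (G z - G \<tau>) / (z - \<tau>))"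
    have f: "f holomorphic_on ball 0 1"
      unfolding f_def by (rule pole_lemma[OF holG]) (simp add: True)
    show ?thesis
    proof (rule that[of "\<lambda>z. - f z / (1 - cnj \<tau> * z)"])
      show "(\<lambda>z. - f z / (1 - cnj \<tau> * z)) holomorphic_on ball 0 1"
        by (intro holomorphic_intros f) (use one_minus_cnj_mult_nonzero \<tau> in auto)
      show "G z = (\<tau> - z) * (1 - cnj \<tau> * z) * (- f z / (1 - cnj \<tau> * z))" if "cmod z < 1" for z
      proof -
        have "G z = (\<tau> - z) * (- f z)"
          using G\<tau> by (cases "z = \<tau>") (auto simp: f_def field_simps)
        thus ?thesis using one_minus_cnj_mult_nonzero[OF \<tau> that] by simp
      qed
    qed
  next
    case False
    hence ne: "\<tau> - z \<noteq> 0" if "cmod z < 1" for z using that by auto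
    show ?thesis
    proof (rule that[of "\<lambda>z. G z / ((\<tau> - z) * (1 - cnj \<tau> * z))"])
      show "(\<lambda>z. G z / ((\<tau> - z) * (1 - cnj \<tau> * z))) holomorphic_on ball 0 1"
        by (intro holomorphic_intros holG) (use one_minus_cnj_mult_nonzero \<tau> ne in auto)
    qed (use one_minus_cnj_mult_nonzero \<tau> ne in auto)
  qed
  have Re1: "Re (q z) \<ge> 0" if "cmod z < 1" "z \<noteq> \<tau>" for z
    using Berkson_Porta_Re_nonneg[OF sg gen DW that(1)] Gq[OF that(1)] that
      one_minus_cnj_mult_nonzero[OF \<tau> that(1)] by simp
  \<comment> \<open>The inequality at the point excluded from \<open>Re1\<close> follows by
    continuity of \<open>q\<close>.\<close>
  have Re\<tau>: "Re (q \<tau>) \<ge> 0" if "cmod \<tau> < 1"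
  proof -
    have "isCont q \<tau>"
      using holomorphic_on_imp_continuous_on[OF holq] that
      by (auto simp: continuous_on_eq_continuous_at)
    hence "((\<lambda>z. Re (q z)) \<longlongrightarrow> Re (q \<tau>)) (at \<tau>)" by (intro tendsto_Re) (simp add: isCont_def)
    moreover have "eventually (\<lambda>z. Re (q z) \<ge> 0) (at \<tau>)"
      unfolding eventually_at_topological
      by (rule exI[of _ "ball 0 1"]) (use that Re1 in auto)
    ultimately show ?thesis by (rule tendsto_lowerbound) simp
  qed
  have q: "herglotz q"
    unfolding herglotz_def using holq Re1 Re\<tau> by (metis mem_ball_0)
  obtain z1 where z1: "cmod z1 < 1" "G z1 \<noteq> 0" using nz by auto
  have qnz: "q z \<noteq> 0" if "cmod z < 1" for z
    using herglotz_zero[OF q that _ z1(1)] Gq[OF z1(1)] z1(2) by auto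
  show ?thesis
  proof (rule that[of "\<lambda>z. inverse (q z)"])
    show "herglotz (\<lambda>z. inverse (q z))"
      unfolding herglotz_def
    proof
      show "(\<lambda>z. inverse (q z)) holomorphic_on ball 0 1"
        by (intro holomorphic_intros holq) (use qnz in auto)
      show "\<forall>z\<in>ball 0 1. 0 \<le> Re (inverse (q z))"
        using q by (auto simp: herglotz_def)
    qed
  qed (use qnz Gq in \<open>auto simp: divide_inverse\<close>)
qed

section \<open>Julia's inequality at a boundary fixed point and the mass it forces\<close>

lemma BRFP_Julia:
  assumes sg: "semigroup_disk \<phi>" and B: "BRFP_spectral \<phi> \<sigma> l" and z: "cmod z < 1" and t: "t \<ge> 0"
  shows "exp (l * t) * Re (cayley \<sigma> z) \<le> Re (cayley \<sigma> (\<phi> t z))"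
proof -
  have \<sigma>: "cmod \<sigma> = 1" and lim1: "has_angular_limit (\<phi> t) \<sigma> \<sigma>"
    and lim2: "has_angular_limit (\<lambda>z. (\<phi> t z - \<sigma>) / (z - \<sigma>)) \<sigma> (of_real (exp (- l * t)))"
    using B t by (auto simp: BRFP_spectral_def)
  note sgD = semigroup_disk_holomorphic[OF sg t] semigroup_disk_norm[OF sg t]
  define p where "p = (\<lambda>z. cayley \<sigma> (\<phi> t z))"
  have p: "herglotz p"
    unfolding herglotz_def
  proof
    have "(cayley \<sigma> \<circ> \<phi> t) holomorphic_on ball 0 1"
      by (rule holomorphic_on_compose_gen[OF sgD(1) cayley_holomorphic[OF \<sigma>]]) (use sgD(2) in auto)
    thus "p holomorphic_on ball 0 1" by (simp add: p_def o_def)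
    show "\<forall>z\<in>ball 0 1. 0 \<le> Re (p z)"
      using Re_cayley_pos[OF \<sigma>] sgD(2) by (auto simp: p_def intro: less_imp_le)
  qed
  \<comment> \<open>The mass of \<open>cayley \<sigma> (\<phi> t z)\<close> at \<sigma> is 2 divided
    by the angular derivative \<open>exp (- l * t)\<close>: the factor
    \<open>1 - cnj \<sigma> * z\<close> turns the pole of the kernel into the difference quotient of
    \<open>\<phi> t\<close>.\<close>
  have "has_angular_limit (\<lambda>z. cnj \<sigma> * (\<sigma> + \<phi> t z) / ((\<phi> t z - \<sigma>) / (z - \<sigma>))) \<sigma> (cnj \<sigma> * (\<sigma> + \<sigma>) / of_real (exp (- l * t)))"
    by (intro angular_limit_divide angular_limit_mult angular_limit_add lim1 lim2 angular_limit_isCont) auto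
  also have "cnj \<sigma> * (\<sigma> + \<sigma>) / of_real (exp (- l * t)) = of_real (2 * exp (l * t))"
    using unit_cnj_mult[OF \<sigma>] by (simp add: distrib_left exp_minus divide_inverse flip: of_real_exp)
  finally have "pstar_eq p \<sigma> (of_real (2 * exp (l * t)))"
    unfolding pstar_eq_def
  proof (rule angular_limit_cong[rotated])
    fix z assume z: "cmod z < 1"
    have "\<sigma> - z \<noteq> 0" "\<sigma> - \<phi> t z \<noteq> 0" using unit_circle_neq[OF \<sigma>] z sgD(2)[OF z] by auto
    moreover have "(\<phi> t z - \<sigma>) / (z - \<sigma>) = (\<sigma> - \<phi> t z) / (\<sigma> - z)"
      by (metis minus_diff_eq minus_divide_divide)
    ultimately show "cnj \<sigma> * (\<sigma> + \<phi> t z) / ((\<phi> t z - \<sigma>) / (z - \<sigma>)) = (1 - cnj \<sigma> * z) * p z"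
      by (simp add: one_minus_cnj_unit_mult[OF \<sigma>] p_def cayley_def)
  qed
  from herglotz_radial_mass[OF p \<sigma> _ pstar_radial[OF \<sigma> this] z]
  show ?thesis by (simp add: p_def)
qed

text \<open>The right-hand side is the generator in the coordinate \<open>cayley \<sigma>\<close>;
  it is the function called \<open>N\<close> in the proofs below.\<close>

lemma cayley_flow_derivative:
  assumes sg: "semigroup_disk \<phi>" and gen: "generator_of \<phi> G" and \<sigma>: "cmod \<sigma> = 1"
    and z: "cmod z < 1" and t: "t \<ge> 0"
  shows "((\<lambda>s. cayley \<sigma> (\<phi> s z)) has_vector_derivative 2 * \<sigma> * G (\<phi> t z) / (\<sigma> - \<phi> t z)\<^sup>2) (at t within {0..})"
proof -
  have ne: "\<sigma> - \<phi> t z \<noteq> 0" using unit_circle_neq[OF \<sigma> semigroup_disk_norm[OF sg t z]] by auto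
  have "(cayley \<sigma> has_field_derivative 2 * \<sigma> / (\<sigma> - \<phi> t z)\<^sup>2) (at (\<phi> t z) within (\<lambda>s. \<phi> s z) ` {0..})"
    unfolding cayley_def[abs_def]
    by (rule derivative_eq_intros refl | use ne in \<open>simp add: power2_eq_square algebra_simps\<close>)+
  from field_vector_diff_chain_within[OF generator_derivative[OF sg gen z t] this]
  show ?thesis by (simp add: o_def mult_ac)
qed

text \<open>The infinitesimal form of Julia's inequality, obtained by differentiating it at time \<open>0\<close>.\<close>

lemma BRFP_generator_Re:
  assumes sg: "semigroup_disk \<phi>" and gen: "generator_of \<phi> G" and B: "BRFP_spectral \<phi> \<sigma> l"
    and z: "cmod z < 1"
  shows "l * Re (cayley \<sigma> z) \<le> Re (2 * \<sigma> * G z / (\<sigma> - z)\<^sup>2)"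
proof -
  have \<sigma>: "cmod \<sigma> = 1" using B by (simp add: BRFP_spectral_def)
  have z0: "\<phi> 0 z = z" using semigroup_disk_0[OF sg z] .
  define f where "f = (\<lambda>t. exp (l * t) * Re (cayley \<sigma> z) - Re (cayley \<sigma> (\<phi> t z)))"
  have d: "((\<lambda>s. cayley \<sigma> (\<phi> s z)) has_vector_derivative 2 * \<sigma> * G z / (\<sigma> - z)\<^sup>2) (at 0 within {0..})"
    using cayley_flow_derivative[OF sg gen \<sigma> z order.refl] z0 by simp
  have e: "((\<lambda>t. exp (l * t)) has_real_derivative l) (at 0 within {0..})"
    by (rule derivative_eq_intros refl | simp)+
  have "(f has_real_derivative (l * Re (cayley \<sigma> z) - Re (2 * \<sigma> * G z / (\<sigma> - z)\<^sup>2))) (at 0 within {0..})"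
    unfolding f_def by (intro DERIV_diff DERIV_cmult_right e has_real_derivative_Re d)
  hence "l * Re (cayley \<sigma> z) - Re (2 * \<sigma> * G z / (\<sigma> - z)\<^sup>2) \<le> 0"
    by (rule derivative_nonpos_at_initial_max) (use BRFP_Julia[OF sg B z] z0 in \<open>simp add: f_def\<close>)
  thus ?thesis by simp
qed

text \<open>By the infinitesimal Julia inequality \<open>N - l * cayley \<sigma>\<close> is a
  Herglotz function and has some mass \<open>k \<ge> 0\<close>. Multiplying the masses of
  \<open>N\<close> and \<open>Q\<close> gives
  \<open>(k + 2 * l) * c = - 2 * |\<tau> - \<sigma>|^2\<close>. Dropping the unknown
  \<open>k * c\<close> is the reason why only an inequality results.\<close>

lemma BRFP_mass:
  assumes sg: "semigroup_disk \<phi>" and gen: "generator_of \<phi> G" and B: "BRFP_spectral \<phi> \<sigma> l"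
    and Q: "\<And>z. cmod z < 1 \<Longrightarrow> Q z \<noteq> 0"
    and G: "\<And>z. cmod z < 1 \<Longrightarrow> G z = (\<tau> - z) * (1 - cnj \<tau> * z) / Q z"
    and c: "c \<ge> 0" "pstar_eq Q \<sigma> (of_real c)"
  shows "(cmod (\<tau> - \<sigma>))\<^sup>2 \<le> c * - l"
proof -
  have \<sigma>: "cmod \<sigma> = 1" using B by (simp add: BRFP_spectral_def)
  define N where "N = (\<lambda>z. 2 * \<sigma> * G z / (\<sigma> - z)\<^sup>2)"
  define K where "K = (\<lambda>z. N z + of_real (- l) * cayley \<sigma> z)"
  have "herglotz K"
    unfolding herglotz_def
  proof
    have "G holomorphic_on ball 0 1" using gen by (simp add: generator_of_def)
    thus "K holomorphic_on ball 0 1" unfolding K_def N_def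
      by (intro holomorphic_intros cayley_holomorphic \<sigma>) (use unit_circle_neq[OF \<sigma>] in auto)
    show "\<forall>z\<in>ball 0 1. 0 \<le> Re (K z)"
      using BRFP_generator_Re[OF sg gen B] by (simp add: K_def N_def)
  qed
  then obtain k where k: "k \<ge> 0" "pstar_eq K \<sigma> (of_real k)"
    using herglotz_has_pstar[OF _ \<sigma>] by metis
  have "pstar_eq (\<lambda>z. K z + of_real l * cayley \<sigma> z) \<sigma> (of_real k + of_real l * 2)"
    by (intro pstar_add k pstar_cmult pstar_cayley_self \<sigma>)
  hence N: "pstar_eq N \<sigma> (of_real (k + 2 * l))" by (simp add: K_def mult.commute)
  \<comment> \<open>\<open>G * Q\<close> is a polynomial, so the product of the two mass expressions
    for \<open>N\<close> and \<open>Q\<close> is this polynomial, whose value at \<sigma> is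
    explicit.\<close>
  define X where "X = (\<lambda>z. 2 * cnj \<sigma> * (\<tau> - z) * (1 - cnj \<tau> * z))"
  have "has_angular_limit (\<lambda>z. ((1 - cnj \<sigma> * z) * N z) * ((1 - cnj \<sigma> * z) * Q z)) \<sigma> (of_real (k + 2 * l) * of_real c)"
    using N c(2) unfolding pstar_eq_def by (rule angular_limit_mult)
  hence "has_angular_limit X \<sigma> (of_real (k + 2 * l) * of_real c)"
  proof (rule angular_limit_cong[rotated])
    fix z assume z: "cmod z < 1"
    have "\<sigma> - z \<noteq> 0" using unit_circle_neq[OF \<sigma> z] by auto
    have "((1 - cnj \<sigma> * z) * N z) * ((1 - cnj \<sigma> * z) * Q z) = cnj \<sigma> * (cnj \<sigma> * \<sigma>) * (2 * (G z * Q z))"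
      using \<open>\<sigma> - z \<noteq> 0\<close> by (simp add: one_minus_cnj_unit_mult[OF \<sigma>] N_def power2_eq_square)
    thus "((1 - cnj \<sigma> * z) * N z) * ((1 - cnj \<sigma> * z) * Q z) = X z"
      using Q[OF z] by (simp add: unit_cnj_mult[OF \<sigma>] X_def G[OF z])
  qed
  moreover have "has_angular_limit X \<sigma> (X \<sigma>)"
    unfolding X_def by (intro angular_limit_isCont continuous_intros)
  ultimately have eq: "of_real (k + 2 * l) * of_real c = X \<sigma>"
    by (rule angular_limit_unique[OF \<sigma>])
  have "X \<sigma> = - 2 * (cnj \<sigma> * \<sigma>) * ((\<tau> - \<sigma>) * cnj (\<tau> - \<sigma>))"
    unfolding X_def one_minus_cnj_mult_unit[OF \<sigma>] by (simp add: algebra_simps)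
  hence "X \<sigma> = of_real (- 2 * (cmod (\<tau> - \<sigma>))\<^sup>2)"
    using unit_cnj_mult[OF \<sigma>] complex_norm_square[of "\<tau> - \<sigma>"] by (simp del: complex_cnj_diff)
  hence eq': "(k + 2 * l) * c = - 2 * (cmod (\<tau> - \<sigma>))\<^sup>2"
    using eq by (metis of_real_eq_iff of_real_mult)
  have "k * c \<ge> 0" using k c by simp
  thus ?thesis using eq' by (simp add: algebra_simps)
qed

section \<open>Boundary regular fixed points from masses\<close>

text \<open>With \<open>m = c / 2 * Re w\<close>, the hypothesis \<open>Re Q \<ge> m\<close> says
  that \<open>1 / Q\<close> lies in the disk with centre and radius \<open>1 / (2 * m)\<close>.
  Hence \<open>Re (E / Q)\<close> is at most \<open>(|E| + Re E) / (2 * m)\<close>, and for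
  \<open>E = (w - w0) * (w + cnj w0)\<close> one has
  \<open>|E| + Re E \<le> 2 * (Re w)^2\<close>.\<close>

lemma half_plane_inequality:
  fixes w w0 Q :: complex
  assumes w: "Re w > 0" and c: "c > 0" and Q: "c / 2 * Re w \<le> Re Q"
  shows "Re ((w - w0) * (w + cnj w0) / Q) \<le> 2 / c * Re w"
proof -
  define m where "m = c / 2 * Re w"
  have m: "m > 0" using w c by (simp add: m_def)
  define E where "E = (w - w0) * (w + cnj w0)"
  \<comment> \<open>A vertical translation makes \<open>w0\<close> real, after which
    \<open>E\<close> is a difference of squares.\<close>
  define v where "v = w - \<i> * of_real (Im w0)"
  have Ev: "E = v * v - of_real (Re w0) * of_real (Re w0)"
    by (simp add: E_def v_def complex_eq_iff algebra_simps)
  have "cmod E \<le> cmod (v * v) + cmod (of_real (Re w0) * of_real (Re w0))"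
    unfolding Ev by (rule norm_triangle_ineq4)
  also have "\<dots> = (cmod v)\<^sup>2 + (Re w0)\<^sup>2" by (simp add: norm_mult power2_eq_square)
  finally have "cmod E \<le> (cmod v)\<^sup>2 + (Re w0)\<^sup>2" .
  moreover have "Re E = (Re v)\<^sup>2 - (Im v)\<^sup>2 - (Re w0)\<^sup>2" unfolding Ev by (simp add: power2_eq_square)
  moreover have "Re v = Re w" by (simp add: v_def)
  ultimately have E: "cmod E + Re E \<le> 2 * (Re w)\<^sup>2" by (simp add: cmod_power2)
  have Qm: "m \<le> Re Q" using Q by (simp add: m_def)
  hence Q0: "Q \<noteq> 0" using m by auto
  have "(cmod (2 * m - Q))\<^sup>2 \<le> (cmod Q)\<^sup>2"
  proof -
    have "(cmod Q)\<^sup>2 - (cmod (2 * m - Q))\<^sup>2 = 4 * m * (Re Q - m)"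
      unfolding cmod_power2 by (simp add: power2_eq_square algebra_simps)
    moreover have "4 * m * (Re Q - m) \<ge> 0" using m Qm by simp
    ultimately show ?thesis by linarith
  qed
  hence le: "cmod (2 * m - Q) \<le> cmod Q" by (rule power2_le_imp_le) simp
  have "1 / Q - 1 / (2 * of_real m) = (2 * of_real m - Q) / (2 * of_real m * Q)"
    using Q0 m by (simp add: diff_frac_eq mult.commute)
  hence "cmod (1 / Q - 1 / (2 * of_real m)) = cmod (2 * m - Q) / (2 * m * cmod Q)"
    using m by (simp add: norm_divide norm_mult)
  also have "\<dots> \<le> 1 / (2 * m)" using le m Q0 by (simp add: field_simps)
  finally have disc: "cmod (1 / Q - 1 / (2 * of_real m)) \<le> 1 / (2 * m)" .
  have "E / Q = E * (1 / Q - 1 / (2 * of_real m)) + E / of_real (2 * m)" by (simp add: algebra_simps)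
  hence "Re (E / Q) = Re (E * (1 / Q - 1 / (2 * of_real m))) + Re E / (2 * m)"
    by (simp only: plus_complex.simps Re_divide_of_real)
  also have "Re (E * (1 / Q - 1 / (2 * of_real m))) \<le> cmod E * (1 / (2 * m))"
    using complex_Re_le_cmod[of "E * (1 / Q - 1 / (2 * of_real m))"] mult_left_mono[OF disc, of "cmod E"]
    by (simp add: norm_mult)
  also have "cmod E * (1 / (2 * m)) + Re E / (2 * m) = (cmod E + Re E) / (2 * m)" by (simp add: add_divide_distrib)
  also have "\<dots> \<le> 2 * (Re w)\<^sup>2 / (2 * m)" using E m by (intro divide_right_mono) auto
  also have "\<dots> = 2 / c * Re w" using w c by (simp add: m_def power2_eq_square)
  finally show ?thesis by (simp add: E_def)
qed

text \<open>The numerator of the Berkson-Porta formula in the half-plane coordinate: its zeros,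
  \<tau> and the reflection of \<tau> in the circle, become \<open>cayley \<sigma> \<tau>\<close>
  and the reflection of this point in the imaginary axis. For \<tau> on the circle the two
  coincide.\<close>

lemma cayley_vector_field:
  assumes \<sigma>: "cmod \<sigma> = 1" and ne: "\<tau> \<noteq> \<sigma>" "z \<noteq> \<sigma>"
  shows "2 * \<sigma> * ((\<tau> - z) * (1 - cnj \<tau> * z)) / (\<sigma> - z)\<^sup>2 =
    - of_real ((cmod (\<tau> - \<sigma>))\<^sup>2 / 2) * ((cayley \<sigma> z - cayley \<sigma> \<tau>) * (cayley \<sigma> z + cnj (cayley \<sigma> \<tau>)))"
proof -
  define a b d where "a = \<sigma> - z" and "b = \<sigma> - \<tau>" and "d = 1 - cnj \<tau> * \<sigma>"
  have d: "d = \<sigma> * cnj b" unfolding d_def b_def by (rule one_minus_cnj_mult_unit[OF \<sigma>])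
  have nz: "a \<noteq> 0" "b \<noteq> 0" "\<sigma> \<noteq> 0" "cnj b \<noteq> 0" "d \<noteq> 0" using \<sigma> ne by (auto simp: a_def b_def d)
  have "cayley \<sigma> z - cayley \<sigma> \<tau> = ((\<sigma> + z) * b - (\<sigma> + \<tau>) * a) / (a * b)"
    unfolding cayley_def a_def[symmetric] b_def[symmetric] using nz by (simp add: diff_frac_eq)
  also have "(\<sigma> + z) * b - (\<sigma> + \<tau>) * a = 2 * \<sigma> * (z - \<tau>)" by (simp add: a_def b_def algebra_simps)
  finally have 1: "cayley \<sigma> z - cayley \<sigma> \<tau> = 2 * \<sigma> * (z - \<tau>) / (a * b)" .
  have "cnj (cayley \<sigma> \<tau>) = \<sigma> * (cnj \<sigma> + cnj \<tau>) / d"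
    unfolding d using nz by (simp add: cayley_def b_def)
  also have "\<sigma> * (cnj \<sigma> + cnj \<tau>) = 1 + cnj \<tau> * \<sigma>" using unit_mult_cnj[OF \<sigma>] by (simp add: algebra_simps)
  finally have "cayley \<sigma> z + cnj (cayley \<sigma> \<tau>) = ((\<sigma> + z) * d + (1 + cnj \<tau> * \<sigma>) * a) / (a * d)"
    unfolding cayley_def a_def[symmetric] using nz by (simp add: add_frac_eq)
  also have "(\<sigma> + z) * d + (1 + cnj \<tau> * \<sigma>) * a = 2 * \<sigma> * (1 - cnj \<tau> * z)"
    by (simp add: a_def d_def algebra_simps)
  finally have 2: "cayley \<sigma> z + cnj (cayley \<sigma> \<tau>) = 2 * \<sigma> * (1 - cnj \<tau> * z) / (a * d)" .
  have "of_real ((cmod (\<tau> - \<sigma>))\<^sup>2) = b * cnj b"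
    unfolding b_def by (subst norm_minus_commute) (rule complex_norm_square)
  hence n: "of_real ((cmod (\<tau> - \<sigma>))\<^sup>2 / 2) = b * cnj b / 2" by simp
  define u where "u = z - \<tau>"
  have u: "\<tau> - z = - u" by (simp add: u_def)
  show ?thesis unfolding 1 2 n d a_def[symmetric] u u_def[symmetric] using nz
    by (simp add: power2_eq_square)
qed

text \<open>The converse of \<open>BRFP_generator_Re\<close> at the level of vector fields: \<open>cayley \<sigma>\<close> sends \<open>\<sigma>\<close> to
  \<open>\<infinity>\<close>, where \<open>half_plane_inequality\<close> applies.\<close>

lemma generator_Re_lower:
  assumes \<sigma>: "cmod \<sigma> = 1" and ne: "\<tau> \<noteq> \<sigma>" and z: "cmod z < 1" and c: "c > 0"
    and Q: "c / 2 * Re (cayley \<sigma> z) \<le> Re Q"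
  shows "- ((cmod (\<tau> - \<sigma>))\<^sup>2 / c) * Re (cayley \<sigma> z) \<le> Re (2 * \<sigma> * ((\<tau> - z) * (1 - cnj \<tau> * z) / Q) / (\<sigma> - z)\<^sup>2)"
proof -
  define r where "r = (cmod (\<tau> - \<sigma>))\<^sup>2 / 2"
  define H where "H = (cayley \<sigma> z - cayley \<sigma> \<tau>) * (cayley \<sigma> z + cnj (cayley \<sigma> \<tau>))"
  have r: "r \<ge> 0" by (simp add: r_def)
  have "2 * \<sigma> * ((\<tau> - z) * (1 - cnj \<tau> * z) / Q) / (\<sigma> - z)\<^sup>2 = 2 * \<sigma> * ((\<tau> - z) * (1 - cnj \<tau> * z)) / (\<sigma> - z)\<^sup>2 / Q"
    by simp
  also have "\<dots> = - of_real r * H / Q"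
    using cayley_vector_field[OF \<sigma> ne] unit_circle_neq[OF \<sigma> z] by (simp only: r_def H_def)
  also have "\<dots> = of_real (- r) * (H / Q)" by simp
  finally have eq: "2 * \<sigma> * ((\<tau> - z) * (1 - cnj \<tau> * z) / Q) / (\<sigma> - z)\<^sup>2 = of_real (- r) * (H / Q)" .
  have "r * Re (H / Q) \<le> r * (2 / c * Re (cayley \<sigma> z))"
    unfolding H_def by (intro mult_left_mono half_plane_inequality Re_cayley_pos \<sigma> z c Q r)
  moreover have "Re (of_real x * y) = x * Re y" for x y by simp
  moreover have "- ((cmod (\<tau> - \<sigma>))\<^sup>2 / c) * Re (cayley \<sigma> z) = - (r * (2 / c * Re (cayley \<sigma> z)))" by (simp add: r_def)
  ultimately show ?thesis unfolding eq by (metis minus_mult_left neg_le_iff_le)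
qed

section \<open>Orbit and growth estimates, and the spectral value determined by the mass\<close>

lemma initial_le_of_derivative_nonneg:
  fixes f :: "real \<Rightarrow> real"
  assumes "\<And>t. t \<ge> 0 \<Longrightarrow> (f has_real_derivative f' t) (at t within {0..})"
    and "\<And>t. t \<ge> 0 \<Longrightarrow> f' t \<ge> 0" and T: "T \<ge> 0"
  shows "f 0 \<le> f T"
proof -
  have "\<exists>x\<in>{0..T}. f T - f 0 = (\<lambda>h. f' x * h) (T - 0)"
  proof (rule mvt_very_simple[OF T])
    fix x assume x: "0 \<le> x" "x \<le> T"
    show "(f has_derivative (\<lambda>h. f' x * h)) (at x within {0..T})"
      using has_field_derivative_subset[OF assms(1)[OF x(1)]] by (auto simp: has_field_derivative_def)
  qed
  then obtain x where x: "x \<ge> 0" "f T - f 0 = f' x * T" by auto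
  thus ?thesis using mult_nonneg_nonneg[OF assms(2)[OF x(1)] T] by simp
qed

lemma increment_le_of_derivative_bound:
  fixes f :: "real \<Rightarrow> complex"
  assumes "\<And>t. t \<in> {0..T} \<Longrightarrow> (f has_vector_derivative f' t) (at t within {0..})"
    and "\<And>t. t \<in> {0..T} \<Longrightarrow> cmod (f' t) \<le> B" and T: "T \<ge> 0"
  shows "cmod (f T - f 0) \<le> B * T"
proof -
  have "cmod (f T - f 0) \<le> B * norm (T - 0)"
  proof (rule differentiable_bound[where f' = "\<lambda>t h. h *\<^sub>R f' t" and S = "{0..T}"])
    fix x assume x: "x \<in> {0..T}"
    show "(f has_derivative (\<lambda>h. h *\<^sub>R f' x)) (at x within {0..T})"
      using has_vector_derivative_within_subset[OF assms(1)[OF x], of "{0..T}"] by (auto simp: has_vector_derivative_def)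
    show "onorm (\<lambda>h. h *\<^sub>R f' x) \<le> B"
    proof (rule onorm_bound)
      show "0 \<le> B" using assms(2)[OF x] norm_ge_zero order.trans by blast
      show "norm (h *\<^sub>R f' x) \<le> B * norm h" for h
        using mult_left_mono[OF assms(2)[OF x], of "\<bar>h\<bar>"] by (simp add: mult.commute)
    qed
  qed (use T in auto)
  thus ?thesis using T by simp
qed

text \<open>The 5 is 4 from \<open>herglotz_growth\<close> at \<open>w = 0\<close> plus 1 for
  removing the term \<open>cnj (p 0)\<close>.\<close>

lemma herglotz_bound_by_value_at_0:
  assumes "herglotz p" "cmod z < 1"
  shows "cmod (p z) \<le> 5 * cmod (p 0) / (1 - cmod z)"
proof -
  have "cmod (p z + cnj (p 0)) * (1 - (cmod z)\<^sup>2) \<le> 4 * Re (p 0)"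
    using herglotz_growth[OF assms, of 0] by simp
  moreover have "cmod (p z + cnj (p 0)) * (1 - cmod z) \<le> cmod (p z + cnj (p 0)) * (1 - (cmod z)\<^sup>2)"
    using assms(2) by (intro mult_left_mono) (auto simp: power2_eq_square intro: mult_left_le)
  moreover have "Re (p 0) \<le> cmod (p 0)" by (rule complex_Re_le_cmod)
  ultimately have "cmod (p z + cnj (p 0)) * (1 - cmod z) \<le> 4 * cmod (p 0)" by linarith
  moreover have "cmod (p z) * (1 - cmod z) \<le> (cmod (p z + cnj (p 0)) + cmod (p 0)) * (1 - cmod z)"
    using norm_triangle_ineq4[of "p z + cnj (p 0)" "cnj (p 0)"] assms(2) by (intro mult_right_mono) auto
  moreover have "cmod (p 0) * (1 - cmod z) \<le> cmod (p 0)" using assms(2) by (simp add: mult_left_le)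
  ultimately have "cmod (p z) * (1 - cmod z) \<le> 5 * cmod (p 0)" unfolding distrib_right by linarith
  thus ?thesis using assms(2) by (simp add: field_simps)
qed

lemma exp_scaled_derivative:
  fixes c :: real
  shows "((\<lambda>s. exp (c * s)) has_real_derivative c * exp (c * t)) (at t within S)"
  by (rule derivative_eq_intros refl | simp)+

text \<open>In the coordinate \<open>u = cayley \<sigma> z\<close> the flow satisfies \<open>u' \<approx> - L u\<close> near \<open>\<infinity>\<close> within Stolz angles.
  Since \<open>Re u\<close> decays at most like \<open>exp (- L s)\<close>, the difference of \<open>E = exp (L s) u(s)\<close> and \<open>u(0)\<close> is
  a Herglotz function, and its growth bound keeps the orbits in a larger Stolz angle; hence
  \<open>E \<approx> u(0)\<close>.\<close>

lemma BRFP_of_mass: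
  assumes sg: "semigroup_disk \<phi>" and gen: "generator_of \<phi> G" and \<sigma>: "cmod \<sigma> = 1" and ne: "\<tau> \<noteq> \<sigma>"
    and Q: "herglotz Q" and c: "c > 0" and star: "pstar_eq Q \<sigma> (of_real c)"
    and G: "\<And>z. cmod z < 1 \<Longrightarrow> G z = (\<tau> - z) * (1 - cnj \<tau> * z) / Q z"
  shows "BRFP_spectral \<phi> \<sigma> (- ((cmod (\<tau> - \<sigma>))\<^sup>2 / c))"
proof -
  define L where "L = (cmod (\<tau> - \<sigma>))\<^sup>2 / c"
  have L0: "L \<ge> 0" using c by (simp add: L_def)
  define N where "N = (\<lambda>y. 2 * \<sigma> * G y / (\<sigma> - y)\<^sup>2)"
  have mass: "c / 2 * Re (cayley \<sigma> z) \<le> Re (Q z)" if "cmod z < 1" for z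
    by (rule herglotz_radial_mass[OF Q \<sigma> c pstar_radial[OF \<sigma> star] that])
  have Q0: "Q z \<noteq> 0" if "cmod z < 1" for z
  proof -
    have "c / 2 * Re (cayley \<sigma> z) > 0" using c Re_cayley_pos[OF \<sigma> that] by simp
    thus ?thesis using mass[OF that] by auto
  qed
  have ReN: "Re (N y) + L * Re (cayley \<sigma> y) \<ge> 0" if "cmod y < 1" for y
    using generator_Re_lower[OF \<sigma> ne that c mass[OF that]] by (simp add: N_def L_def G[OF that])
  define E where "E = (\<lambda>z s. of_real (exp (L * s)) * cayley \<sigma> (\<phi> s z))"
  have dE: "(E z has_vector_derivative of_real (exp (L * s)) * (N (\<phi> s z) + of_real L * cayley \<sigma> (\<phi> s z))) (at s within {0..})"
    if "cmod z < 1" "s \<ge> 0" for z s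
  proof -
    have "((\<lambda>s. of_real (exp (L * s)) * cayley \<sigma> (\<phi> s z)) has_vector_derivative
       of_real (exp (L * s)) * N (\<phi> s z) + of_real (L * exp (L * s)) * cayley \<sigma> (\<phi> s z)) (at s within {0..})"
      unfolding N_def
      by (intro has_vector_derivative_mult has_vector_derivative_of_real exp_scaled_derivative cayley_flow_derivative[OF sg gen \<sigma>] that)
    thus ?thesis by (simp add: E_def algebra_simps)
  qed
  have E0: "E z 0 = cayley \<sigma> z" if "cmod z < 1" for z
    using semigroup_disk_0[OF sg that] by (simp add: E_def)
  have ReE: "Re (cayley \<sigma> z) \<le> Re (E z s)" if z: "cmod z < 1" and s: "s \<ge> 0" for z s
  proof -
    have "Re (E z 0) \<le> Re (E z s)"
    proof (rule initial_le_of_derivative_nonneg[OF has_real_derivative_Re[OF dE[OF z]] _ s])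
      fix t :: real assume t: "t \<ge> 0"
      have "0 \<le> exp (L * t) * (Re (N (\<phi> t z)) + L * Re (cayley \<sigma> (\<phi> t z)))"
        using ReN[OF semigroup_disk_norm[OF sg t z]] by simp
      thus "0 \<le> Re (of_real (exp (L * t)) * (N (\<phi> t z) + of_real L * cayley \<sigma> (\<phi> t z)))" by simp
    qed
    thus ?thesis using E0[OF z] by simp
  qed
  have herg: "herglotz (\<lambda>z. E z s - cayley \<sigma> z)" if s: "s \<ge> 0" for s
    unfolding herglotz_def
  proof
    have "(cayley \<sigma> \<circ> \<phi> s) holomorphic_on ball 0 1"
      by (rule holomorphic_on_compose_gen[OF semigroup_disk_holomorphic[OF sg s] cayley_holomorphic[OF \<sigma>]])
         (use semigroup_disk_norm[OF sg s] in auto)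
    thus "(\<lambda>z. E z s - cayley \<sigma> z) holomorphic_on ball 0 1"
      unfolding E_def o_def by (intro holomorphic_intros cayley_holomorphic \<sigma>)
    show "\<forall>z\<in>ball 0 1. 0 \<le> Re (E z s - cayley \<sigma> z)" using ReE s by simp
  qed
  \<comment> \<open>As \<open>N\<close> is \<open>u'\<close> in the coordinate \<open>u\<close>,
    this is the asymptotic equation with rate \<open>- L\<close>. It is available only inside Stolz
    angles, which is why the orbits have to be confined to one.\<close>
  have ratio: "has_angular_limit (\<lambda>y. N y / cayley \<sigma> y) \<sigma> (- of_real L)"
  proof -
    define X where "X = (\<lambda>y. 2 * (\<tau> - y) * (1 - cnj \<tau> * y))"
    have "has_angular_limit (\<lambda>y. X y / (((1 - cnj \<sigma> * y) * Q y) * (\<sigma> + y))) \<sigma> (X \<sigma> / (of_real c * (\<sigma> + \<sigma>)))"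
      unfolding X_def using star[unfolded pstar_eq_def] c \<sigma>
      by (intro angular_limit_divide angular_limit_mult angular_limit_isCont) auto
    also have "X \<sigma> / (of_real c * (\<sigma> + \<sigma>)) = - of_real L"
    proof -
      have "X \<sigma> = - (2 * \<sigma> * ((\<tau> - \<sigma>) * cnj (\<tau> - \<sigma>)))"
        unfolding X_def one_minus_cnj_mult_unit[OF \<sigma>] by (simp add: algebra_simps)
      also have "(\<tau> - \<sigma>) * cnj (\<tau> - \<sigma>) = of_real ((cmod (\<tau> - \<sigma>))\<^sup>2)"
        by (rule complex_norm_square[symmetric])
      also have "(cmod (\<tau> - \<sigma>))\<^sup>2 = c * L" using c by (simp add: L_def)
      finally show ?thesis using c \<sigma> by (auto simp: mult_2[symmetric])
    qed
    finally show ?thesis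
    proof (rule angular_limit_cong[rotated])
      fix y assume y: "cmod y < 1"
      have "\<sigma> - y \<noteq> 0" "\<sigma> + y \<noteq> 0"
        using unit_circle_neq[OF \<sigma> y] unit_circle_neq[OF \<sigma>, of "- y"] y by (auto simp: add_eq_0_iff)
      have "N y / cayley \<sigma> y = 2 * \<sigma> * G y / ((\<sigma> - y) * (\<sigma> + y))"
        using \<open>\<sigma> - y \<noteq> 0\<close> by (simp add: N_def cayley_def power2_eq_square)
      also have "\<dots> = \<sigma> * X y / (Q y * ((\<sigma> - y) * (\<sigma> + y)))" by (simp add: G[OF y] X_def)
      also have "\<dots> = (cnj \<sigma> * (\<sigma> * X y)) / (cnj \<sigma> * (Q y * ((\<sigma> - y) * (\<sigma> + y))))"
        using \<sigma> by auto
      also have "cnj \<sigma> * (\<sigma> * X y) = X y" by (simp only: mult.assoc[symmetric] unit_cnj_mult[OF \<sigma>] mult_1)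
      also have "cnj \<sigma> * (Q y * ((\<sigma> - y) * (\<sigma> + y))) = ((1 - cnj \<sigma> * y) * Q y) * (\<sigma> + y)"
        unfolding one_minus_cnj_unit_mult[OF \<sigma>] by (simp only: mult_ac)
      finally show "X y / (((1 - cnj \<sigma> * y) * Q y) * (\<sigma> + y)) = N y / cayley \<sigma> y" ..
    qed
  qed
  have main: "(\<phi> T \<longlongrightarrow> \<sigma>) (at \<sigma> within stolz_angle \<sigma> M) \<and>
      ((\<lambda>z. (\<phi> T z - \<sigma>) / (z - \<sigma>)) \<longlongrightarrow> of_real (exp (L * T))) (at \<sigma> within stolz_angle \<sigma> M)"
    if T: "T \<ge> 0" and M: "M > 1" for T M
  proof -
    define F where "F = at \<sigma> within stolz_angle \<sigma> M"
    define X where "X = exp (L * T)"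
    have X: "X \<ge> 1" using L0 T by (simp add: X_def)
    have expX: "exp (L * s) \<le> X" "exp (L * s) \<ge> 1" if "s \<in> {0..T}" for s
      using that L0 by (auto simp: X_def mult_left_mono)
    \<comment> \<open>Compactness of the time interval bounds the functions
      \<open>E z s - cayley \<sigma> z\<close> at \<open>z = 0\<close> uniformly in
      \<open>s\<close>; the growth bound for Herglotz functions then holds uniformly as
      well.\<close>
    have "continuous_on {0..T} (\<lambda>s. E 0 s - cayley \<sigma> 0)"
    proof (intro continuous_intros)
      show "continuous_on {0..T} (E 0)"
        by (rule continuous_on_vector_derivative)
           (rule has_vector_derivative_within_subset[OF dE], auto)
    qed
    hence "bounded ((\<lambda>s. E 0 s - cayley \<sigma> 0) ` {0..T})"
      by (intro compact_imp_bounded compact_continuous_image) auto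
    then obtain B where "\<forall>u\<in>(\<lambda>s. E 0 s - cayley \<sigma> 0) ` {0..T}. cmod u \<le> B"
      unfolding bounded_iff by blast
    hence B: "cmod (E 0 s - cayley \<sigma> 0) \<le> B" if "s \<in> {0..T}" for s
      using that by blast
    have B0: "B \<ge> 0" using B[of 0] T by (auto intro: order.trans[OF norm_ge_zero])
    \<comment> \<open>The 2 bounds the numerator of \<open>cayley \<sigma> z\<close>; the term
      \<open>5 * B * M\<close> is the growth bound with \<open>1 / (1 - |z|)\<close> replaced by
      \<open>M / |\<sigma> - z|\<close>.\<close>
    define A where "A = 2 + 5 * B * M"
    have A: "A \<ge> 2" using B0 M by (simp add: A_def)
    \<comment> \<open>\<open>K\<close> bounds \<open>|u| / Re u\<close> along the orbits:
      \<open>|u| \<le> A / |\<sigma> - z|\<close> by \<open>bound\<close>, while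
      \<open>Re u \<ge> 1 / (M * X * |\<sigma> - z|)\<close> by \<open>ReU\<close>.\<close>
    define K where "K = A * M * X"
    have K: "K > 0" using A M X by (simp add: K_def)
    have Mstolz: "cmod z < 1" "\<sigma> \<noteq> z" "cmod (\<sigma> - z) > 0" "cmod (\<sigma> - z) < M * (1 - cmod z)" if "z \<in> stolz_angle \<sigma> M" for z
      using that unit_circle_neq[OF \<sigma>] by (auto simp: stolz_angle_def)
    have bound: "cmod (E z s) \<le> A / cmod (\<sigma> - z)" if z: "z \<in> stolz_angle \<sigma> M" and s: "s \<in> {0..T}" for z s
    proof -
      note zz = Mstolz[OF z]
      have "cmod (cayley \<sigma> z) \<le> 2 / cmod (\<sigma> - z)"
        unfolding cayley_def norm_divide
        using zz(1,3) \<sigma> norm_triangle_ineq[of \<sigma> z] by (intro divide_right_mono) auto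
      moreover have "cmod (E z s - cayley \<sigma> z) \<le> 5 * B * M / cmod (\<sigma> - z)"
      proof -
        have "cmod (E z s - cayley \<sigma> z) \<le> 5 * cmod (E 0 s - cayley \<sigma> 0) / (1 - cmod z)"
          using herglotz_bound_by_value_at_0[OF herg zz(1)] s by auto
        also have "\<dots> \<le> 5 * B * (1 / (1 - cmod z))"
          using B[OF s] zz(1) by (simp add: divide_right_mono)
        also have "\<dots> \<le> 5 * B * (M / cmod (\<sigma> - z))"
          using zz B0 by (intro mult_left_mono) (auto simp: field_simps)
        finally show ?thesis by simp
      qed
      ultimately show ?thesis
        using norm_triangle_ineq[of "cayley \<sigma> z" "E z s - cayley \<sigma> z"] by (simp add: A_def add_divide_distrib)
    qed
    have ReU: "1 / (M * X * cmod (\<sigma> - z)) \<le> Re (cayley \<sigma> (\<phi> s z))" if z: "z \<in> stolz_angle \<sigma> M" and s: "s \<in> {0..T}" for z s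
    proof -
      note zz = Mstolz[OF z]
      have pos: "Re (cayley \<sigma> (\<phi> s z)) > 0" using Re_cayley_pos[OF \<sigma>] semigroup_disk_norm[OF sg] s zz by auto
      have "1 / (M * cmod (\<sigma> - z)) = (cmod (\<sigma> - z) / M) / (cmod (\<sigma> - z))\<^sup>2"
        using zz M by (simp add: power2_eq_square)
      also have "\<dots> \<le> (1 - (cmod z)\<^sup>2) / (cmod (\<sigma> - z))\<^sup>2"
      proof (rule divide_right_mono)
        have "cmod (\<sigma> - z) / M \<le> 1 - cmod z" using zz M by (simp add: field_simps)
        also have "\<dots> \<le> 1 - (cmod z)\<^sup>2" using zz by (simp add: power2_eq_square mult_left_le)
        finally show "cmod (\<sigma> - z) / M \<le> 1 - (cmod z)\<^sup>2" .
      qed simp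
      also have "\<dots> \<le> exp (L * s) * Re (cayley \<sigma> (\<phi> s z))"
        using ReE[OF zz(1), of s] s by (simp add: E_def Re_cayley[OF \<sigma>, symmetric])
      also have "\<dots> \<le> X * Re (cayley \<sigma> (\<phi> s z))" using expX[OF s] pos by simp
      finally show ?thesis using X M zz(3) by (simp add: field_simps)
    qed
    have near: "cmod (\<sigma> - \<phi> s z) \<le> 2 * M * X * cmod (\<sigma> - z)" if z: "z \<in> stolz_angle \<sigma> M" and s: "s \<in> {0..T}" for z s
    proof -
      note zz = Mstolz[OF z]
      have y: "cmod (\<phi> s z) < 1" using semigroup_disk_norm[OF sg _ zz(1)] s by auto
      have y': "cmod (\<sigma> - \<phi> s z) > 0" using unit_circle_neq[OF \<sigma> y] by auto
      have "1 / (M * X * cmod (\<sigma> - z)) \<le> cmod (cayley \<sigma> (\<phi> s z))"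
        using ReU[OF z s] complex_Re_le_cmod order.trans by blast
      also have "\<dots> \<le> 2 / cmod (\<sigma> - \<phi> s z)"
        unfolding cayley_def norm_divide
        using y \<sigma> norm_triangle_ineq[of \<sigma> "\<phi> s z"] by (intro divide_right_mono) auto
      finally show ?thesis using X M zz(3) y' by (simp add: field_simps)
    qed
    have tend: "((\<lambda>z. cmod (\<sigma> - z)) \<longlongrightarrow> cmod (\<sigma> - \<sigma>)) F" unfolding F_def by (intro tendsto_intros)
    have evS: "eventually (\<lambda>z. z \<in> stolz_angle \<sigma> M) F" unfolding F_def by (rule eventually_in_stolz)
    have \<phi>lim: "(\<phi> T \<longlongrightarrow> \<sigma>) F"
    proof (rule Lim_transform_bound[where g = "\<lambda>z. 2 * M * X * cmod (\<sigma> - z)", THEN LIM_zero_cancel])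
      show "eventually (\<lambda>z. cmod (\<phi> T z - \<sigma>) \<le> norm (2 * M * X * cmod (\<sigma> - z))) F"
        using evS
      proof eventually_elim
        case (elim z)
        thus ?case using near[OF elim, of T] T by (simp add: norm_minus_commute)
      qed
      show "((\<lambda>z. 2 * M * X * cmod (\<sigma> - z)) \<longlongrightarrow> 0) F"
        using tendsto_mult_left[OF tend, of "2 * M * X"] by simp
    qed
    have key: "((\<lambda>z. (\<sigma> - z) * E z T - (\<sigma> + z)) \<longlongrightarrow> 0) F"
    proof (rule tendstoI)
      fix e :: real assume e: "e > 0"
      \<comment> \<open>Chosen so that the accumulated drift \<open>\<epsilon> * A * T\<close> stays
        below \<open>e\<close>; writing \<open>T + 1\<close> keeps the denominator positive when
        \<open>T = 0\<close>.\<close>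
      define \<epsilon> where "\<epsilon> = e / (2 * (T + 1) * X * A)"
      have \<epsilon>: "\<epsilon> > 0" using e T X A by (simp add: \<epsilon>_def)
      \<comment> \<open>The bound \<open>|u| \<le> K * Re u\<close> reads
        \<open>|\<sigma> + y| * |\<sigma> - y| \<le> K * (1 - |y|^2)\<close>. Within distance 1 of
        \<sigma> the first factor is at least 1, and \<open>1 - |y|^2 \<le> 2 * (1 - |y|)\<close>;
        this gives the opening \<open>2 * K\<close>, and the added 1 makes the inequality
        strict.\<close>
      have "((\<lambda>y. N y / cayley \<sigma> y) \<longlongrightarrow> - of_real L) (at \<sigma> within stolz_angle \<sigma> (2 * K + 1))"
        using angular_limitD[OF ratio] K by simp
      then obtain \<delta> where \<delta>: "\<delta> > 0"
        and \<delta>': "\<And>y. y \<in> stolz_angle \<sigma> (2 * K + 1) \<Longrightarrow> y \<noteq> \<sigma> \<Longrightarrow> cmod (y - \<sigma>) < \<delta> \<Longrightarrow> cmod (N y / cayley \<sigma> y + of_real L) < \<epsilon>"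
        using \<epsilon> unfolding tendsto_iff eventually_at dist_norm by fastforce
      have "((\<lambda>z. 2 * M * X * cmod (\<sigma> - z)) \<longlongrightarrow> 0) F"
        using tendsto_mult_left[OF tend, of "2 * M * X"] by simp
      hence "eventually (\<lambda>z. 2 * M * X * cmod (\<sigma> - z) < min \<delta> 1) F"
        using \<delta> by (intro order_tendstoD(2)[where y = 0]) auto
      thus "eventually (\<lambda>z. dist ((\<sigma> - z) * E z T - (\<sigma> + z)) 0 < e) F"
        using evS
      proof eventually_elim
        case (elim z)
        note z = elim(2) and zz = Mstolz[OF elim(2)]
        have der: "cmod (of_real (exp (L * s)) * (N (\<phi> s z) + of_real L * cayley \<sigma> (\<phi> s z))) \<le> \<epsilon> * A / cmod (\<sigma> - z)"
          if s: "s \<in> {0..T}" for s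
        proof -
          define y where "y = \<phi> s z"
          have y: "cmod y < 1" unfolding y_def using semigroup_disk_norm[OF sg _ zz(1)] s by auto
          have small: "cmod (\<sigma> - y) < \<delta>" "cmod (\<sigma> - y) < 1"
            using near[OF z s] elim(1) by (auto simp: y_def)
          have ypos: "cmod (\<sigma> - y) > 0" "\<sigma> \<noteq> y" using unit_circle_neq[OF \<sigma> y] by auto
          have U: "cmod (cayley \<sigma> y) = cmod (E z s) / exp (L * s)" by (simp add: E_def y_def norm_mult)
          also have "\<dots> \<le> cmod (E z s)" using mult_left_mono[OF expX(2)[OF s], of "cmod (E z s)"] by (simp add: field_simps)
          also have "\<dots> \<le> A / cmod (\<sigma> - z)" by (rule bound[OF z s])
          also have "\<dots> = K * (1 / (M * X * cmod (\<sigma> - z)))" using M X by (simp add: K_def)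
          also have "\<dots> \<le> K * Re (cayley \<sigma> y)" using ReU[OF z s] K unfolding y_def by (intro mult_left_mono) auto
          finally have "cmod (\<sigma> + y) / cmod (\<sigma> - y) \<le> K * ((1 - (cmod y)\<^sup>2) / (cmod (\<sigma> - y))\<^sup>2)"
            by (simp add: cayley_def norm_divide Re_cayley[OF \<sigma>, unfolded cayley_def])
          hence prod: "cmod (\<sigma> + y) * cmod (\<sigma> - y) \<le> K * (1 - (cmod y)\<^sup>2)"
            using ypos(1) by (simp add: field_simps power2_eq_square)
          have "cmod (2 * \<sigma>) \<le> cmod (\<sigma> + y) + cmod (\<sigma> - y)"
            using norm_triangle_ineq[of "\<sigma> + y" "\<sigma> - y"] by simp
          hence "cmod (\<sigma> + y) \<ge> 1" using small(2) \<sigma> by (simp add: norm_mult)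
          hence "cmod (\<sigma> - y) \<le> cmod (\<sigma> + y) * cmod (\<sigma> - y)"
            using ypos(1) by (simp add: mult_le_cancel_right1)
          also note prod
          also have "K * (1 - (cmod y)\<^sup>2) \<le> K * (2 * (1 - cmod y))"
          proof (rule mult_left_mono)
            have "1 - (cmod y)\<^sup>2 = (1 + cmod y) * (1 - cmod y)" by (simp add: power2_eq_square algebra_simps)
            also have "\<dots> \<le> 2 * (1 - cmod y)" using y by (intro mult_right_mono) auto
            finally show "1 - (cmod y)\<^sup>2 \<le> 2 * (1 - cmod y)" .
          qed (use K in simp)
          also have "\<dots> < (2 * K + 1) * (1 - cmod y)" using y by (simp add: algebra_simps)
          finally have "y \<in> stolz_angle \<sigma> (2 * K + 1)" using y by (simp add: stolz_angle_def)
          hence r: "cmod (N y / cayley \<sigma> y + of_real L) < \<epsilon>"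
            using \<delta>' small(1) ypos(2) by (metis norm_minus_commute)
          have cy: "cayley \<sigma> y \<noteq> 0" using Re_cayley_pos[OF \<sigma> y] by auto
          \<comment> \<open>The velocity of \<open>E\<close> is \<open>E\<close> itself times the
            error in the asymptotic equation, so it is small relative to
            \<open>1 / |\<sigma> - z|\<close>.\<close>
          have "of_real (exp (L * s)) * (N y + of_real L * cayley \<sigma> y) = (N y / cayley \<sigma> y + of_real L) * E z s"
            using cy by (simp add: E_def y_def field_simps)
          hence "cmod (of_real (exp (L * s)) * (N y + of_real L * cayley \<sigma> y)) \<le> \<epsilon> * (A / cmod (\<sigma> - z))"
            using r bound[OF z s] \<epsilon> by (simp only: norm_mult) (intro mult_mono, auto)
          thus ?thesis by (simp add: y_def)
        qed
        have "cmod (E z T - E z 0) \<le> \<epsilon> * A / cmod (\<sigma> - z) * T"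
          by (rule increment_le_of_derivative_bound[OF dE der T]) (use zz in auto)
        hence "cmod (\<sigma> - z) * cmod (E z T - cayley \<sigma> z) \<le> \<epsilon> * A * T"
          using zz(3) E0[OF zz(1)] by (simp add: field_simps)
        moreover have "(\<sigma> - z) * E z T - (\<sigma> + z) = (\<sigma> - z) * (E z T - cayley \<sigma> z)"
          using zz(2) by (simp add: cayley_def right_diff_distrib)
        moreover have "\<epsilon> * A * T < e"
        proof -
          have lt: "T / (2 * (T + 1) * X) < 1"
          proof -
            have "T < 2 * (T + 1) * 1" using T by simp
            also have "\<dots> \<le> 2 * (T + 1) * X" using T X by (intro mult_left_mono) auto
            finally show ?thesis using T X by simp
          qed
          have "\<epsilon> * A * T = e * (T / (2 * (T + 1) * X))" using A T X by (simp add: \<epsilon>_def)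
          also have "\<dots> < e * 1" using mult_strict_left_mono[OF lt e] .
          finally show ?thesis by simp
        qed
        ultimately show ?case by (simp add: norm_mult)
      qed
    qed
    have "((\<lambda>z. ((\<sigma> - z) * E z T - (\<sigma> + z)) + (\<sigma> + z)) \<longlongrightarrow> 0 + (\<sigma> + \<sigma>)) F"
      by (intro tendsto_add key tendsto_const) (simp add: F_def)
    moreover have "0 + (\<sigma> + \<sigma>) = 2 * \<sigma>" by (simp only: mult_2 add_0)
    ultimately have lim2: "((\<lambda>z. (\<sigma> - z) * E z T) \<longlongrightarrow> 2 * \<sigma>) F" by simp
    have lim3: "((\<lambda>z. of_real X * (\<sigma> + \<phi> T z) / ((\<sigma> - z) * E z T)) \<longlongrightarrow> of_real X * (\<sigma> + \<sigma>) / (2 * \<sigma>)) F"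
    proof (rule tendsto_divide[OF _ lim2])
      show "((\<lambda>z. of_real X * (\<sigma> + \<phi> T z)) \<longlongrightarrow> of_real X * (\<sigma> + \<sigma>)) F"
        by (intro tendsto_mult tendsto_add tendsto_const \<phi>lim)
    qed (use \<sigma> in auto)
    have eq3: "of_real X * (\<sigma> + \<sigma>) / (2 * \<sigma>) = of_real X"
      using \<sigma> unfolding mult_2[symmetric] by auto
    \<comment> \<open>Solving the definition of \<open>E\<close> for
      \<open>\<sigma> - \<phi> T z\<close> expresses the difference quotient through
      \<open>(\<sigma> - z) * E z T\<close>, whose limit is \<open>2 * \<sigma>\<close>.\<close>
    have ev3: "eventually (\<lambda>z. of_real X * (\<sigma> + \<phi> T z) / ((\<sigma> - z) * E z T) = (\<phi> T z - \<sigma>) / (z - \<sigma>)) F"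
      using evS
    proof eventually_elim
      case (elim z)
      note zz = Mstolz[OF elim]
      define y where "y = \<phi> T z"
      have y: "cmod y < 1" unfolding y_def using semigroup_disk_norm[OF sg T zz(1)] .
      have "\<sigma> - y \<noteq> 0" "\<sigma> + y \<noteq> 0"
        using unit_circle_neq[OF \<sigma> y] unit_circle_neq[OF \<sigma>, of "- y"] y by (auto simp: add_eq_0_iff)
      moreover have "(y - \<sigma>) / (z - \<sigma>) = (\<sigma> - y) / (\<sigma> - z)"
        by (metis minus_diff_eq minus_divide_divide)
      moreover have "E z T = of_real X * ((\<sigma> + y) / (\<sigma> - y))" by (simp add: E_def cayley_def y_def X_def)
      ultimately show ?case using X zz(2) unfolding y_def[symmetric] by simp
    qed
    have "((\<lambda>z. (\<phi> T z - \<sigma>) / (z - \<sigma>)) \<longlongrightarrow> of_real X) F"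
      using Lim_transform_eventually[OF lim3 ev3] unfolding eq3 .
    thus ?thesis using \<phi>lim by (simp add: F_def X_def)
  qed
  show ?thesis
    unfolding BRFP_spectral_def L_def[symmetric] has_angular_limit_def using \<sigma> main by simp
qed

section \<open>Flows on the right half-plane\<close>

text \<open>\<open>Schwarz_Pick_Re_pos\<close> for \<open>g\<close> in the disk coordinate
  \<open>m\<close>. The identity \<open>|x + cnj y|^2 = |x - y|^2 + 4 * (Re x * Re y)\<close>
  replaces sums by differences, the form needed for difference quotients.\<close>

lemma half_plane_Schwarz_Pick:
  assumes holg: "g holomorphic_on {w. Re w > 0}" and pos: "\<And>w. Re w > 0 \<Longrightarrow> Re (g w) > 0"
    and a: "Re a > 0" and b: "Re b > 0"
  shows "(cmod (g a - g b))\<^sup>2 * (Re a * Re b) \<le> (cmod (a - b))\<^sup>2 * (Re (g a) * Re (g b))"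
proof -
  define m where "m = (\<lambda>w::complex. (w - 1) / (w + 1))"
  define p where "p = g \<circ> cayley 1"
  have nz: "w + 1 \<noteq> 0" if "Re w > 0" for w
    using that by (metis add_eq_0_iff2 less_minus_iff neg_0_less_iff_less not_less_iff_gr_or_eq
        one_complex.sel(1) uminus_complex.sel(1) zero_less_one order.strict_trans)
  have id1: "1 - (cmod (m w))\<^sup>2 = 4 * Re w / (cmod (w + 1))\<^sup>2" if "Re w > 0" for w
  proof -
    have "(cmod (w + 1))\<^sup>2 - (cmod (w - 1))\<^sup>2 = 4 * Re w"
      unfolding cmod_power2 by (simp add: power2_eq_square algebra_simps)
    moreover have "(cmod (m w))\<^sup>2 = (cmod (w - 1))\<^sup>2 / (cmod (w + 1))\<^sup>2"
      by (simp add: m_def norm_divide power_divide)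
    moreover have "1 - (cmod (m w))\<^sup>2 = ((cmod (w + 1))\<^sup>2 - (cmod (w - 1))\<^sup>2) / (cmod (w + 1))\<^sup>2"
      using nz[OF that] by (simp add: calculation(2) diff_divide_distrib)
    ultimately show ?thesis by simp
  qed
  have m1: "cmod (m w) < 1" if "Re w > 0" for w
  proof -
    have "1 - (cmod (m w))\<^sup>2 > 0"
      unfolding id1[OF that] using nz[OF that] that by (simp add: divide_pos_pos)
    thus ?thesis by (simp add: abs_square_less_1)
  qed
  have cm: "cayley 1 (m w) = w" if "Re w > 0" for w
  proof -
    have "1 + m w = 2 * w / (w + 1)" "1 - m w = 2 / (w + 1)"
      using nz[OF that] by (simp_all add: m_def add_divide_eq_iff diff_divide_eq_iff)
    thus ?thesis using nz[OF that] by (simp add: cayley_def)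
  qed
  have holp: "p holomorphic_on ball 0 1"
    unfolding p_def by (rule holomorphic_on_compose_gen[OF cayley_holomorphic holg]) (auto intro: Re_cayley_pos)
  have posp: "Re (p z) > 0" if "cmod z < 1" for z
    unfolding p_def o_def by (intro pos Re_cayley_pos that) simp
  have pm: "p (m w) = g w" if "Re w > 0" for w using cm[OF that] by (simp add: p_def)
  define A B where "A = (cmod (a + 1))\<^sup>2" and "B = (cmod (b + 1))\<^sup>2"
  have AB: "A * B > 0" using nz a b by (simp add: A_def B_def)
  have nz': "cnj b + 1 \<noteq> 0" using nz[OF b] by (metis complex_cnj_add complex_cnj_one complex_cnj_zero_iff)
  have "cnj (m b) * m a = (cnj b - 1) * (a - 1) / ((a + 1) * (cnj b + 1))"
    by (simp add: m_def mult.commute)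
  hence "1 - cnj (m b) * m a = ((a + 1) * (cnj b + 1) - (cnj b - 1) * (a - 1)) / ((a + 1) * (cnj b + 1))"
    using nz[OF a] nz' by (simp only: diff_divide_distrib) simp
  also have "(a + 1) * (cnj b + 1) - (cnj b - 1) * (a - 1) = 2 * (a + cnj b)" by (simp add: algebra_simps)
  finally have "cmod (1 - cnj (m b) * m a) = 2 * cmod (a + cnj b) / (cmod (a + 1) * cmod (cnj b + 1))"
    by (simp only: norm_mult norm_divide norm_numeral)
  moreover have "cmod (cnj b + 1) = cmod (b + 1)"
    by (metis complex_cnj_add complex_cnj_one complex_mod_cnj)
  ultimately have id2: "(cmod (1 - cnj (m b) * m a))\<^sup>2 = 4 * (cmod (a + cnj b))\<^sup>2 / (A * B)"
    by (simp add: A_def B_def power_mult_distrib power_divide)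
  have "(cmod (g a + cnj (g b)))\<^sup>2 * (1 - (cmod (m a))\<^sup>2) * (1 - (cmod (m b))\<^sup>2)
       \<le> 4 * Re (g a) * Re (g b) * (cmod (1 - cnj (m b) * m a))\<^sup>2"
    using Schwarz_Pick_Re_pos[OF holp posp m1[OF a] m1[OF b]] by (simp add: pm a b)
  hence "16 * ((cmod (g a + cnj (g b)))\<^sup>2 * (Re a * Re b)) / (A * B)
      \<le> 16 * ((cmod (a + cnj b))\<^sup>2 * (Re (g a) * Re (g b))) / (A * B)"
    unfolding id1[OF a] id1[OF b] id2 A_def[symmetric] B_def[symmetric] by (simp add: mult_ac)
  hence *: "(cmod (g a + cnj (g b)))\<^sup>2 * (Re a * Re b) \<le> (cmod (a + cnj b))\<^sup>2 * (Re (g a) * Re (g b))"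
    using AB by (simp only: divide_le_cancel) simp
  have "(cmod (x + cnj y))\<^sup>2 = (cmod (x - y))\<^sup>2 + 4 * (Re x * Re y)" for x y
    unfolding cmod_power2 by (simp add: power2_eq_square algebra_simps)
  hence "((cmod (g a - g b))\<^sup>2 + 4 * (Re (g a) * Re (g b))) * (Re a * Re b)
      \<le> ((cmod (a - b))\<^sup>2 + 4 * (Re a * Re b)) * (Re (g a) * Re (g b))"
    using * by simp
  thus ?thesis by (simp add: algebra_simps)
qed

text \<open>The infinitesimal form of \<open>half_plane_Schwarz_Pick\<close>: divide by
  \<open>|a - b|^2\<close> and let \<open>a\<close> tend to \<open>b\<close>.\<close>

lemma half_plane_derivative_bound:
  assumes holg: "g holomorphic_on {w. Re w > 0}" and pos: "\<And>w. Re w > 0 \<Longrightarrow> Re (g w) > 0"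
    and b: "Re b > 0"
  shows "cmod (deriv g b) * Re b \<le> Re (g b)"
proof -
  have op: "open {w::complex. Re w > 0}" by (rule open_halfspace_Re_gt)
  have d: "(g has_field_derivative deriv g b) (at b)"
    using holomorphic_derivI[OF holg op] b by simp
  have lim: "((\<lambda>a. (g a - g b) / (a - b)) \<longlongrightarrow> deriv g b) (at b)"
    using d by (simp add: has_field_derivative_iff)
  have "isCont g b" using d by (rule DERIV_isCont)
  hence limg: "(g \<longlongrightarrow> g b) (at b)" by (simp add: isCont_def)
  have ev: "eventually (\<lambda>a. (cmod ((g a - g b) / (a - b)))\<^sup>2 * (Re a * Re b) \<le> Re (g a) * Re (g b)) (at b)"
  proof (rule eventually_mono[OF eventually_at_in_open[OF op]])
    fix a assume "a \<in> {w. Re w > 0} - {b}"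
    hence a: "a \<in> {w. Re w > 0}" "a \<noteq> b" by auto
    have "(cmod (a - b))\<^sup>2 > 0" using a by simp
    thus "(cmod ((g a - g b) / (a - b)))\<^sup>2 * (Re a * Re b) \<le> Re (g a) * Re (g b)"
      using half_plane_Schwarz_Pick[OF holg pos _ b, of a] a
      by (simp add: norm_divide power_divide pos_divide_le_eq mult.commute)
  qed (use b in simp)
  have "(cmod (deriv g b))\<^sup>2 * (Re b * Re b) \<le> Re (g b) * Re (g b)"
    by (rule tendsto_le[OF _ _ _ ev]) (intro tendsto_intros limg lim | simp)+
  hence "(cmod (deriv g b) * Re b)\<^sup>2 \<le> (Re (g b))\<^sup>2" by (simp add: power2_eq_square mult_ac)
  thus ?thesis by (rule power2_le_imp_le) (use pos[OF b] in simp)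
qed

text \<open>The Noshiro-Warschawski criterion: on the segment from \<open>a\<close> to
  \<open>b\<close> the function \<open>Re (cnj (b - a) * h)\<close> has derivative
  \<open>|b - a|^2 * Re h' > 0\<close>, so \<open>h a\<close> and \<open>h b\<close> differ.\<close>

lemma inj_on_of_Re_derivative_pos:
  assumes conv: "convex S" and d: "\<And>z. z \<in> S \<Longrightarrow> (h has_field_derivative h' z) (at z)"
    and pos: "\<And>z. z \<in> S \<Longrightarrow> Re (h' z) > 0"
  shows "inj_on h S"
proof (rule inj_onI, rule ccontr)
  fix a b assume a: "a \<in> S" and b: "b \<in> S" and eq: "h a = h b" and ne: "a \<noteq> b"
  define l where "l = (\<lambda>s::real. a + of_real s * (b - a))"
  define f where "f = (\<lambda>s. Re (cnj (b - a) * h (l s)))"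
  have lS: "l s \<in> S" if "0 \<le> s" "s \<le> 1" for s
  proof -
    have "l s = (1 - s) *\<^sub>R a + s *\<^sub>R b" by (simp add: l_def scaleR_conv_of_real algebra_simps)
    thus ?thesis using convexD[OF conv a b, of "1 - s" s] that by simp
  qed
  have "f 0 < f 1"
  proof (rule DERIV_pos_imp_increasing[where f = f])
    fix s :: real assume s: "0 \<le> s" "s \<le> 1"
    have "(l has_vector_derivative (b - a)) (at s)"
      unfolding l_def by (auto intro!: derivative_eq_intros)
    from field_vector_diff_chain_at[OF this d[OF lS[OF s]]]
    have "((\<lambda>s. h (l s)) has_vector_derivative (b - a) * h' (l s)) (at s)" by (simp add: o_def)
    from has_real_derivative_Re[OF has_vector_derivative_mult_right[OF this, of "cnj (b - a)"]]
    have "(f has_real_derivative Re (cnj (b - a) * ((b - a) * h' (l s)))) (at s)" by (simp add: f_def)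
    moreover have "cnj (b - a) * ((b - a) * h' (l s)) = of_real ((cmod (b - a))\<^sup>2) * h' (l s)"
      unfolding complex_norm_square by (simp only: mult_ac)
    moreover have "Re (of_real ((cmod (b - a))\<^sup>2) * h' (l s)) > 0"
      using pos[OF lS[OF s]] ne by simp
    ultimately show "\<exists>y. (f has_real_derivative y) (at s) \<and> 0 < y" by metis
  qed simp
  thus False using eq by (simp add: f_def l_def)
qed

text \<open>The last two clauses prepare the return to the disk. Commuting with the imaginary
  periods of \<open>g\<close> lets the flow descend through the exponential when \<tau> is interior;
  divergence to infinity becomes convergence to \<tau> when \<tau> lies on the circle.\<close>

definition half_plane_flow :: "(complex \<Rightarrow> complex) \<Rightarrow> (real \<Rightarrow> complex \<Rightarrow> complex) \<Rightarrow> bool" where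
  "half_plane_flow g V \<longleftrightarrow>
    (\<forall>t\<ge>0. V t holomorphic_on {w. Re w > 0}) \<and>
    (\<forall>t\<ge>0. \<forall>w. Re w > 0 \<longrightarrow> Re w \<le> Re (V t w)) \<and>
    (\<forall>w. Re w > 0 \<longrightarrow> V 0 w = w) \<and>
    (\<forall>s\<ge>0. \<forall>t\<ge>0. \<forall>w. Re w > 0 \<longrightarrow> V s (V t w) = V (s + t) w) \<and>
    (\<forall>t\<ge>0. \<forall>w. Re w > 0 \<longrightarrow> ((\<lambda>s. V s w) has_vector_derivative g (V t w)) (at t)) \<and>
    (\<forall>t\<ge>0. \<forall>w c. Re w > 0 \<longrightarrow> Re c = 0 \<longrightarrow> (\<forall>v. Re v > 0 \<longrightarrow> g (v + c) = g v) \<longrightarrow>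
       V t (w + c) = V t w + c) \<and>
    (\<forall>w. Re w > 0 \<longrightarrow> filterlim (\<lambda>t. V t w) at_infinity at_top)"

lemma half_plane_flow_holomorphic:
  "half_plane_flow g V \<Longrightarrow> t \<ge> 0 \<Longrightarrow> V t holomorphic_on {w. Re w > 0}"
  by (simp add: half_plane_flow_def)

lemma half_plane_flow_Re_le:
  "half_plane_flow g V \<Longrightarrow> t \<ge> 0 \<Longrightarrow> Re w > 0 \<Longrightarrow> Re w \<le> Re (V t w)"
  by (simp add: half_plane_flow_def)

lemma half_plane_flow_0:
  "half_plane_flow g V \<Longrightarrow> Re w > 0 \<Longrightarrow> V 0 w = w"
  by (simp add: half_plane_flow_def)

lemma half_plane_flow_add:
  "half_plane_flow g V \<Longrightarrow> s \<ge> 0 \<Longrightarrow> t \<ge> 0 \<Longrightarrow> Re w > 0 \<Longrightarrow> V s (V t w) = V (s + t) w"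
  by (simp add: half_plane_flow_def)

lemma half_plane_flow_derivative:
  "half_plane_flow g V \<Longrightarrow> t \<ge> 0 \<Longrightarrow> Re w > 0 \<Longrightarrow> ((\<lambda>s. V s w) has_vector_derivative g (V t w)) (at t)"
  by (simp add: half_plane_flow_def)

lemma half_plane_flow_translate:
  "half_plane_flow g V \<Longrightarrow> t \<ge> 0 \<Longrightarrow> Re w > 0 \<Longrightarrow> Re c = 0 \<Longrightarrow> (\<And>v. Re v > 0 \<Longrightarrow> g (v + c) = g v) \<Longrightarrow> V t (w + c) = V t w + c"
  by (simp add: half_plane_flow_def)

lemma half_plane_flow_at_infinity:
  "half_plane_flow g V \<Longrightarrow> Re w > 0 \<Longrightarrow> filterlim (\<lambda>t. V t w) at_infinity at_top"
  by (simp add: half_plane_flow_def)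

text \<open>The crux is \<open>stay\<close>: a first exit time \<open>T\<close> from the image of
  \<open>h\<close> would be finite, yet up to \<open>T\<close> the orbit remains in a compact subset
  of the half-plane, whose image under \<open>h\<close> is closed and contains the end point.
  Openness of the image of \<open>h\<close> gives two-sided time derivatives even at time 0.\<close>

lemma half_plane_flow_exists:
  assumes holg: "g holomorphic_on {w. Re w > 0}" and pos: "\<And>w. Re w > 0 \<Longrightarrow> Re (g w) > 0"
  shows "\<exists>V. half_plane_flow g V"
proof -
  define H where "H = {w::complex. Re w > 0}"
  have opH: "open H" unfolding H_def by (rule open_halfspace_Re_gt)
  have convH: "convex H" unfolding H_def by (rule convex_halfspace_Re_gt)
  have gnz: "g w \<noteq> 0" if "w \<in> H" for w using pos[of w] that by (auto simp: H_def)
  have "(\<lambda>w. inverse (g w)) holomorphic_on H"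
    using holg gnz by (intro holomorphic_intros) (auto simp: H_def)
  then obtain h where "\<And>w. w \<in> H \<Longrightarrow> (h has_field_derivative inverse (g w)) (at w within H)"
    using holomorphic_convex_primitive'[OF convH opH] by metis
  hence dh: "(h has_field_derivative inverse (g w)) (at w)" if "w \<in> H" for w
    using that at_within_open[OF that opH] by metis
  have inj: "inj_on h H"
  proof (rule inj_on_of_Re_derivative_pos[OF convH dh])
    show "Re (inverse (g w)) > 0" if "w \<in> H" for w
      using pos[of w] that Re_complex_div_gt_0[of 1 "g w"] by (simp add: H_def inverse_eq_divide)
  qed
  have holh: "h holomorphic_on H" using dh opH by (auto simp: holomorphic_on_open)
  have conth: "continuous_on H h" using holh by (rule holomorphic_on_imp_continuous_on)
  obtain k where holk: "k holomorphic_on h ` H" and dk: "\<And>z. z \<in> H \<Longrightarrow> deriv h z * deriv k (h z) = 1"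
    and kh: "\<And>z. z \<in> H \<Longrightarrow> k (h z) = z"
    by (rule holomorphic_has_inverse[OF holh opH inj]) blast
  have op: "open (h ` H)" by (rule open_mapping_thm3[OF holh opH inj])
  have kH: "k u \<in> H" "h (k u) = u" if "u \<in> h ` H" for u using that kh by auto
  have dV: "((\<lambda>s. k (h w + of_real s)) has_vector_derivative g (k (h w + of_real t))) (at t)"
    if "h w + of_real t \<in> h ` H" for w t
  proof -
    define u where "u = h w + of_real t"
    have u: "u \<in> h ` H" using that by (simp add: u_def)
    have "(k has_field_derivative deriv k u) (at u)" by (rule holomorphic_derivI[OF holk op u])
    moreover have "deriv k u = g (k u)"
      using dk[OF kH(1)[OF u]] DERIV_imp_deriv[OF dh[OF kH(1)[OF u]]] gnz[OF kH(1)[OF u]]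
      by (simp add: kH(2)[OF u] field_simps)
    moreover have "((\<lambda>s. h w + of_real s) has_vector_derivative 1) (at t)"
      by (auto intro!: derivative_eq_intros)
    ultimately have "((k \<circ> (\<lambda>s. h w + of_real s)) has_vector_derivative 1 * g (k u)) (at t)"
      by (intro field_vector_diff_chain_at) (auto simp: u_def)
    thus ?thesis by (simp add: o_def u_def)
  qed
  \<comment> \<open>Real parts never decrease along orbits, so bounding the modulus suffices to
    confine an orbit to a compact set away from the imaginary axis.\<close>
  define K where "K = (\<lambda>w B. {v. Re w \<le> Re v} \<inter> cball 0 B)"
  have cK: "compact (h ` K w B)" and KH: "K w B \<subseteq> H" if "w \<in> H" for w B
  proof -
    show sub: "K w B \<subseteq> H" using that by (auto simp: K_def H_def)
    have "compact (K w B)" unfolding K_def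
      by (intro closed_Int_compact closed_halfspace_Re_ge compact_cball)
    thus "compact (h ` K w B)" using continuous_on_subset[OF conth sub] by (rule compact_continuous_image[rotated])
  qed
  have Re_mono: "Re w \<le> Re (k (h w + of_real t))"
    if w: "w \<in> H" and t: "t \<ge> 0" and all: "\<And>s. 0 \<le> s \<Longrightarrow> s \<le> t \<Longrightarrow> h w + of_real s \<in> h ` H" for w t
  proof -
    have "Re (k (h w + of_real 0)) \<le> Re (k (h w + of_real t))"
    proof (rule DERIV_nonneg_imp_nondecreasing[OF t])
      fix s assume s: "0 \<le> s" "s \<le> t"
      have "Re (g (k (h w + of_real s))) \<ge> 0"
        using pos[of "k (h w + of_real s)"] kH(1)[OF all[OF s]] by (simp add: H_def)
      thus "\<exists>y. ((\<lambda>s. Re (k (h w + of_real s))) has_real_derivative y) (at s) \<and> 0 \<le> y"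
        using has_real_derivative_Re[OF dV[OF all[OF s]]] by blast
    qed
    thus ?thesis using kh[OF w] by simp
  qed
  \<comment> \<open>The speed \<open>|g(V)| / Re V\<close> is non-increasing along orbits, so they cannot escape in finite time.\<close>
  have bounded_orbit: "\<exists>B. \<forall>t. 0 \<le> t \<and> t < T \<longrightarrow> k (h w + of_real t) \<in> K w B"
    if w: "w \<in> H" and all: "\<And>s. 0 \<le> s \<Longrightarrow> s < T \<Longrightarrow> h w + of_real s \<in> h ` H" for w T
  proof -
    define V where "V = (\<lambda>s. k (h w + of_real s))"
    define x where "x = (\<lambda>s. Re (V s))"
    define G where "G = (\<lambda>s. g (V s))"
    have V0: "V 0 = w" using kh[OF w] by (simp add: V_def)
    have VH: "V s \<in> H" if "0 \<le> s" "s < T" for s using kH(1)[OF all[OF that]] by (simp add: V_def)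
    have xpos: "x s > 0" if "0 \<le> s" "s < T" for s using VH[OF that] by (simp add: H_def x_def)
    have dV': "(V has_vector_derivative G s) (at s)" if "0 \<le> s" "s < T" for s
      using dV[OF all[OF that]] by (simp add: V_def G_def)
    have dx: "(x has_real_derivative Re (G s)) (at s)" if "0 \<le> s" "s < T" for s
      unfolding x_def by (rule has_real_derivative_Re[OF dV'[OF that]])
    define \<kappa> where "\<kappa> = cmod (g w) / Re w"
    have wpos: "Re w > 0" using w by (simp add: H_def)
    have \<kappa>0: "\<kappa> \<ge> 0" using wpos by (simp add: \<kappa>_def)
    have speed: "cmod (G t) \<le> \<kappa> * x t" if t: "0 \<le> t" "t < T" for t
    proof -
      define R where "R = (\<lambda>s. (cmod (G s))\<^sup>2 / (x s)\<^sup>2)"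
      have "R t \<le> R 0"
      proof (rule DERIV_nonpos_imp_nonincreasing[OF t(1)])
        fix s assume s': "0 \<le> s" "s \<le> t"
        hence s: "0 \<le> s" "s < T" using t by auto
        note VHs = VH[OF s]
        have "(g has_field_derivative deriv g (V s)) (at (V s))"
          using holomorphic_derivI[OF holg[folded H_def] opH VHs] .
        from field_vector_diff_chain_at[OF dV'[OF s] this]
        have "(G has_vector_derivative G s * deriv g (V s)) (at s)" by (simp add: o_def G_def)
        from has_real_derivative_norm_square[OF this]
        have d1: "((\<lambda>s. (cmod (G s))\<^sup>2) has_real_derivative 2 * (cmod (G s))\<^sup>2 * Re (deriv g (V s))) (at s)"
        proof -
          have "cnj (G s) * (G s * deriv g (V s)) = of_real ((cmod (G s))\<^sup>2) * deriv g (V s)"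
            unfolding complex_norm_square by (simp only: mult_ac)
          moreover have "Re (of_real r * v) = r * Re v" for r v by simp
          ultimately have "2 * Re (cnj (G s) * (G s * deriv g (V s))) = 2 * (cmod (G s))\<^sup>2 * Re (deriv g (V s))"
            by (simp only: mult.assoc)
          thus ?thesis using \<open>((\<lambda>s. (cmod (G s))\<^sup>2) has_real_derivative _) _\<close> by simp
        qed
        have d2: "((\<lambda>s. (x s)\<^sup>2) has_real_derivative 2 * x s * Re (G s)) (at s)"
          using DERIV_power[OF dx[OF s], of 2] by (simp add: mult_ac)
        \<comment> \<open>The sign of the derivative of \<open>R\<close> is that of
          \<open>Re (g'(V)) * x - Re (g V)\<close>, which the Schwarz-Pick bound on
          \<open>g'\<close> makes non-positive.\<close>
        have "Re (deriv g (V s)) * x s \<le> cmod (deriv g (V s)) * x s"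
          using xpos[OF s] complex_Re_le_cmod by (intro mult_right_mono) auto
        also have "\<dots> \<le> Re (G s)"
          using half_plane_derivative_bound[OF holg pos, of "V s"] VHs by (simp add: x_def G_def H_def)
        finally have le: "Re (deriv g (V s)) * x s \<le> Re (G s)" .
        have "2 * (cmod (G s))\<^sup>2 * Re (deriv g (V s)) * (x s)\<^sup>2 - (cmod (G s))\<^sup>2 * (2 * x s * Re (G s))
          = (2 * (cmod (G s))\<^sup>2 * x s) * (Re (deriv g (V s)) * x s - Re (G s))"
          by (simp add: power2_eq_square algebra_simps)
        also have "\<dots> \<le> 0" using le xpos[OF s] by (intro mult_nonneg_nonpos) auto
        finally have "(2 * (cmod (G s))\<^sup>2 * Re (deriv g (V s)) * (x s)\<^sup>2 - (cmod (G s))\<^sup>2 * (2 * x s * Re (G s))) / ((x s)\<^sup>2 * (x s)\<^sup>2) \<le> 0"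
          by (intro divide_nonpos_nonneg) auto
        moreover have "(R has_real_derivative (2 * (cmod (G s))\<^sup>2 * Re (deriv g (V s)) * (x s)\<^sup>2 - (cmod (G s))\<^sup>2 * (2 * x s * Re (G s))) / ((x s)\<^sup>2 * (x s)\<^sup>2)) (at s)"
          unfolding R_def by (rule DERIV_divide[OF d1 d2]) (use xpos[OF s] in simp)
        ultimately show "\<exists>y. (R has_real_derivative y) (at s) \<and> y \<le> 0" by blast
      qed
      also have "R 0 = \<kappa>\<^sup>2" by (simp add: R_def G_def x_def V0 \<kappa>_def power_divide)
      finally have "(cmod (G t))\<^sup>2 \<le> (\<kappa> * x t)\<^sup>2"
        using xpos[OF t] by (simp add: R_def pos_divide_le_eq power_mult_distrib)
      thus ?thesis by (rule power2_le_imp_le) (use \<kappa>0 xpos[OF t] in simp)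
    qed
    \<comment> \<open>The Gronwall bound for \<open>x' \<le> \<kappa> * x\<close> on the interval up
      to \<open>T\<close>.\<close>
    define Y where "Y = Re w * exp (\<kappa> * T)"
    have xY: "x t \<le> Y" if t: "0 \<le> t" "t < T" for t
    proof -
      have "exp (- \<kappa> * t) * x t \<le> exp (- \<kappa> * 0) * x 0"
      proof (rule DERIV_nonpos_imp_nonincreasing[OF t(1)])
        fix s assume s': "0 \<le> s" "s \<le> t"
        hence s: "0 \<le> s" "s < T" using t by auto
        have d: "((\<lambda>s. exp (- \<kappa> * s) * x s) has_real_derivative (- \<kappa> * exp (- \<kappa> * s)) * x s + Re (G s) * exp (- \<kappa> * s)) (at s)"
          by (rule DERIV_mult[OF exp_scaled_derivative dx[OF s]])
        have "exp (- \<kappa> * s) * (Re (G s) - \<kappa> * x s) \<le> 0"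
          using speed[OF s] complex_Re_le_cmod[of "G s"] by (intro mult_nonneg_nonpos) auto
        hence "(- \<kappa> * exp (- \<kappa> * s)) * x s + Re (G s) * exp (- \<kappa> * s) \<le> 0"
          by (simp add: algebra_simps)
        with d show "\<exists>y. ((\<lambda>s. exp (- \<kappa> * s) * x s) has_real_derivative y) (at s) \<and> y \<le> 0" by blast
      qed
      hence "x t \<le> Re w * exp (\<kappa> * t)" by (simp add: x_def V0 exp_minus field_simps)
      also have "\<dots> \<le> Y" unfolding Y_def using wpos t \<kappa>0 by (simp add: mult_left_mono)
      finally show ?thesis .
    qed
    have "V t \<in> K w (cmod w + \<kappa> * Y * T)" if t: "0 \<le> t" "t < T" for t
    proof -
      have "cmod (V t - V 0) \<le> \<kappa> * Y * t"
      proof (rule increment_le_of_derivative_bound)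
        fix s assume "s \<in> {0..t}"
        hence s: "0 \<le> s" "s < T" using t by auto
        show "(V has_vector_derivative G s) (at s within {0..})"
          using dV'[OF s] by (rule has_vector_derivative_at_within)
        show "cmod (G s) \<le> \<kappa> * Y" using speed[OF s] mult_left_mono[OF xY[OF s] \<kappa>0] by linarith
      qed (use t in simp)
      also have "\<dots> \<le> \<kappa> * Y * T" using t \<kappa>0 wpos by (intro mult_left_mono) (auto simp: Y_def)
      finally have "cmod (V t) \<le> cmod w + \<kappa> * Y * T"
        using norm_triangle_ineq2[of "V t" w] by (simp add: V0)
      moreover have "Re w \<le> Re (V t)"
        unfolding V_def by (rule Re_mono[OF w t(1)]) (use all t in auto)
      ultimately show ?thesis by (simp add: K_def)
    qed
    thus ?thesis by (auto simp: V_def)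
  qed
  have stay: "h w + of_real t \<in> h ` H" if w: "w \<in> H" and t: "t \<ge> 0" for w t
  proof (rule ccontr)
    assume nin: "h w + of_real t \<notin> h ` H"
    \<comment> \<open>The set of exit times is closed because the image of \<open>h\<close> is open,
      so a first exit time is attained.\<close>
    define S where "S = {s. 0 \<le> s \<and> h w + of_real s \<notin> h ` H}"
    have "S = {0..} \<inter> (\<lambda>s. h w + of_real s) -` (- (h ` H))" by (auto simp: S_def)
    moreover have "closed ((\<lambda>s::real. h w + of_real s) -` (- (h ` H)))"
      using op by (intro continuous_closed_vimage) (auto intro!: continuous_intros)
    ultimately have clS: "closed S" by (auto intro: closed_Int)
    define T where "T = Inf S"
    have bdd: "bdd_below S" by (intro bdd_belowI[of _ 0]) (simp add: S_def)
    have "T \<in> S" unfolding T_def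
      by (rule closed_contains_Inf[OF _ bdd clS]) (use nin t in \<open>auto simp: S_def\<close>)
    hence T0: "T \<ge> 0" and Tnin: "h w + of_real T \<notin> h ` H" by (auto simp: S_def)
    have Tpos: "T > 0" using T0 Tnin w by (cases "T = 0") auto
    have all: "h w + of_real s \<in> h ` H" if "0 \<le> s" "s < T" for s
    proof (rule ccontr)
      assume "h w + of_real s \<notin> h ` H"
      hence "s \<in> S" using that by (simp add: S_def)
      from cInf_lower[OF this bdd] show False using that by (simp add: T_def)
    qed
    obtain B where B: "\<And>s. 0 \<le> s \<Longrightarrow> s < T \<Longrightarrow> k (h w + of_real s) \<in> K w B"
      using bounded_orbit[where T = T, OF w all] by blast
    have "h w + of_real T \<in> h ` K w B"
    proof (rule Lim_in_closed_set[OF compact_imp_closed[OF cK[OF w]]])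
      show "eventually (\<lambda>s. h w + of_real s \<in> h ` K w B) (at_left T)"
      proof (rule eventually_at_leftI[OF _ Tpos])
        fix s assume "s \<in> {0<..<T}"
        hence s: "0 \<le> s" "s < T" by auto
        show "h w + of_real s \<in> h ` K w B"
          using B[OF s] kH(2)[OF all[OF s]] by (metis imageI)
      qed
      show "((\<lambda>s. h w + of_real s) \<longlongrightarrow> h w + of_real T) (at_left T)" by (intro tendsto_intros)
    qed simp
    thus False using Tnin KH[OF w] by blast
  qed
  define V where "V = (\<lambda>t w. k (h w + of_real t))"
  have hV: "h (V t w) = h w + of_real t" and VH: "V t w \<in> H" if "w \<in> H" "t \<ge> 0" for t w
    using kH[OF stay[OF that]] by (auto simp: V_def)
  have Re_le: "Re w \<le> Re (V t w)" if "w \<in> H" "t \<ge> 0" for t w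
    unfolding V_def by (rule Re_mono[OF that]) (use stay that in auto)
  show ?thesis
  unfolding half_plane_flow_def
  proof (intro exI[of _ V] conjI allI impI)
    show "V t holomorphic_on {w. Re w > 0}" if t: "t \<ge> 0" for t
    proof -
      have "(k \<circ> (\<lambda>w. h w + of_real t)) holomorphic_on H"
        by (rule holomorphic_on_compose_gen[OF _ holk]) (use stay t in \<open>auto intro!: holomorphic_intros holh\<close>)
      thus ?thesis by (simp add: V_def o_def H_def)
    qed
    show "Re w \<le> Re (V t w)" if "t \<ge> 0" "Re w > 0" for t w using Re_le that by (simp add: H_def)
    show "V 0 w = w" if "Re w > 0" for w using kh that by (simp add: V_def H_def)
    show "V s (V t w) = V (s + t) w" if "s \<ge> 0" "t \<ge> 0" "Re w > 0" for s t w
    proof -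
      have "h (V t w) = h w + of_real t" using hV that by (simp add: H_def)
      thus ?thesis by (simp add: V_def add_ac)
    qed
    show "((\<lambda>s. V s w) has_vector_derivative g (V t w)) (at t)" if "t \<ge> 0" "Re w > 0" for t w
      using dV stay that by (simp add: V_def H_def)
    show "V t (w + c) = V t w + c"
      if t: "t \<ge> 0" and w: "Re w > 0" and c: "Re c = 0" and per: "\<forall>v. Re v > 0 \<longrightarrow> g (v + c) = g v" for t w c
    proof -
      \<comment> \<open>If \<open>c\<close> is a period of \<open>g\<close>, then
        \<open>h (v + c)\<close> and \<open>h v\<close> are primitives of the same function and
        differ by a constant; hence the flow commutes with translation by \<open>c\<close>.\<close>
      have "\<exists>d. \<forall>v\<in>H. h (v + c) - h v = d"
      proof (rule has_field_derivative_zero_constant[OF convH])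
        fix v assume v: "v \<in> H"
        hence vc: "v + c \<in> H" using c by (simp add: H_def)
        have "((\<lambda>v. h (v + c)) has_field_derivative inverse (g (v + c))) (at v)"
          using dh[OF vc] by (simp add: DERIV_shift)
        from DERIV_diff[OF this dh[OF v]]
        show "((\<lambda>v. h (v + c) - h v) has_field_derivative 0) (at v within H)"
          using per v by (simp add: H_def has_field_derivative_at_within)
      qed
      then obtain d where d: "\<And>v. v \<in> H \<Longrightarrow> h (v + c) = h v + d" by (metis add.commute diff_add_cancel)
      have wH: "w \<in> H" using w by (simp add: H_def)
      have "h (V t w + c) = h (w + c) + of_real t"
        using d[OF VH[OF wH t]] d[OF wH] hV[OF wH t] by simp
      hence "V t (w + c) = k (h (V t w + c))" by (simp add: V_def)
      also have "\<dots> = V t w + c" by (rule kh) (use VH[OF wH t] c in \<open>simp add: H_def\<close>)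
      finally show ?thesis .
    qed
    show "filterlim (\<lambda>t. V t w) at_infinity at_top" if w: "Re w > 0" for w
      unfolding filterlim_at_infinity[OF order.refl]
    proof (intro allI impI)
      fix r :: real assume "r > 0"
      have wH: "w \<in> H" using w by (simp add: H_def)
      \<comment> \<open>An orbit point in the compact set \<open>K w r\<close> keeps
        \<open>h w + t\<close> bounded, which fails for large \<open>t\<close>.\<close>
      obtain C where C: "\<And>u. u \<in> h ` K w r \<Longrightarrow> cmod u \<le> C"
        using compact_imp_bounded[OF cK[OF wH]] unfolding bounded_iff by blast
      have "r \<le> cmod (V t w)" if t: "t \<ge> 0" "t > C + cmod (h w)" for t
      proof (rule ccontr)
        assume "\<not> r \<le> cmod (V t w)"
        hence "V t w \<in> K w r" using Re_le[OF wH t(1)] by (simp add: K_def)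
        hence "cmod (h w + of_real t) \<le> C" using C hV[OF wH t(1)] by (metis imageI)
        moreover have "t \<le> cmod (h w + of_real t) + cmod (h w)"
          using norm_triangle_ineq4[of "h w + of_real t" "h w"] t(1) by simp
        ultimately show False using t by simp
      qed
      moreover have "eventually (\<lambda>t. t \<ge> 0 \<and> t > C + cmod (h w)) at_top"
        by (intro eventually_conj eventually_ge_at_top eventually_gt_at_top)
      ultimately show "eventually (\<lambda>t. r \<le> cmod (V t w)) at_top"
        by (auto elim: eventually_mono)
    qed
  qed
qed

section \<open>Semigroups with a given Herglotz function\<close>

lemma semigroup_diskI:
  assumes hol: "\<And>t. t \<ge> 0 \<Longrightarrow> \<phi> t holomorphic_on ball 0 1"
    and im: "\<And>t z. t \<ge> 0 \<Longrightarrow> cmod z < 1 \<Longrightarrow> cmod (\<phi> t z) < 1"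
    and zero: "\<And>z. cmod z < 1 \<Longrightarrow> \<phi> 0 z = z"
    and add: "\<And>s t z. s \<ge> 0 \<Longrightarrow> t \<ge> 0 \<Longrightarrow> cmod z < 1 \<Longrightarrow> \<phi> s (\<phi> t z) = \<phi> (s + t) z"
    and der: "\<And>t z. t \<ge> 0 \<Longrightarrow> cmod z < 1 \<Longrightarrow>
      ((\<lambda>s. \<phi> s z) has_vector_derivative G (\<phi> t z)) (at t within {0..})"
  shows "semigroup_disk \<phi>"
proof -
  have "((\<lambda>t. \<phi> t z) \<longlongrightarrow> z) (at_right 0)" if z: "cmod z < 1" for z
  proof -
    have "continuous (at 0 within {0..}) (\<lambda>t. \<phi> t z)"
      using has_vector_derivative_continuous[OF der[OF order.refl z]] .
    thus ?thesis by (simp add: continuous_within zero[OF z] at_within_Ici_at_right)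
  qed
  thus ?thesis unfolding semigroup_disk_def using hol im zero add by (auto simp: image_subset_iff)
qed

text \<open>\<open>m\<close> inverts \<open>cayley \<tau>\<close>. In this coordinate the double
  zero of the numerator at \<tau> cancels the double pole of the derivative of
  \<open>cayley \<tau>\<close>, and the field becomes \<open>g = 2 / Q\<close>. As \<tau>
  corresponds to infinity, the iterates converge to \<tau> because the half-plane flow tends to
  infinity.\<close>

lemma semigroup_exists_boundary:
  assumes holQ: "Q holomorphic_on ball 0 1" and ReQ: "\<And>z. cmod z < 1 \<Longrightarrow> Re (Q z) > 0"
    and \<tau>: "cmod \<tau> = 1" and holG: "G holomorphic_on ball 0 1"
    and G: "\<And>z. cmod z < 1 \<Longrightarrow> G z = (\<tau> - z) * (1 - cnj \<tau> * z) / Q z"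
  shows "\<exists>\<phi>. semigroup_disk \<phi> \<and> generator_of \<phi> G \<and> semigroup_DW \<phi> \<tau>"
proof -
  define m where "m = (\<lambda>w. \<tau> * (w - 1) / (w + 1))"
  define H where "H = {w::complex. Re w > 0}"
  have \<tau>0: "\<tau> \<noteq> 0" using \<tau> by auto
  have nz: "w + 1 \<noteq> 0" if "Re w > 0" for w
  proof
    assume "w + 1 = 0"
    hence "w = -1" by (simp add: eq_neg_iff_add_eq_0)
    thus False using that by simp
  qed
  have tm: "\<tau> - m w = 2 * \<tau> / (w + 1)" if "Re w > 0" for w
    using nz[OF that] by (simp add: m_def diff_divide_eq_iff algebra_simps)
  have cm: "cayley \<tau> (m w) = w" if "Re w > 0" for w
  proof -
    have "\<tau> + m w = 2 * \<tau> * w / (w + 1)"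
      using nz[OF that] by (simp add: m_def add_divide_eq_iff algebra_simps)
    thus ?thesis unfolding cayley_def tm[OF that] using nz[OF that] \<tau>0 by simp
  qed
  have mc: "m (cayley \<tau> z) = z" if z: "cmod z < 1" for z
  proof -
    have "\<tau> - z \<noteq> 0" using unit_circle_neq[OF \<tau> z] by simp
    hence "cayley \<tau> z - 1 = 2 * z / (\<tau> - z)" "cayley \<tau> z + 1 = 2 * \<tau> / (\<tau> - z)"
      by (simp_all add: cayley_def divide_diff_eq_iff divide_add_eq_iff)
    thus ?thesis using \<open>\<tau> - z \<noteq> 0\<close> \<tau>0 by (simp add: m_def)
  qed
  have m1: "cmod (m w) < 1" if w: "Re w > 0" for w
  proof -
    have "\<tau> - m w \<noteq> 0" using tm[OF w] nz[OF w] \<tau>0 by simp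
    moreover have "(1 - (cmod (m w))\<^sup>2) / (cmod (\<tau> - m w))\<^sup>2 > 0"
      using w cm[OF w] Re_cayley[OF \<tau>, of "m w"] by simp
    ultimately have "1 - (cmod (m w))\<^sup>2 > 0" by (simp add: zero_less_divide_iff)
    thus ?thesis by (simp add: abs_square_less_1)
  qed
  have holm: "m holomorphic_on H"
    unfolding m_def by (intro holomorphic_intros) (use nz in \<open>auto simp: H_def\<close>)
  define g where "g = (\<lambda>w. 2 / Q (m w))"
  have Q0: "Q z \<noteq> 0" if "cmod z < 1" for z using ReQ[OF that] by auto
  have "(Q \<circ> m) holomorphic_on H"
    by (rule holomorphic_on_compose_gen[OF holm holQ]) (use m1 in \<open>auto simp: H_def\<close>)
  hence holg: "g holomorphic_on {w. Re w > 0}"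
    unfolding g_def o_def H_def by (intro holomorphic_intros) (use Q0 m1 in auto)
  have posg: "Re (g w) > 0" if "Re w > 0" for w
    using ReQ[OF m1[OF that]] unfolding g_def Re_complex_div_gt_0 by simp
  obtain V where flow: "half_plane_flow g V" using half_plane_flow_exists[OF holg posg] by blast
  define \<phi> where "\<phi> = (\<lambda>t z. m (V t (cayley \<tau> z)))"
  have VH: "Re (V t (cayley \<tau> z)) > 0" if "t \<ge> 0" "cmod z < 1" for t z
    using half_plane_flow_Re_le[OF flow that(1) Re_cayley_pos[OF \<tau> that(2)]] Re_cayley_pos[OF \<tau> that(2)] by linarith
  have c\<phi>: "cayley \<tau> (\<phi> t z) = V t (cayley \<tau> z)" and \<phi>1: "cmod (\<phi> t z) < 1" if "t \<ge> 0" "cmod z < 1" for t z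
    using cm[OF VH[OF that]] m1[OF VH[OF that]] by (simp_all add: \<phi>_def)
  have add: "\<phi> s (\<phi> t z) = \<phi> (s + t) z" if "s \<ge> 0" "t \<ge> 0" "cmod z < 1" for s t z
  proof -
    have "\<phi> s (\<phi> t z) = m (V s (V t (cayley \<tau> z)))" using c\<phi> that by (simp only: \<phi>_def)
    thus ?thesis using half_plane_flow_add[OF flow] Re_cayley_pos[OF \<tau>] that by (simp add: \<phi>_def)
  qed
  have zero: "\<phi> 0 z = z" if "cmod z < 1" for z
    using half_plane_flow_0[OF flow Re_cayley_pos[OF \<tau> that]] mc[OF that] by (simp add: \<phi>_def)
  have der: "((\<lambda>s. \<phi> s z) has_vector_derivative G (\<phi> t z)) (at t within {0..})" if t: "t \<ge> 0" and z: "cmod z < 1" for t z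
  proof -
    define w where "w = V t (cayley \<tau> z)"
    have w: "Re w > 0" using VH[OF t z] by (simp add: w_def)
    have mw: "m w = \<phi> t z" by (simp add: w_def \<phi>_def)
    have "(m has_field_derivative 2 * \<tau> / (w + 1)\<^sup>2) (at w)"
      unfolding m_def
      by (rule derivative_eq_intros refl | use nz[OF w] in \<open>simp add: power2_eq_square algebra_simps\<close>)+
    from field_vector_diff_chain_at[OF half_plane_flow_derivative[OF flow t Re_cayley_pos[OF \<tau> z]] this[unfolded w_def]]
    have "((\<lambda>s. \<phi> s z) has_vector_derivative g w * (2 * \<tau> / (w + 1)\<^sup>2)) (at t)"
      by (simp add: o_def \<phi>_def w_def)
    moreover have "g w * (2 * \<tau> / (w + 1)\<^sup>2) = G (\<phi> t z)"
    proof -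
      have "G (\<phi> t z) = (\<tau> - m w) * (cnj \<tau> * (\<tau> - m w)) / Q (m w)"
        using G[OF \<phi>1[OF t z]] by (simp add: mw one_minus_cnj_unit_mult[OF \<tau>])
      also have "\<dots> = (cnj \<tau> * \<tau>) * (4 * \<tau> / ((w + 1)\<^sup>2 * Q (m w)))"
        unfolding tm[OF w] by (simp add: power2_eq_square)
      finally show ?thesis unfolding unit_cnj_mult[OF \<tau>] by (simp add: g_def)
    qed
    ultimately show ?thesis by (simp add: has_vector_derivative_at_within)
  qed
  have hol: "\<phi> t holomorphic_on ball 0 1" if t: "t \<ge> 0" for t
  proof -
    have "(V t \<circ> cayley \<tau>) holomorphic_on ball 0 1"
      by (rule holomorphic_on_compose_gen[OF cayley_holomorphic[OF \<tau>] half_plane_flow_holomorphic[OF flow t]]) (use Re_cayley_pos[OF \<tau>] in auto)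
    hence "(m \<circ> (V t \<circ> cayley \<tau>)) holomorphic_on ball 0 1"
      by (rule holomorphic_on_compose_gen[OF _ holm]) (use VH[OF t] in \<open>auto simp: H_def\<close>)
    thus ?thesis by (simp add: \<phi>_def o_def)
  qed
  have sg: "semigroup_disk \<phi>"
    by (rule semigroup_diskI[OF hol \<phi>1 zero add der])
  have "semigroup_DW \<phi> \<tau>"
    unfolding semigroup_DW_def
  proof (intro allI impI)
    fix t :: real assume t: "t \<ge> 0" and "\<not> (\<forall>z\<in>ball 0 1. \<phi> t z = z)"
    hence tpos: "t > 0" using zero by (cases "t = 0") auto
    have "(\<lambda>n. (\<phi> t ^^ n) z) \<longlonglongrightarrow> \<tau>" if z: "cmod z < 1" for z
    proof -
      have it: "(\<phi> t ^^ n) z = \<phi> (of_nat n * t) z" for n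
      proof (induction n)
        case (Suc n)
        have "of_nat n * t \<ge> 0" using t by simp
        from add[OF t this z] show ?case using Suc by (simp add: algebra_simps)
      qed (simp add: zero[OF z])
      have "filterlim (\<lambda>n. t * real n) at_top sequentially"
        by (rule filterlim_tendsto_pos_mult_at_top[OF tendsto_const tpos filterlim_real_sequentially])
      hence "filterlim (\<lambda>n. V (t * real n) (cayley \<tau> z)) at_infinity sequentially"
        by (rule filterlim_compose[OF half_plane_flow_at_infinity[OF flow Re_cayley_pos[OF \<tau> z]]])
      hence "filterlim (\<lambda>n. 1 + V (t * real n) (cayley \<tau> z)) at_infinity sequentially"
        by (rule tendsto_add_filterlim_at_infinity[OF tendsto_const])
      hence "(\<lambda>n. 2 * \<tau> / (1 + V (t * real n) (cayley \<tau> z))) \<longlonglongrightarrow> 0"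
        by (rule tendsto_divide_0[OF tendsto_const])
      hence "(\<lambda>n. \<tau> - 2 * \<tau> / (1 + V (t * real n) (cayley \<tau> z))) \<longlonglongrightarrow> \<tau> - 0"
        by (intro tendsto_diff tendsto_const)
      moreover have "\<tau> - 2 * \<tau> / (1 + V (t * real n) (cayley \<tau> z)) = (\<phi> t ^^ n) z" for n
        using tm[OF VH[OF _ z, of "t * real n"]] t unfolding it
        by (simp add: \<phi>_def mult.commute add.commute algebra_simps)
      ultimately show ?thesis by simp
    qed
    thus "DW_point (\<phi> t) \<tau>" using \<tau> by (simp add: DW_point_def)
  qed
  moreover have "generator_of \<phi> G" using holG der by (simp add: generator_of_def)
  ultimately show ?thesis using sg by blast
qed

text \<open>The involution \<open>\<psi>\<close> exchanges \<tau> and 0, and in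
  \<open>u = \<psi> z\<close> the equation is \<open>u' = - u * a / Q (\<psi> u)\<close>. Its
  logarithm removes the zero at the origin and leaves a field with positive real part; the flow
  found there is periodic and descends to the punctured disk.\<close>

lemma semigroup_exists_interior:
  assumes holQ: "Q holomorphic_on ball 0 1" and ReQ: "\<And>z. cmod z < 1 \<Longrightarrow> Re (Q z) > 0"
    and \<tau>: "cmod \<tau> < 1" and holG: "G holomorphic_on ball 0 1"
    and G: "\<And>z. cmod z < 1 \<Longrightarrow> G z = (\<tau> - z) * (1 - cnj \<tau> * z) / Q z"
  shows "\<exists>\<phi>. semigroup_disk \<phi> \<and> generator_of \<phi> G \<and> semigroup_DW \<phi> \<tau>"
proof -
  define H where "H = {w::complex. Re w > 0}"
  define \<psi> where "\<psi> = (\<lambda>z. (\<tau> - z) / (1 - cnj \<tau> * z))"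
  define a where "a = 1 - (cmod \<tau>)\<^sup>2"
  have a: "a > 0" using one_minus_norm_square_pos[OF \<tau>] by (simp add: a_def)
  have ca: "of_real a = 1 - \<tau> * cnj \<tau>" by (simp add: a_def complex_norm_square[symmetric])
  have nz: "1 - cnj \<tau> * z \<noteq> 0" if "cmod z < 1" for z
    using one_minus_cnj_mult_nonzero[OF less_imp_le[OF \<tau>] that] .
  have \<psi>M: "\<psi> z = - Moebius_function 0 \<tau> z" for z
    by (simp add: \<psi>_def Moebius_function_simple minus_divide_left)
  have \<psi>1: "cmod (\<psi> z) < 1" if "cmod z < 1" for z
    using Moebius_function_norm_lt_1[OF \<tau> that] by (simp add: \<psi>M)
  have hol\<psi>: "\<psi> holomorphic_on ball 0 1"
    unfolding \<psi>_def by (intro holomorphic_intros) (use nz in auto)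
  have t\<psi>: "\<tau> - \<psi> u = of_real a * u / (1 - cnj \<tau> * u)" "1 - cnj \<tau> * \<psi> u = of_real a / (1 - cnj \<tau> * u)" if "cmod u < 1" for u
    using nz[OF that] unfolding ca by (simp_all add: \<psi>_def diff_divide_eq_iff algebra_simps)
  have \<psi>\<psi>: "\<psi> (\<psi> z) = z" if "cmod z < 1" for z
  proof -
    have "\<psi> (\<psi> z) = (\<tau> - \<psi> z) / (1 - cnj \<tau> * \<psi> z)" by (simp only: \<psi>_def)
    thus ?thesis unfolding t\<psi>[OF that] using a nz[OF that] by simp
  qed
  have \<psi>0: "\<psi> 0 = \<tau>" and \<psi>\<tau>: "\<psi> \<tau> = 0" by (simp_all add: \<psi>_def)
  have eneg: "cmod (exp (- v)) < 1" if "Re v > 0" for v using that by simp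
  \<comment> \<open>The coordinate \<open>v\<close> with \<open>\<psi> z = exp (- v)\<close> lifts the disk without \<open>\<tau>\<close> to the right half-plane.\<close>
  define g where "g = (\<lambda>v. of_real a / Q (\<psi> (exp (- v))))"
  have Q0: "Q z \<noteq> 0" if "cmod z < 1" for z using ReQ[OF that] by auto
  have "(\<psi> \<circ> (\<lambda>v. exp (- v))) holomorphic_on H"
    by (rule holomorphic_on_compose_gen[OF _ hol\<psi>]) (use eneg in \<open>auto simp: H_def intro!: holomorphic_intros\<close>)
  hence "(Q \<circ> (\<psi> \<circ> (\<lambda>v. exp (- v)))) holomorphic_on H"
    by (rule holomorphic_on_compose_gen[OF _ holQ]) (use eneg \<psi>1 in \<open>auto simp: H_def\<close>)
  hence holg: "g holomorphic_on {w. Re w > 0}"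
    unfolding g_def o_def H_def by (intro holomorphic_intros) (use Q0 \<psi>1 eneg in auto)
  have posg: "Re (g w) > 0" if "Re w > 0" for w
    using ReQ[OF \<psi>1[OF eneg[OF that]]] a unfolding g_def Re_complex_div_gt_0 by simp
  obtain V where flow: "half_plane_flow g V" using half_plane_flow_exists[OF holg posg] by blast
  have VH: "Re (V t v) > 0" if "t \<ge> 0" "Re v > 0" for t v
    using half_plane_flow_Re_le[OF flow that] that by linarith
  define \<Phi> where "\<Phi> = (\<lambda>t u. if u = 0 then 0 else exp (- V t (- Ln u)))"
  have \<Phi>_exp: "\<Phi> t (exp (- v)) = exp (- V t v)" if t: "t \<ge> 0" and v: "Re v > 0" for t v
  proof -
    \<comment> \<open>The discrepancy between the principal logarithm and the chosen
      \<open>v\<close>. It is an imaginary period of \<open>g\<close>, so the choice of branch does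
      not affect the value of \<open>\<Phi>\<close>.\<close>
    define c where "c = - Ln (exp (- v)) - v"
    have ec: "exp (- c) = 1" by (simp add: c_def exp_diff exp_add exp_minus)
    have "Re c = 0" by (simp add: c_def)
    moreover have "g (x + c) = g x" for x
    proof -
      have "exp (- (x + c)) = exp (- x) * exp (- c)" by (simp add: exp_add[symmetric])
      thus ?thesis by (simp only: g_def ec mult_1_right)
    qed
    ultimately have "V t (v + c) = V t v + c" by (intro half_plane_flow_translate[OF flow] t v)
    moreover have "v + c = - Ln (exp (- v))" by (simp add: c_def)
    ultimately have "\<Phi> t (exp (- v)) = exp (- (V t v + c))" by (simp add: \<Phi>_def)
    also have "\<dots> = exp (- V t v) * exp (- c)" by (simp add: exp_add[symmetric])
    finally show ?thesis by (simp add: ec)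
  qed
  have exp_ex: "\<exists>v. Re v > 0 \<and> u = exp (- v)" if "cmod u < 1" "u \<noteq> 0" for u
    by (rule exI[of _ "- Ln u"]) (use that in simp)
  have \<Phi>_le: "cmod (\<Phi> t u) \<le> cmod u" if t: "t \<ge> 0" and u: "cmod u < 1" for t u
  proof (cases "u = 0")
    case False
    then obtain v where v: "Re v > 0" "u = exp (- v)" using exp_ex[OF u] by auto
    show ?thesis unfolding v(2) \<Phi>_exp[OF t v(1)] using half_plane_flow_Re_le[OF flow t v(1)] by simp
  qed (simp add: \<Phi>_def)
  have \<Phi>1: "cmod (\<Phi> t u) < 1" if "t \<ge> 0" "cmod u < 1" for t u
    using \<Phi>_le[OF that] that by linarith
  have \<Phi>0: "\<Phi> 0 u = u" if u: "cmod u < 1" for u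
  proof (cases "u = 0")
    case False
    then obtain v where v: "Re v > 0" "u = exp (- v)" using exp_ex[OF u] by auto
    show ?thesis unfolding v(2) \<Phi>_exp[OF order.refl v(1)] half_plane_flow_0[OF flow v(1)] ..
  qed (simp add: \<Phi>_def)
  have \<Phi>add: "\<Phi> s (\<Phi> t u) = \<Phi> (s + t) u" if s: "s \<ge> 0" and t: "t \<ge> 0" and u: "cmod u < 1" for s t u
  proof (cases "u = 0")
    case False
    then obtain v where v: "Re v > 0" "u = exp (- v)" using exp_ex[OF u] by auto
    have st: "s + t \<ge> 0" using s t by simp
    show ?thesis unfolding v(2) \<Phi>_exp[OF t v(1)] \<Phi>_exp[OF st v(1)] \<Phi>_exp[OF s VH[OF t v(1)]] half_plane_flow_add[OF flow s t v(1)] ..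
  qed (simp add: \<Phi>_def)
  have hol\<Phi>: "\<Phi> t holomorphic_on ball 0 1" if t: "t \<ge> 0" for t
  proof (rule no_isolated_singularity)
    show "\<Phi> t holomorphic_on ball 0 1 - {0}"
      unfolding holomorphic_on_def
    proof
      fix u0 :: complex assume "u0 \<in> ball 0 1 - {0}"
      hence u0: "u0 \<noteq> 0" "cmod u0 < 1" by auto
      \<comment> \<open>On this half of the punctured disk around \<open>u0\<close>,
        \<open>u / u0\<close> has positive real part, so \<open>Ln (u / u0) + Ln u0\<close> is a
        holomorphic logarithm even when \<open>u0\<close> lies on the branch cut of
        \<open>Ln\<close>.\<close>
      define S where "S = (ball 0 1 - {0}) \<inter> {u. Re (u / u0) > 0}"
      have opS: "open S" unfolding S_def
        by (intro open_Int open_Diff) (auto intro!: open_Collect_less continuous_intros simp: u0)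
      have u0S: "u0 \<in> S" using u0 by (simp add: S_def)
      define b where "b = (\<lambda>u. - (Ln (u / u0) + Ln u0))"
      have eb: "exp (- b u) = u" if "u \<in> S" for u
        using that u0 by (simp add: b_def exp_add S_def)
      have bH: "Re (b u) > 0" if "u \<in> S" for u
      proof -
        have "exp (- Re (b u)) = cmod u" using eb[OF that] by (metis norm_exp_eq_Re uminus_complex.sel(1))
        moreover have "cmod u < 1" using that by (simp add: S_def)
        ultimately show ?thesis by (metis exp_less_one_iff neg_less_0_iff_less)
      qed
      have holb: "b holomorphic_on S"
        unfolding b_def using u0
        by (intro holomorphic_intros) (auto simp: S_def complex_nonpos_Reals_iff)
      have "(V t \<circ> b) holomorphic_on S"
        by (rule holomorphic_on_compose_gen[OF holb half_plane_flow_holomorphic[OF flow t]]) (use bH in auto)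
      hence "(\<lambda>u. exp (- V t (b u))) holomorphic_on S"
        unfolding o_def by (intro holomorphic_intros)
      moreover have "exp (- V t (b u)) = \<Phi> t u" if "u \<in> S" for u
        using \<Phi>_exp[OF t bH[OF that]] eb[OF that] by simp
      ultimately have "\<Phi> t holomorphic_on S" by (simp cong: holomorphic_cong)
      hence "\<Phi> t field_differentiable (at u0)" using opS u0S by (rule holomorphic_on_imp_differentiable_at)
      thus "\<Phi> t field_differentiable (at u0 within ball 0 1 - {0})" by (rule field_differentiable_at_within)
    qed
    hence c1: "continuous_on (ball 0 1 - {0}) (\<Phi> t)" by (rule holomorphic_on_imp_continuous_on)
    show "continuous_on (ball 0 1) (\<Phi> t)"
    proof (rule continuous_at_imp_continuous_on, rule ballI)
      fix u :: complex assume u: "u \<in> ball 0 1"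
      show "isCont (\<Phi> t) u"
      proof (cases "u = 0")
        case False
        have "open (ball 0 1 - {0::complex})" by (intro open_Diff) auto
        thus ?thesis using c1 u False by (simp add: continuous_on_eq_continuous_at)
      next
        case True
        \<comment> \<open>The bound \<open>|\<Phi> t u| \<le> |u|\<close> gives continuity at the
          puncture, which makes the singularity removable.\<close>
        have "(\<Phi> t \<longlongrightarrow> 0) (at 0)"
        proof (rule Lim_null_comparison)
          show "eventually (\<lambda>u. norm (\<Phi> t u) \<le> cmod u) (at 0)"
            using eventually_at_in_open[of "ball 0 1" "0::complex"]
            by (auto elim!: eventually_mono intro: \<Phi>_le[OF t])
          show "(cmod \<longlongrightarrow> 0) (at 0)" by (rule tendsto_norm_zero) simp
        qed
        thus ?thesis using True by (simp add: isCont_def \<Phi>_def)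
      qed
    qed
  qed auto
  define \<phi> where "\<phi> = (\<lambda>t z. \<psi> (\<Phi> t (\<psi> z)))"
  have \<phi>1: "cmod (\<phi> t z) < 1" if "t \<ge> 0" "cmod z < 1" for t z
    unfolding \<phi>_def by (intro \<psi>1 \<Phi>1 that)
  have add: "\<phi> s (\<phi> t z) = \<phi> (s + t) z" if "s \<ge> 0" "t \<ge> 0" "cmod z < 1" for s t z
    using \<psi>\<psi>[OF \<Phi>1[OF that(2) \<psi>1[OF that(3)]]] \<Phi>add[OF that(1,2) \<psi>1[OF that(3)]] by (simp add: \<phi>_def)
  have zero: "\<phi> 0 z = z" if "cmod z < 1" for z
    using \<Phi>0[OF \<psi>1[OF that]] \<psi>\<psi>[OF that] by (simp add: \<phi>_def)
  have hol: "\<phi> t holomorphic_on ball 0 1" if t: "t \<ge> 0" for t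
  proof -
    have "(\<Phi> t \<circ> \<psi>) holomorphic_on ball 0 1"
      by (rule holomorphic_on_compose_gen[OF hol\<psi> hol\<Phi>[OF t]]) (use \<psi>1 in auto)
    hence "(\<psi> \<circ> (\<Phi> t \<circ> \<psi>)) holomorphic_on ball 0 1"
      by (rule holomorphic_on_compose_gen[OF _ hol\<psi>]) (use \<Phi>1[OF t] \<psi>1 in auto)
    thus ?thesis by (simp add: \<phi>_def o_def)
  qed
  have \<phi>\<tau>: "\<phi> t \<tau> = \<tau>" for t by (simp add: \<phi>_def \<psi>\<tau> \<psi>0 \<Phi>_def)
  have der: "((\<lambda>s. \<phi> s z) has_vector_derivative G (\<phi> t z)) (at t within {0..})" if t: "t \<ge> 0" and z: "cmod z < 1" for t z
  proof (cases "z = \<tau>")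
    case True
    thus ?thesis by (simp add: \<phi>\<tau> G[OF \<tau>])
  next
    case False
    have "\<psi> z \<noteq> 0" using False nz[OF z] by (simp add: \<psi>_def)
    then obtain v where v: "Re v > 0" "\<psi> z = exp (- v)" using exp_ex[OF \<psi>1[OF z]] by auto
    have \<phi>v: "\<phi> s z = \<psi> (exp (- V s v))" if "s \<ge> 0" for s
      by (simp add: \<phi>_def v(2) \<Phi>_exp[OF that v(1)])
    define w where "w = V t v"
    define u where "u = exp (- w)"
    have u: "cmod u < 1" unfolding u_def w_def by (intro eneg VH t v)
    have d\<psi>: "(\<psi> has_field_derivative - of_real a / (1 - cnj \<tau> * u)\<^sup>2) (at u)"
      unfolding \<psi>_def ca
      by (rule derivative_eq_intros refl | use nz[OF u] in \<open>simp add: power2_eq_square algebra_simps\<close>)+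
    have "((\<lambda>w. exp (- w)) has_field_derivative - u) (at w)"
      unfolding u_def by (auto intro!: derivative_eq_intros)
    from DERIV_chain[OF d\<psi>[unfolded u_def] this]
    have "(\<psi> \<circ> (\<lambda>w. exp (- w)) has_field_derivative - of_real a / (1 - cnj \<tau> * u)\<^sup>2 * - u) (at (V t v))"
      by (simp add: u_def w_def)
    from field_vector_diff_chain_at[OF half_plane_flow_derivative[OF flow t v(1)] this]
    have "((\<lambda>s. \<psi> (exp (- V s v))) has_vector_derivative g w * (- of_real a / (1 - cnj \<tau> * u)\<^sup>2 * - u)) (at t)"
      by (simp add: o_def w_def)
    moreover have "g w * (- of_real a / (1 - cnj \<tau> * u)\<^sup>2 * - u) = G (\<psi> u)"
      unfolding G[OF \<psi>1[OF u]] t\<psi>[OF u] g_def u_def[symmetric] by (simp add: power2_eq_square mult_ac)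
    ultimately have "((\<lambda>s. \<psi> (exp (- V s v))) has_vector_derivative G (\<phi> t z)) (at t within {0..})"
      using \<phi>v[OF t] by (simp add: u_def w_def has_vector_derivative_at_within)
    thus ?thesis by (rule has_vector_derivative_transform[rotated 2]) (use t \<phi>v in auto)
  qed
  have sg: "semigroup_disk \<phi>" by (rule semigroup_diskI[OF hol \<phi>1 zero add der])
  have "semigroup_DW \<phi> \<tau>" using \<phi>\<tau> \<tau> by (simp add: semigroup_DW_def DW_point_def)
  moreover have "generator_of \<phi> G" using holG der by (simp add: generator_of_def)
  ultimately show ?thesis using sg by blast
qed

lemma semigroup_exists:
  assumes holQ: "Q holomorphic_on ball 0 1" and ReQ: "\<And>z. cmod z < 1 \<Longrightarrow> Re (Q z) > 0"
    and \<tau>: "cmod \<tau> \<le> 1"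
    and G: "\<And>z. cmod z < 1 \<Longrightarrow> G z = (\<tau> - z) * (1 - cnj \<tau> * z) / Q z"
  shows "\<exists>\<phi>. semigroup_disk \<phi> \<and> generator_of \<phi> G \<and> semigroup_DW \<phi> \<tau>"
proof -
  have Q0: "Q z \<noteq> 0" if "cmod z < 1" for z using ReQ[OF that] by auto
  have "(\<lambda>z. (\<tau> - z) * (1 - cnj \<tau> * z) / Q z) holomorphic_on ball 0 1"
    by (intro holomorphic_intros holQ) (simp add: Q0)
  hence holG: "G holomorphic_on ball 0 1" by (rule holomorphic_transform) (simp add: G)
  show ?thesis
  proof (cases "cmod \<tau> = 1")
    case True
    show ?thesis by (rule semigroup_exists_boundary[OF holQ ReQ True holG G])
  next
    case False
    hence \<tau>': "cmod \<tau> < 1" using \<tau> by simp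
    show ?thesis by (rule semigroup_exists_interior[OF holQ ReQ \<tau>' holG G])
  qed
qed

section \<open>The representation theorem\<close>

lemma pstar_cayley_other:
  assumes "cmod \<sigma> = 1" "\<rho> \<noteq> \<sigma>"
  shows "pstar_eq (cayley \<rho>) \<sigma> 0"
  using assms by (intro pstar_isCont) (auto simp: cayley_def[abs_def] intro!: continuous_intros)

text \<open>The index \<open>j\<close> may lie outside \<open>A\<close>; this case serves the
  successive subtraction of masses, where the next point is not among those already treated.\<close>

lemma pstar_cayley_sum:
  assumes "finite A" "cmod (\<sigma> j) = 1" "inj_on \<sigma> (insert j A)"
  shows "pstar_eq (\<lambda>z. \<Sum>k\<in>A. of_real (a k) * cayley (\<sigma> k) z) (\<sigma> j) (of_real (if j \<in> A then 2 * a j else 0))"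
  using assms
proof (induction A rule: finite_induct)
  case empty
  thus ?case by (auto simp: pstar_eq_def has_angular_limit_def)
next
  case (insert i A)
  have IH: "pstar_eq (\<lambda>z. \<Sum>k\<in>A. of_real (a k) * cayley (\<sigma> k) z) (\<sigma> j) (of_real (if j \<in> A then 2 * a j else 0))"
    by (rule insert.IH) (use insert.prems in \<open>auto intro: inj_on_subset\<close>)
  have "pstar_eq (cayley (\<sigma> i)) (\<sigma> j) (if i = j then 2 else 0)"
  proof (cases "i = j")
    case True
    thus ?thesis using pstar_cayley_self insert.prems by simp
  next
    case False
    hence "\<sigma> i \<noteq> \<sigma> j" using insert.prems(2) by (auto simp: inj_on_def)
    thus ?thesis using False pstar_cayley_other insert.prems by simp
  qed
  from pstar_add[OF pstar_cmult[OF this, of "of_real (a i)"] IH]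
  show ?case using insert.hyps by (cases "i = j") (auto simp: mult.commute)
qed

text \<open>The kernels are removed one at a time. Kernels at other points do not change the mass at
  \<open>\<sigma> m\<close>, so the remainder \<open>R\<close> still dominates
  \<open>c m / 2\<close> times the Poisson kernel there and can spare \<open>a m\<close> of
  it.\<close>

lemma herglotz_subtract_masses:
  fixes n :: nat
  assumes P: "herglotz P" and circ: "\<And>k. k < n \<Longrightarrow> cmod (\<sigma> k) = 1" and inj: "inj_on \<sigma> {..<n}"
    and star: "\<And>k. k < n \<Longrightarrow> pstar_eq P (\<sigma> k) (of_real (c k))"
    and a: "\<And>k. k < n \<Longrightarrow> 0 < a k \<and> 2 * a k \<le> c k"
  shows "herglotz (\<lambda>z. P z - (\<Sum>k<n. of_real (a k) * cayley (\<sigma> k) z))"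
proof -
  have "m \<le> n \<Longrightarrow> herglotz (\<lambda>z. P z - (\<Sum>k<m. of_real (a k) * cayley (\<sigma> k) z))" for m
  proof (induction m)
    case 0
    thus ?case using P by simp
  next
    case (Suc m)
    hence m: "m < n" by simp
    define R where "R = (\<lambda>z. P z - (\<Sum>k<m. of_real (a k) * cayley (\<sigma> k) z))"
    have R: "herglotz R" using Suc by (simp add: R_def)
    have "pstar_eq (\<lambda>z. \<Sum>k<m. of_real (a k) * cayley (\<sigma> k) z) (\<sigma> m) (of_real 0)"
      using pstar_cayley_sum[of "{..<m}" \<sigma> m a] circ[OF m] inj_on_subset[OF inj, of "insert m {..<m}"] m
      by (auto simp: less_imp_le)
    from pstar_add[OF star[OF m] pstar_cmult[OF this, of "-1"]]
    have "pstar_eq R (\<sigma> m) (of_real (c m))" by (simp add: R_def)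
    from herglotz_radial_mass[OF R circ[OF m] _ pstar_radial[OF circ[OF m] this]]
    have le: "c m / 2 * Re (cayley (\<sigma> m) z) \<le> Re (R z)" if "cmod z < 1" for z
      using that a[OF m] by simp
    have "Re (R z - of_real (a m) * cayley (\<sigma> m) z) \<ge> 0" if z: "cmod z < 1" for z
    proof -
      have "a m * Re (cayley (\<sigma> m) z) \<le> c m / 2 * Re (cayley (\<sigma> m) z)"
        using a[OF m] Re_cayley_pos[OF circ[OF m] z] by (intro mult_right_mono) auto
      thus ?thesis using le[OF z] by simp
    qed
    moreover have "(\<lambda>z. R z - of_real (a m) * cayley (\<sigma> m) z) holomorphic_on ball 0 1"
      using R cayley_holomorphic[OF circ[OF m]] by (auto simp: herglotz_def intro!: holomorphic_intros)
    ultimately have "herglotz (\<lambda>z. R z - of_real (a m) * cayley (\<sigma> m) z)" by (auto simp: herglotz_def)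
    thus ?case by (simp add: R_def algebra_simps)
  qed
  thus ?thesis by simp
qed

lemma BRFP_angular_derivative:
  "BRFP_spectral \<phi> \<sigma> l \<Longrightarrow> t \<ge> 0 \<Longrightarrow>
    has_angular_limit (\<lambda>z. (\<phi> t z - \<sigma>) / (z - \<sigma>)) \<sigma> (of_real (exp (- l * t)))"
  by (simp add: BRFP_spectral_def)

text \<open>A zero generator yields the identity, whose angular derivative 1 forces
  \<open>l = 0\<close>. This excludes \<open>G = 0\<close> from the class with prescribed negative
  spectral values.\<close>

lemma generator_nonzero_of_BRFP:
  assumes sg: "semigroup_disk \<phi>" and gen: "generator_of \<phi> G" and B: "BRFP_spectral \<phi> \<sigma> l" and l: "l \<noteq> 0"
  shows "\<exists>z\<in>ball 0 1. G z \<noteq> 0"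
proof (rule ccontr)
  assume "\<not> ?thesis"
  hence G0: "G z = 0" if "cmod z < 1" for z using that by auto
  have \<sigma>: "cmod \<sigma> = 1" using B by (simp add: BRFP_spectral_def)
  have id: "\<phi> 1 z = z" if z: "cmod z < 1" for z
  proof -
    have "cmod (\<phi> 1 z - \<phi> 0 z) \<le> 0 * 1"
    proof (rule increment_le_of_derivative_bound)
      show "((\<lambda>s. \<phi> s z) has_vector_derivative G (\<phi> t z)) (at t within {0..})" if "t \<in> {0..1}" for t
        using generator_derivative[OF sg gen z] that by simp
      show "cmod (G (\<phi> t z)) \<le> 0" if "t \<in> {0..1}" for t
        using G0 semigroup_disk_norm[OF sg _ z] that by simp
    qed simp
    thus ?thesis using semigroup_disk_0[OF sg z] by simp
  qed
  have "has_angular_limit (\<lambda>z. (\<phi> 1 z - \<sigma>) / (z - \<sigma>)) \<sigma> (of_real (exp (- l * 1)))"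
    by (rule BRFP_angular_derivative[OF B]) simp
  hence "has_angular_limit (\<lambda>z. 1) \<sigma> (of_real (exp (- l * 1)))"
    by (rule angular_limit_cong[rotated]) (use id unit_circle_neq[OF \<sigma>] in auto)
  moreover have "has_angular_limit (\<lambda>z. 1) \<sigma> 1" by (simp add: has_angular_limit_def)
  ultimately have "complex_of_real (exp (- l * 1)) = 1" by (rule angular_limit_unique[OF \<sigma>])
  hence "exp (- l * 1) = 1" by (metis of_real_eq_1_iff)
  thus False using l by simp
qed

lemma BRFP_spectral_unique:
  assumes "BRFP_spectral \<phi> \<sigma> l" "BRFP_spectral \<phi> \<sigma> l'"
  shows "l = l'"
proof -
  have \<sigma>: "cmod \<sigma> = 1" using assms(1) by (simp add: BRFP_spectral_def)
  have "complex_of_real (exp (- l * 1)) = of_real (exp (- l' * 1))"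
    by (rule angular_limit_unique[OF \<sigma>]) (rule BRFP_angular_derivative[OF assms(1)] BRFP_angular_derivative[OF assms(2)], simp)+
  thus ?thesis by simp
qed

section \<open>The two equivalences for fixed boundary data\<close>

locale BRFP_data =
  fixes \<sigma> :: "nat \<Rightarrow> complex" and lam :: "nat \<Rightarrow> real" and n :: nat and \<tau> :: complex
  assumes n_pos: "1 \<le> n"
    and circ: "k < n \<Longrightarrow> cmod (\<sigma> k) = 1"
    and inj: "inj_on \<sigma> {..<n}"
    and tau_in: "cmod \<tau> \<le> 1"
    and ne: "k < n \<Longrightarrow> \<tau> \<noteq> \<sigma> k"
    and lneg: "k < n \<Longrightarrow> lam k < 0"
begin

text \<open>The coefficients of \<open>p0\<close>. The resulting mass \<open>2 * a k\<close> is the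
  one that corresponds to the spectral value \<open>lam k\<close>.\<close>

definition a :: "nat \<Rightarrow> real" where
  "a k = (cmod (\<tau> - \<sigma> k))\<^sup>2 / (2 * \<bar>lam k\<bar>)"

definition rep :: "(complex \<Rightarrow> complex) \<Rightarrow> (complex \<Rightarrow> complex) \<Rightarrow> bool" where
  "rep G p \<longleftrightarrow> (\<forall>z\<in>ball 0 1. G z = (\<tau> - z) * (1 - cnj \<tau> * z) / (p z + p0 \<tau> \<sigma> lam n z))"

lemma a_pos:
  assumes "k < n"
  shows "a k > 0"
  unfolding a_def using lneg[OF assms] ne[OF assms] by (intro divide_pos_pos) auto

lemma a_lam: "k < n \<Longrightarrow> (cmod (\<tau> - \<sigma> k))\<^sup>2 = 2 * a k * - lam k"
  using lneg[of k] by (simp add: a_def)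

lemma p0_eq: "p0 \<tau> \<sigma> lam n z = (\<Sum>k<n. of_real (a k) * cayley (\<sigma> k) z)"
  by (simp add: p0_def a_def cayley_def)

lemma pstar_p0:
  assumes "k < n"
  shows "pstar_eq (p0 \<tau> \<sigma> lam n) (\<sigma> k) (of_real (2 * a k))"
  using pstar_cayley_sum[of "{..<n}" \<sigma> k a] circ[OF assms] inj assms
  by (simp add: p0_eq[abs_def] insert_absorb)

lemma p0_holomorphic: "p0 \<tau> \<sigma> lam n holomorphic_on ball 0 1"
  unfolding p0_eq[abs_def] by (intro holomorphic_intros cayley_holomorphic circ) simp

lemma Re_p0_pos:
  assumes "cmod z < 1"
  shows "Re (p0 \<tau> \<sigma> lam n z) > 0"
proof -
  have "0 < (\<Sum>k<n. a k * Re (cayley (\<sigma> k) z))"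
    using n_pos a_pos Re_cayley_pos[OF circ assms] by (intro sum_pos) (auto intro!: mult_pos_pos simp: lessThan_empty_iff)
  thus ?thesis by (simp add: p0_eq)
qed

text \<open>Quantifying over the mass \<open>c\<close> of \<open>p\<close> inside the existential
  lets one semigroup serve both equivalences: the first takes whatever mass \<open>p\<close> has,
  the second takes \<open>c = 0\<close>.\<close>

lemma semigroup_of_representation:
  assumes p: "herglotz p" and G: "rep G p"
  shows "\<exists>\<phi>. semigroup_disk \<phi> \<and> generator_of \<phi> G \<and> semigroup_DW \<phi> \<tau> \<and>
    (\<forall>k<n. \<forall>c. pstar_eq p (\<sigma> k) (of_real c) \<and> c \<ge> 0 \<longrightarrow>
       BRFP_spectral \<phi> (\<sigma> k) (- ((cmod (\<tau> - \<sigma> k))\<^sup>2 / (c + 2 * a k))))"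
proof -
  define Q where "Q = (\<lambda>z. p z + p0 \<tau> \<sigma> lam n z)"
  have holQ: "Q holomorphic_on ball 0 1"
    unfolding Q_def using p p0_holomorphic by (auto simp: herglotz_def intro!: holomorphic_intros)
  have ReQ: "Re (Q z) > 0" if "cmod z < 1" for z
    using Re_p0_pos[OF that] herglotz_Re_nonneg[OF p that] by (simp add: Q_def)
  have Q: "herglotz Q" using holQ ReQ by (auto simp: herglotz_def intro: less_imp_le)
  have GQ: "G z = (\<tau> - z) * (1 - cnj \<tau> * z) / Q z" if "cmod z < 1" for z
    using G that by (simp add: rep_def Q_def)
  obtain \<phi> where \<phi>: "semigroup_disk \<phi>" "generator_of \<phi> G" "semigroup_DW \<phi> \<tau>"
    using semigroup_exists[OF holQ ReQ tau_in GQ] by auto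
  have "BRFP_spectral \<phi> (\<sigma> k) (- ((cmod (\<tau> - \<sigma> k))\<^sup>2 / (c + 2 * a k)))"
    if k: "k < n" and c: "pstar_eq p (\<sigma> k) (of_real c)" "c \<ge> 0" for k c
  proof (rule BRFP_of_mass[OF \<phi>(1,2) circ[OF k] ne[OF k] Q _ _ GQ])
    show "c + 2 * a k > 0" using c a_pos[OF k] by simp
    show "pstar_eq Q (\<sigma> k) (of_real (c + 2 * a k))"
      using pstar_add[OF c(1) pstar_p0[OF k]] by (simp add: Q_def)
  qed
  thus ?thesis using \<phi> by blast
qed

lemma representation_nonzero:
  assumes p: "herglotz p" and G: "rep G p"
  shows "\<exists>z\<in>ball 0 1. G z \<noteq> 0"
proof -
  obtain z where z: "cmod z < 1" "z \<noteq> \<tau>"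
  proof (cases "\<tau> = 0")
    case True
    show ?thesis by (rule that[of "1 / 2"]) (use True in auto)
  next
    case False
    show ?thesis by (rule that[of 0]) (use False in auto)
  qed
  have "Re (p z + p0 \<tau> \<sigma> lam n z) > 0"
    using Re_p0_pos[OF z(1)] herglotz_Re_nonneg[OF p z(1)] by simp
  hence "p z + p0 \<tau> \<sigma> lam n z \<noteq> 0" by (metis less_irrefl zero_complex.simps(1))
  moreover have "G z = (\<tau> - z) * (1 - cnj \<tau> * z) / (p z + p0 \<tau> \<sigma> lam n z)"
    using G z(1) by (simp add: rep_def)
  ultimately have "G z \<noteq> 0" using z one_minus_cnj_mult_nonzero[OF tau_in z(1)] by simp
  thus ?thesis using z by auto
qed

text \<open>The mass bound at \<open>l k\<close> and \<open>lam k \<le> l k\<close> give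
  \<open>2 * a k \<le> c k\<close>, so \<open>p0\<close> can be subtracted from \<open>Q\<close>.
  For \<open>l k = lam k\<close>, equality of the masses comes from computing the spectral value
  exactly with \<open>BRFP_of_mass\<close>.\<close>

lemma representation_of_generator:
  assumes sg: "semigroup_disk \<phi>" and gen: "generator_of \<phi> G" and DW: "semigroup_DW \<phi> \<tau>"
    and nz: "\<exists>z\<in>ball 0 1. G z \<noteq> 0"
    and B: "\<And>k. k < n \<Longrightarrow> lam k \<le> l k \<and> l k \<le> 0 \<and> BRFP_spectral \<phi> (\<sigma> k) (l k)"
  shows "\<exists>p. herglotz p \<and> rep G p \<and> (\<forall>k<n. l k = lam k \<longrightarrow> pstar_eq p (\<sigma> k) 0)"
proof -
  obtain Q where Q: "herglotz Q" "\<And>z. cmod z < 1 \<Longrightarrow> Q z \<noteq> 0"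
    "\<And>z. cmod z < 1 \<Longrightarrow> G z = (\<tau> - z) * (1 - cnj \<tau> * z) / Q z"
    using Berkson_Porta_representation[OF sg gen DW tau_in nz] by blast
  have "\<exists>c. c \<ge> 0 \<and> pstar_eq Q (\<sigma> k) (of_real c)" if "k < n" for k
    using herglotz_has_pstar[OF Q(1) circ[OF that]] by metis
  then obtain c where c: "\<And>k. k < n \<Longrightarrow> c k \<ge> 0" "\<And>k. k < n \<Longrightarrow> pstar_eq Q (\<sigma> k) (of_real (c k))"
    by metis
  have mass: "(cmod (\<tau> - \<sigma> k))\<^sup>2 \<le> c k * - l k" if k: "k < n" for k
    using BRFP_mass[OF sg gen _ Q(2,3) c(1)[OF k] c(2)[OF k]] B[OF k] by blast
  have ac: "2 * a k \<le> c k" if k: "k < n" for k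
  proof -
    have "c k * - l k \<le> c k * - lam k" using B[OF k] c(1)[OF k] by (intro mult_left_mono) auto
    hence "2 * a k * - lam k \<le> c k * - lam k" using mass[OF k] a_lam[OF k] by simp
    thus ?thesis using lneg[OF k] by (simp add: mult_le_cancel_right)
  qed
  define p where "p = (\<lambda>z. Q z - p0 \<tau> \<sigma> lam n z)"
  have "herglotz p"
    unfolding p_def p0_eq by (rule herglotz_subtract_masses[OF Q(1) circ inj c(2)]) (use ac a_pos in auto)
  moreover have "rep G p" using Q(3) by (simp add: rep_def p_def)
  moreover have "pstar_eq p (\<sigma> k) 0" if k: "k < n" and eq: "l k = lam k" for k
  proof -
    have cpos: "c k > 0" using ac[OF k] a_pos[OF k] by simp
    have "lam k = - ((cmod (\<tau> - \<sigma> k))\<^sup>2 / c k)"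
      using BRFP_spectral_unique[OF _ BRFP_of_mass[OF sg gen circ[OF k] ne[OF k] Q(1) cpos c(2)[OF k] Q(3)]] B[OF k] eq by auto
    hence "c k * - lam k = (2 * a k) * - lam k" using cpos a_lam[OF k] by (simp add: field_simps)
    hence "c k = 2 * a k" using lneg[OF k] by simp
    with pstar_add[OF c(2)[OF k] pstar_cmult[OF pstar_p0[OF k], of "-1"]]
    show ?thesis by (simp add: p_def)
  qed
  ultimately show ?thesis by blast
qed

lemma Gen_FL_iff_representation:
  "(Gen_FL \<tau> \<sigma> lam n G \<and> \<not> (\<forall>z\<in>ball 0 1. G z = 0)) \<longleftrightarrow> (\<exists>p. herglotz p \<and> rep G p)"
proof
  assume L: "Gen_FL \<tau> \<sigma> lam n G \<and> \<not> (\<forall>z\<in>ball 0 1. G z = 0)"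
  then obtain \<phi> where \<phi>: "semigroup_disk \<phi>" "generator_of \<phi> G" "semigroup_DW \<phi> \<tau>"
    and "\<forall>k<n. \<exists>l. lam k \<le> l \<and> l \<le> 0 \<and> BRFP_spectral \<phi> (\<sigma> k) l"
    unfolding Gen_FL_def by blast
  then obtain l where "\<And>k. k < n \<Longrightarrow> lam k \<le> l k \<and> l k \<le> 0 \<and> BRFP_spectral \<phi> (\<sigma> k) (l k)" by metis
  thus "\<exists>p. herglotz p \<and> rep G p" using representation_of_generator[OF \<phi>] L by blast
next
  assume "\<exists>p. herglotz p \<and> rep G p"
  then obtain p where p: "herglotz p" and G: "rep G p" by blast
  obtain \<phi> where \<phi>: "semigroup_disk \<phi>" "generator_of \<phi> G" "semigroup_DW \<phi> \<tau>"
    and B: "\<And>k c. k < n \<Longrightarrow> pstar_eq p (\<sigma> k) (of_real c) \<Longrightarrow> c \<ge> 0 \<Longrightarrow>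
       BRFP_spectral \<phi> (\<sigma> k) (- ((cmod (\<tau> - \<sigma> k))\<^sup>2 / (c + 2 * a k)))"
    using semigroup_of_representation[OF p G] by blast
  have "\<exists>l. lam k \<le> l \<and> l \<le> 0 \<and> BRFP_spectral \<phi> (\<sigma> k) l" if k: "k < n" for k
  proof -
    obtain c where c: "c \<ge> 0" "pstar_eq p (\<sigma> k) (of_real c)"
      using herglotz_has_pstar[OF p circ[OF k]] by metis
    have pos: "c + 2 * a k > 0" using c a_pos[OF k] by simp
    \<comment> \<open>Additional mass \<open>c\<close> in \<open>p\<close> only moves the spectral
      value from \<open>lam k\<close> towards 0, so it remains in the permitted interval.\<close>
    have "2 * a k * - lam k \<le> (c + 2 * a k) * - lam k"
      using c lneg[OF k] by (intro mult_right_mono) auto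
    hence "(cmod (\<tau> - \<sigma> k))\<^sup>2 / (c + 2 * a k) \<le> - lam k"
      unfolding pos_divide_le_eq[OF pos] a_lam[OF k] by (simp add: mult.commute)
    moreover have "(cmod (\<tau> - \<sigma> k))\<^sup>2 / (c + 2 * a k) \<ge> 0" using pos by simp
    ultimately show ?thesis using B[OF k c(2,1)] by (intro exI[of _ "- ((cmod (\<tau> - \<sigma> k))\<^sup>2 / (c + 2 * a k))"]) simp
  qed
  hence "Gen_FL \<tau> \<sigma> lam n G" unfolding Gen_FL_def using \<phi> by blast
  thus "Gen_FL \<tau> \<sigma> lam n G \<and> \<not> (\<forall>z\<in>ball 0 1. G z = 0)" using representation_nonzero[OF p G] by blast
qed

lemma Gen'_FL_iff_representation:
  "Gen'_FL \<tau> \<sigma> lam n G \<longleftrightarrow> (\<exists>p. herglotz p \<and> (\<forall>k<n. pstar_eq p (\<sigma> k) 0) \<and> rep G p)"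
proof
  assume "Gen'_FL \<tau> \<sigma> lam n G"
  then obtain \<phi> where \<phi>: "semigroup_disk \<phi>" "generator_of \<phi> G" "semigroup_DW \<phi> \<tau>"
    and B: "\<And>k. k < n \<Longrightarrow> BRFP_spectral \<phi> (\<sigma> k) (lam k)"
    unfolding Gen'_FL_def by blast
  \<comment> \<open>At least one boundary point is present, and its non-zero spectral value rules
    out \<open>G = 0\<close>, as the representation requires.\<close>
  have "0 < n" using n_pos by simp
  hence "\<exists>z\<in>ball 0 1. G z \<noteq> 0"
    using generator_nonzero_of_BRFP[OF \<phi>(1,2) B] lneg by force
  from representation_of_generator[OF \<phi> this, of lam]
  show "\<exists>p. herglotz p \<and> (\<forall>k<n. pstar_eq p (\<sigma> k) 0) \<and> rep G p"
    using B lneg by (auto simp: less_imp_le)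
next
  assume "\<exists>p. herglotz p \<and> (\<forall>k<n. pstar_eq p (\<sigma> k) 0) \<and> rep G p"
  then obtain p where p: "herglotz p" and G: "rep G p" and star: "\<And>k. k < n \<Longrightarrow> pstar_eq p (\<sigma> k) 0" by blast
  obtain \<phi> where \<phi>: "semigroup_disk \<phi>" "generator_of \<phi> G" "semigroup_DW \<phi> \<tau>"
    and B: "\<And>k c. k < n \<Longrightarrow> pstar_eq p (\<sigma> k) (of_real c) \<Longrightarrow> c \<ge> 0 \<Longrightarrow>
       BRFP_spectral \<phi> (\<sigma> k) (- ((cmod (\<tau> - \<sigma> k))\<^sup>2 / (c + 2 * a k)))"
    using semigroup_of_representation[OF p G] by blast
  have "BRFP_spectral \<phi> (\<sigma> k) (lam k)" if k: "k < n" for k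
    using B[OF k, of 0] star[OF k] a_lam[OF k] a_pos[OF k] by simp
  thus "Gen'_FL \<tau> \<sigma> lam n G" unfolding Gen'_FL_def using \<phi> by blast
qed

end

theorem theorem6p1:
  fixes \<sigma> :: "nat \<Rightarrow> complex" and lam :: "nat \<Rightarrow> real" and n :: nat and \<tau> :: complex
  assumes n_pos: "1 \<le> n"
    and on_circle: "\<forall>k<n. cmod (\<sigma> k) = 1"
    and distinct: "inj_on \<sigma> {..<n}"
    and tau_in: "cmod \<tau> \<le> 1"
    and tau_notin: "\<tau> \<notin> \<sigma> ` {..<n}"
    and lam_neg: "\<forall>k<n. lam k < 0"
  shows "(\<forall>G. (Gen_FL \<tau> \<sigma> lam n G \<and> \<not> (\<forall>z\<in>unit_disk. G z = 0)) \<longleftrightarrow>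
             (\<exists>p. herglotz p \<and>
                (\<forall>z\<in>unit_disk. G z = (\<tau> - z) * (1 - cnj \<tau> * z) / (p z + p0 \<tau> \<sigma> lam n z))))
       \<and> (\<forall>G. Gen'_FL \<tau> \<sigma> lam n G \<longleftrightarrow>
             (\<exists>p. herglotz p \<and> (\<forall>k<n. pstar_eq p (\<sigma> k) 0) \<and>
                (\<forall>z\<in>unit_disk. G z = (\<tau> - z) * (1 - cnj \<tau> * z) / (p z + p0 \<tau> \<sigma> lam n z))))"
proof -
  interpret BRFP_data \<sigma> lam n \<tau>
    using assms by unfold_locales auto
  show ?thesis
    using Gen_FL_iff_representation Gen'_FL_iff_representation unfolding rep_def by blast
qed

end
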